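(* Let $F$ be a field with $\operatorname{char} F\neq 2$, fix an algebraic closure of $F$, and let $a\in\dot F\setminus(F^2\cup -F^2)$. Then the element $-a$ is not rigid in $F$ if and only if at least one of the following holds: (1) there exist fields $F\subseteq F(\sqrt a)\subseteq E\subseteq L$ with $E/F$ and $L/F$ Galois, $\operatorname{Gal}(E/F)\cong C$ and $\operatorname{Gal}(L/F)\cong G_1$; (2) there exist fields $F\subseteq F(\sqrt a)\subseteq L$ with $L/F$ Galois, $\operatorname{Gal}(L/F(\sqrt a))\cong DD$ and $\operatorname{Gal}(L/F)\cong G_2$.
   Context: $\dot F=F\setminus\{0\}$; $D_F(q)$ is the set of elements of $\dot F$ represented by the quadratic form $q$, and $\langle 1,c\rangle$ is the form $x_1^2+cx_2^2$. An element $c\in\dot F\setminus(F^2\cup -F^2)$ is rigid if $D_F(\langle 1,c\rangle)=\dot F^2\cup c\dot F^2$. $C$ is the cyclic group of order $4$, $D$ the dihedral group of order $8$. $DD$ is the central product of two copies of $D$: if $g$ is the nontrivial central element of $D$, $DD=(D\times D)/\{1,(g,g)\}$. Commutators: $[\sigma,\tau]=\sigma^{-1}\tau^{-1}\sigma\tau$. $G_1$ is the group generated by $x,y$ with relations $x^4=y^2=1$, $[x,y]^2=1$, $[[x,y],x]^2=1$, and $[[x,y],x]$ commutes with $x$ and $y$. $G_2$ is the group generated by $x,y,z$ with relations $x^2=y^2=z^2=1$, $[x,y]^2=[x,z]^2=[y,z]=1$, $[y,[x,z]]=[z,[x,y]]$, this element having order dividing $2$ and commuting with $x,y,z$. *)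

theory Defs
  imports "HOL-Algebra.Elementary_Groups" "HOL-Algebra.Coset"
          "HOL-Computational_Algebra.Polynomial"
begin

definition is_subfield :: "'k::field set \<Rightarrow> bool" where
  "is_subfield S \<longleftrightarrow> 0 \<in> S \<and> 1 \<in> S \<and>
     (\<forall>x\<in>S. \<forall>y\<in>S. x + y \<in> S \<and> x * y \<in> S) \<and>
     (\<forall>x\<in>S. - x \<in> S) \<and> (\<forall>x\<in>S. inverse x \<in> S)"

definition poly_over :: "'k::field set \<Rightarrow> 'k poly \<Rightarrow> bool" where
  "poly_over F p \<longleftrightarrow> (\<forall>i. coeff p i \<in> F)"

definition algebraic_over :: "'k::field set \<Rightarrow> 'k \<Rightarrow> bool" where
  "algebraic_over F x \<longleftrightarrow> (\<exists>p. p \<noteq> 0 \<and> poly_over F p \<and> poly p x = 0)"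

definition algebraically_closed :: "'k::field itself \<Rightarrow> bool" where
  "algebraically_closed _ \<longleftrightarrow> (\<forall>p::'k poly. degree p > 0 \<longrightarrow> (\<exists>x. poly p x = 0))"

definition is_algebraic_closure_of :: "'k::field set \<Rightarrow> bool" where
  "is_algebraic_closure_of F \<longleftrightarrow> is_subfield F \<and> algebraically_closed TYPE('k) \<and>
     (\<forall>x::'k. algebraic_over F x)"

definition irreducible_over :: "'k::field set \<Rightarrow> 'k poly \<Rightarrow> bool" where
  "irreducible_over F p \<longleftrightarrow> poly_over F p \<and> degree p > 0 \<and>
     (\<forall>q r. poly_over F q \<and> poly_over F r \<and> p = q * r \<longrightarrow> degree q = 0 \<or> degree r = 0)"

text \<open>L/F is Galois: algebraic, normal and separable, i.e. every element of L has a
  minimal polynomial over F (an irreducible polynomial over F vanishing at it)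
  which splits in L into distinct linear factors.\<close>
definition galois_ext :: "'k::field set \<Rightarrow> 'k set \<Rightarrow> bool" where
  "galois_ext F L \<longleftrightarrow> is_subfield F \<and> is_subfield L \<and> F \<subseteq> L \<and>
     (\<forall>x\<in>L. \<exists>p. irreducible_over F p \<and> poly p x = 0 \<and>
        (\<exists>rs. distinct rs \<and> set rs \<subseteq> L \<and>
              p = smult (lead_coeff p) (\<Prod>r\<leftarrow>rs. [:- r, 1:])))"

definition adjoin :: "'k::field set \<Rightarrow> 'k set \<Rightarrow> 'k set" where
  "adjoin F S = \<Inter> {E. is_subfield E \<and> F \<subseteq> E \<and> S \<subseteq> E}"

definition adjoin_sqrt :: "'k::field set \<Rightarrow> 'k \<Rightarrow> 'k set" where
  "adjoin_sqrt F a = adjoin F {x. x * x = a}"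

definition Gal :: "'k::field set \<Rightarrow> 'k set \<Rightarrow> ('k \<Rightarrow> 'k) monoid" where
  "Gal L F = \<lparr>carrier = {\<sigma>::'k \<Rightarrow> 'k. bij_betw \<sigma> L L \<and>
        (\<forall>x\<in>L. \<forall>y\<in>L. \<sigma> (x + y) = \<sigma> x + \<sigma> y \<and> \<sigma> (x * y) = \<sigma> x * \<sigma> y) \<and>
        (\<forall>x\<in>F. \<sigma> x = x) \<and> (\<forall>x. x \<notin> L \<longrightarrow> \<sigma> x = x)},
      monoid.mult = (\<lambda>(\<sigma>::'k \<Rightarrow> 'k) \<tau>. \<sigma> \<circ> \<tau>), one = (id :: 'k \<Rightarrow> 'k)\<rparr>"

definition nonzero_squares :: "'k::field set \<Rightarrow> 'k set" where
  "nonzero_squares F = {x * x | x. x \<in> F \<and> x \<noteq> 0}"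

definition represented_1c :: "'k::field set \<Rightarrow> 'k \<Rightarrow> 'k set" where
  "represented_1c F c = {x * x + c * (y * y) | x y. x \<in> F \<and> y \<in> F} - {0}"

definition rigid :: "'k::field set \<Rightarrow> 'k \<Rightarrow> bool" where
  "rigid F c \<longleftrightarrow> c \<in> F - {0} \<and> c \<notin> {x * x | x. x \<in> F} \<and> c \<notin> {- (x * x) | x. x \<in> F} \<and>
     represented_1c F c = nonzero_squares F \<union> (\<lambda>s. c * s) ` nonzero_squares F"

definition commutator :: "('a, 'b) monoid_scheme \<Rightarrow> 'a \<Rightarrow> 'a \<Rightarrow> 'a" where
  "commutator G s t = inv\<^bsub>G\<^esub> s \<otimes>\<^bsub>G\<^esub> inv\<^bsub>G\<^esub> t \<otimes>\<^bsub>G\<^esub> s \<otimes>\<^bsub>G\<^esub> t"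

definition G1_rels :: "('a, 'b) monoid_scheme \<Rightarrow> 'a \<Rightarrow> 'a \<Rightarrow> bool" where
  "G1_rels G x y \<longleftrightarrow> (let c = commutator G (commutator G x y) x in
     x [^]\<^bsub>G\<^esub> (4::nat) = \<one>\<^bsub>G\<^esub> \<and> y [^]\<^bsub>G\<^esub> (2::nat) = \<one>\<^bsub>G\<^esub> \<and>
     commutator G x y [^]\<^bsub>G\<^esub> (2::nat) = \<one>\<^bsub>G\<^esub> \<and> c [^]\<^bsub>G\<^esub> (2::nat) = \<one>\<^bsub>G\<^esub> \<and>
     c \<otimes>\<^bsub>G\<^esub> x = x \<otimes>\<^bsub>G\<^esub> c \<and> c \<otimes>\<^bsub>G\<^esub> y = y \<otimes>\<^bsub>G\<^esub> c)"

definition G2_rels :: "('a, 'b) monoid_scheme \<Rightarrow> 'a \<Rightarrow> 'a \<Rightarrow> 'a \<Rightarrow> bool" where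
  "G2_rels G x y z \<longleftrightarrow> (let w = commutator G y (commutator G x z) in
     x [^]\<^bsub>G\<^esub> (2::nat) = \<one>\<^bsub>G\<^esub> \<and> y [^]\<^bsub>G\<^esub> (2::nat) = \<one>\<^bsub>G\<^esub> \<and>
     z [^]\<^bsub>G\<^esub> (2::nat) = \<one>\<^bsub>G\<^esub> \<and>
     commutator G x y [^]\<^bsub>G\<^esub> (2::nat) = \<one>\<^bsub>G\<^esub> \<and>
     commutator G x z [^]\<^bsub>G\<^esub> (2::nat) = \<one>\<^bsub>G\<^esub> \<and>
     commutator G y z = \<one>\<^bsub>G\<^esub> \<and>
     w = commutator G z (commutator G x y) \<and>
     w [^]\<^bsub>G\<^esub> (2::nat) = \<one>\<^bsub>G\<^esub> \<and>
     w \<otimes>\<^bsub>G\<^esub> x = x \<otimes>\<^bsub>G\<^esub> w \<and> w \<otimes>\<^bsub>G\<^esub> y = y \<otimes>\<^bsub>G\<^esub> w \<and> w \<otimes>\<^bsub>G\<^esub> z = z \<otimes>\<^bsub>G\<^esub> w)"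

text \<open>G is isomorphic to the group presented by generators and relations: G is generated
  by elements satisfying the relations, and has the universal property with respect
  to all groups (every finitely generated group is countable, so it suffices to test
  groups whose carrier is a set of naturals).\<close>
definition iso_G1 :: "('a, 'b) monoid_scheme \<Rightarrow> bool" where
  "iso_G1 G \<longleftrightarrow> group G \<and> (\<exists>x\<in>carrier G. \<exists>y\<in>carrier G. G1_rels G x y \<and>
     generate G {x, y} = carrier G \<and>
     (\<forall>(H :: nat monoid) a b. group H \<and> a \<in> carrier H \<and> b \<in> carrier H \<and> G1_rels H a b \<longrightarrow>
        (\<exists>h \<in> hom G H. h x = a \<and> h y = b)))"

definition iso_G2 :: "('a, 'b) monoid_scheme \<Rightarrow> bool" where
  "iso_G2 G \<longleftrightarrow> group G \<and> (\<exists>x\<in>carrier G. \<exists>y\<in>carrier G. \<exists>z\<in>carrier G. G2_rels G x y z \<and>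
     generate G {x, y, z} = carrier G \<and>
     (\<forall>(H :: nat monoid) a b c. group H \<and> a \<in> carrier H \<and> b \<in> carrier H \<and> c \<in> carrier H \<and>
        G2_rels H a b c \<longrightarrow> (\<exists>h \<in> hom G H. h x = a \<and> h y = b \<and> h z = c)))"

abbreviation C4 :: "int monoid" where "C4 \<equiv> integer_mod_group 4"

text \<open>Dihedral group of order 8 as Z/4 semidirect Z/2: (k,b) stands for r^k s^b.\<close>
definition D8 :: "(nat \<times> bool) monoid" where
  "D8 = \<lparr>carrier = {0..<4} \<times> UNIV,
     monoid.mult = (\<lambda>(k1, b1) (k2, b2). ((if b1 then k1 + 4 - k2 else k1 + k2) mod 4, b1 \<noteq> b2)),
     one = (0, False)\<rparr>"

text \<open>Central product DD = (D x D)/{1,(g,g)}, g = r^2 the nontrivial central element.\<close>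
definition DD :: "((nat \<times> bool) \<times> (nat \<times> bool)) set monoid" where
  "DD = (D8 \<times>\<times> D8) Mod {((0, False), (0, False)), ((2, False), (2, False))}"

end

theory Submission
  imports Defs "HOL-Library.Countable"
begin

text \<open>
  Write \<open>K = F(\<surd>a)\<close>.  The element \<open>-a\<close> is not rigid iff some norm \<open>b\<close> from \<open>K\<close> lies outside
  \<open>F\<^sup>2 \<union> -aF\<^sup>2\<close>.

  Given such a norm, rescaling \<open>a\<close> by a square allows \<open>b = 1 - a\<close>.  Take \<open>r\<^sup>4 = a\<close>, \<open>i\<^sup>2 = -1\<close> and
  \<open>s\<^sub>k\<^sup>2 = 1 + i\<^sup>k r\<close> for \<open>k < 4\<close>.  The field \<open>L\<close> generated by \<open>i\<close>, \<open>r\<close> and all products \<open>s\<^sub>j s\<^sub>k\<close> is Galois over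
  \<open>F\<close>, and its automorphisms are signed dihedral permutations of the \<open>s\<^sub>k\<close> modulo a global sign.  If \<open>-1\<close> is
  not a norm from \<open>K\<close>, all 64 of them occur and the group is \<open>G\<^sub>2\<close>.  If \<open>i \<in> F\<close>, exactly the 32 rotations
  occur and the group is \<open>G\<^sub>1\<close>.  If \<open>-1\<close> is a norm but not a square, choose \<open>b = -1\<close>; then \<open>\<surd>b\<close> and \<open>i\<close> are
  flipped simultaneously, which again leaves a group of order 32 isomorphic to \<open>G\<^sub>1\<close>.

  Conversely, both \<open>G\<^sub>1\<close> and \<open>G\<^sub>2\<close> have dihedral quotients.  If \<open>X\<close> moves \<open>\<surd>a\<close> and \<open>e\<close> is a Kummer generator
  for a suitable character of \<open>Gal(L/K)\<close>, then \<open>d = e X(e)\<close> satisfies \<open>d\<^sup>2 = N(e\<^sup>2) \<in> F\<close>, and the action of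
  the group on \<open>d\<close> shows that \<open>d\<^sup>2\<close> is a new norm.  For \<open>G\<^sub>2\<close> the condition \<open>Gal(L/K) \<cong> DD\<close> forces \<open>K\<close> to
  be the quadratic field attached to the generator \<open>x\<close>.
\<close>

section \<open>Extending partial isomorphisms to the algebraic closure\<close>

text \<open>All fields are subsets of one algebraically closed type, so automorphisms are obtained
  by extending partial isomorphisms to the whole closure and restricting back. The radicands
  \<open>1 + i^k r\<close> multiply to \<open>1 - r^4\<close>; hence the product of the
  \<open>s_k\<close> is a square root of \<open>b\<close> in \<open>L\<close>, moved by sign changes
  according to their parity. Adjoining the \<open>s_k\<close> themselves would let the global sign
  act and allow order 128. The cases ask which of \<open>-1\<close>, \<open>a\<close>,
  \<open>b\<close> and their products are squares. As \<open>-a\<close> and \<open>b\<close> are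
  norms, a square \<open>-b\<close> or \<open>ab\<close> would make \<open>-1\<close> a norm;
  \<open>b\<close> and \<open>-ab\<close> are nonsquares because \<open>b\<close> is new,
  \<open>a\<close> and \<open>-a\<close> by hypothesis. So if \<open>-1\<close> is no norm, the
  roots of \<open>a\<close>, \<open>b\<close>, \<open>-1\<close> are independent. If
  \<open>-1\<close> is a norm but no square, it is outside \<open>-aF^2\<close> too and may serve as
  \<open>b\<close>. In the converse the character must be moved by \<open>X\<close>: it lives on a
  Klein four-group of the dihedral quotient and is trivial on one of its two reflections, which
  \<open>X\<close> exchanges.\<close>

lemma is_subfieldD:
  assumes "is_subfield S"
  shows "0 \<in> S" "1 \<in> S"
    "x \<in> S \<Longrightarrow> y \<in> S \<Longrightarrow> x + y \<in> S" "x \<in> S \<Longrightarrow> y \<in> S \<Longrightarrow> x * y \<in> S"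
    "x \<in> S \<Longrightarrow> - x \<in> S" "x \<in> S \<Longrightarrow> inverse x \<in> S"
    "x \<in> S \<Longrightarrow> y \<in> S \<Longrightarrow> x - y \<in> S" "x \<in> S \<Longrightarrow> y \<in> S \<Longrightarrow> x / y \<in> S"
    "x \<in> S \<Longrightarrow> x ^ n \<in> S"
proof -
  show A: "0 \<in> S" "1 \<in> S" "\<And>x y. x \<in> S \<Longrightarrow> y \<in> S \<Longrightarrow> x + y \<in> S"
    "\<And>x y. x \<in> S \<Longrightarrow> y \<in> S \<Longrightarrow> x * y \<in> S" "\<And>x. x \<in> S \<Longrightarrow> - x \<in> S" "\<And>x. x \<in> S \<Longrightarrow> inverse x \<in> S"
    using assms unfolding is_subfield_def by blast+
  show "x \<in> S \<Longrightarrow> y \<in> S \<Longrightarrow> x - y \<in> S"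
    using A(3)[of x "- y"] A(5)[of y] by simp
  show "x \<in> S \<Longrightarrow> y \<in> S \<Longrightarrow> x / y \<in> S"
    using A(4)[of x "inverse y"] A(6)[of y] by (simp add: field_simps)
  show "x \<in> S \<Longrightarrow> x ^ n \<in> S"
    by (induction n) (auto intro: A)
qed

text \<open>The graph of an \<open>F\<close>-algebra homomorphism from a subring of the closure: a
  subring of pairs that contains the diagonal of \<open>F\<close> and is single-valued at 0. As a
  set of pairs it needs no separate domain, and unions of chains are again of this kind.\<close>

definition partial_iso :: "'k::field set \<Rightarrow> ('k \<times> 'k) set \<Rightarrow> bool" where
  "partial_iso F R \<longleftrightarrow> (\<forall>f\<in>F. (f, f) \<in> R) \<and>
     (\<forall>x y x' y'. (x, y) \<in> R \<longrightarrow> (x', y') \<in> R \<longrightarrow> (x + x', y + y') \<in> R \<and> (x * x', y * y') \<in> R) \<and>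
     (\<forall>y. (0, y) \<in> R \<longrightarrow> y = 0)"

lemma partial_isoD:
  assumes "partial_iso F R"
  shows "f \<in> F \<Longrightarrow> (f, f) \<in> R"
    "(x, y) \<in> R \<Longrightarrow> (x', y') \<in> R \<Longrightarrow> (x + x', y + y') \<in> R"
    "(x, y) \<in> R \<Longrightarrow> (x', y') \<in> R \<Longrightarrow> (x * x', y * y') \<in> R"
    "(0, y) \<in> R \<Longrightarrow> y = 0"
  using assms unfolding partial_iso_def by simp_all

lemma partial_iso_minus:
  assumes "is_subfield F" "partial_iso F R" "(x, y) \<in> R" "(x', y') \<in> R"
  shows "(x - x', y - y') \<in> R"
proof -
  have "(-1, -1) \<in> R"
    by (intro partial_isoD(1)[OF assms(2)] is_subfieldD(2,5)[OF assms(1)])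
  then have "(- x', - y') \<in> R"
    using partial_isoD(3)[OF assms(2) _ assms(4), of "-1" "-1"] by simp
  then show ?thesis
    using partial_isoD(2)[OF assms(2,3), of "- x'" "- y'"] by simp
qed

lemma partial_iso_unique:
  assumes "is_subfield F" "partial_iso F R" "(x, y) \<in> R" "(x, y') \<in> R"
  shows "y = y'"
  using partial_iso_minus[OF assms] partial_isoD(4)[OF assms(2), of "y - y'"] by simp

lemma partial_iso_poly:
  assumes R: "partial_iso F R" and F: "is_subfield F" and xy: "(x, y) \<in> R"
    and pq: "\<And>n. (coeff p n, coeff q n) \<in> R"
  shows "(poly p x, poly q y) \<in> R"
  using pq
proof (induction p arbitrary: q)
  case 0
  have "coeff q n = 0" for n
    using 0[of n] partial_isoD(4)[OF R] by simp
  then have "q = 0" by (simp add: poly_eqI)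
  then show ?case using partial_isoD(1)[OF R] is_subfieldD[OF F] by simp
next
  case (pCons c p)
  obtain c' q' where q: "q = pCons c' q'" by (cases q)
  have "(c, c') \<in> R" using pCons.prems[of 0] q by simp
  moreover have "(coeff p n, coeff q' n) \<in> R" for n using pCons.prems[of "Suc n"] q by simp
  ultimately show ?case
    using pCons.IH[of q'] q partial_isoD[OF R] xy by simp
qed

text \<open>Powers of the indeterminate can be divided out of an annihilating polynomial because
  \<open>x\<close> is nonzero.\<close>

lemma algebraic_over_nonzero_const:
  assumes "x \<noteq> 0" "algebraic_over F x"
  shows "\<exists>p. poly_over F p \<and> poly p x = 0 \<and> coeff p 0 \<noteq> 0"
proof -
  obtain p where "p \<noteq> 0" "poly_over F p" "poly p x = 0"
    using assms(2) unfolding algebraic_over_def by blast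
  then show ?thesis
  proof (induction p)
    case 0 then show ?case by simp
  next
    case (pCons c p)
    show ?case
    proof (cases "c = 0")
      case True
      have "p \<noteq> 0" "poly p x = 0" using pCons.prems True assms(1) by auto
      moreover have "poly_over F p"
        using pCons.prems(2) unfolding poly_over_def by (metis coeff_pCons_Suc)
      ultimately show ?thesis using pCons.IH by blast
    next
      case False
      then show ?thesis using pCons.prems by (intro exI[of _ "pCons c p"]) simp
    qed
  qed
qed

text \<open>Algebraicity gives injectivity: if a nonzero \<open>x\<close> went to 0, an equation for
  \<open>x\<close> over \<open>F\<close> with nonzero constant term would be carried to the
  statement that this constant term is 0.\<close>

lemma partial_iso_converse:
  assumes R: "partial_iso F R" and F: "is_algebraic_closure_of F"
  shows "partial_iso F (R\<inverse>)"
proof -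
  have sf: "is_subfield F" and alg: "\<And>x. algebraic_over F x"
    using F unfolding is_algebraic_closure_of_def by auto
  have "x = 0" if xR: "(x, 0) \<in> R" for x
  proof (rule ccontr)
    assume "x \<noteq> 0"
    then obtain p where p: "poly_over F p" "poly p x = 0" "coeff p 0 \<noteq> 0"
      using algebraic_over_nonzero_const alg by blast
    have "(poly p x, poly p 0) \<in> R"
      by (rule partial_iso_poly[OF R sf xR]) (use p partial_isoD(1)[OF R] in \<open>auto simp: poly_over_def\<close>)
    then show False using p partial_isoD(4)[OF R] by (simp add: poly_0_coeff_0)
  qed
  then show ?thesis using R unfolding partial_iso_def by simp
qed

lemma coeff_mult_rel:
  assumes R: "partial_iso F R" and F: "is_subfield F"
    and "\<And>n. (coeff p n, coeff p' n) \<in> R" "\<And>n. (coeff q n, coeff q' n) \<in> R"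
  shows "(coeff (p * q) n, coeff (p' * q') n) \<in> R"
proof -
  have "(\<Sum>i\<in>A. coeff p i * coeff q (n - i), \<Sum>i\<in>A. coeff p' i * coeff q' (n - i)) \<in> R"
    if "finite A" for A
    using that
  proof (induction A rule: finite_induct)
    case empty
    then show ?case using partial_isoD(1)[OF R] is_subfieldD[OF F] by simp
  next
    case (insert i A)
    then show ?case using assms partial_isoD[OF R] by simp
  qed
  then show ?thesis by (simp add: coeff_mult)
qed

text \<open>Pseudo-division keeps the argument inside the ring of pairs, so that the domain of
  the relation need not be known to be a field.\<close>
lemma maximal_partial_iso_total:
  fixes R :: "('k::field \<times> 'k) set"
  assumes F: "is_algebraic_closure_of F" and R: "partial_iso F R"
    and max: "\<And>R'. partial_iso F R' \<Longrightarrow> R \<subseteq> R' \<Longrightarrow> R' = R"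
  shows "Domain R = UNIV"
proof -
  have sf: "is_subfield F" and ac: "algebraically_closed TYPE('k)" and alg: "\<And>x. algebraic_over F x"
    using F unfolding is_algebraic_closure_of_def by auto
  define P where "P = {(p, q). \<forall>n. (coeff p n, coeff q n) \<in> R}"
  have nz: "x = 0 \<longleftrightarrow> y = 0" if "(x, y) \<in> R" for x y
    using that partial_isoD(4)[OF R] partial_isoD(4)[OF partial_iso_converse[OF R F]] by blast
  have Pdeg: "degree p = degree q \<and> (p = 0 \<longleftrightarrow> q = 0)" if "(p, q) \<in> P" for p q
  proof -
    have "coeff p n = 0 \<longleftrightarrow> coeff q n = 0" for n
      using that nz unfolding P_def by blast
    then show ?thesis unfolding degree_def by (simp add: poly_eq_iff)
  qed
  have F0: "(0, 0) \<in> R" "(1, 1) \<in> R" using partial_isoD(1)[OF R] is_subfieldD[OF sf] by auto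
  have Pring: "(p + q, p' + q') \<in> P" "(p - q, p' - q') \<in> P" "(p * q, p' * q') \<in> P"
    if "(p, p') \<in> P" "(q, q') \<in> P" for p q p' q'
    using that partial_isoD[OF R] partial_iso_minus[OF sf R] coeff_mult_rel[OF R sf]
    unfolding P_def by auto
  have Pmonom: "(monom c n, monom c' n) \<in> P" if "(c, c') \<in> R" for c c' n
    using that F0 unfolding P_def by auto
  have PF: "(p, p) \<in> P" if "poly_over F p" for p
    using that partial_isoD(1)[OF R] unfolding P_def poly_over_def by auto
  have "z \<in> Domain R" for z
  proof -
    obtain p0 where p0: "p0 \<noteq> 0" "poly_over F p0" "poly p0 z = 0"
      using alg unfolding algebraic_over_def by blast
    define Q where "Q = (\<lambda>(p, q). (p, q) \<in> P \<and> p \<noteq> 0 \<and> poly p z = 0)"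
    have "Q (p0, p0)" using p0 PF unfolding Q_def by auto
    then obtain m m' where mQ: "Q (m, m')"
      and min: "\<And>pq. Q pq \<Longrightarrow> degree m \<le> degree (fst pq)"
      using ex_has_least_nat[of Q "(p0, p0)" "\<lambda>pq. degree (fst pq)"] by (metis surj_pair fst_conv)
    then have mm: "(m, m') \<in> P" and m0: "m \<noteq> 0" "poly m z = 0" unfolding Q_def by auto
    have "degree m > 0"
    proof (rule ccontr)
      assume "\<not> degree m > 0"
      then obtain c where "m = [:c:]" by (metis degree_eq_zeroE gr0I)
      then show False using m0 by simp
    qed
    then have "degree m' > 0" using Pdeg[OF mm] by simp
    then obtain y where y: "poly m' y = 0"
      using ac unfolding algebraically_closed_def by blast
    let ?l = "lead_coeff m" and ?l' = "lead_coeff m'"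
    have ll: "(?l, ?l') \<in> R" using mm Pdeg[OF mm] unfolding P_def by auto
    have l0: "?l' \<noteq> 0" using Pdeg[OF mm] m0 by simp
    have key: "poly q y = 0" if "(p, q) \<in> P" "poly p z = 0" for p q
      using that
    proof (induction "degree p" arbitrary: p q rule: less_induct)
      case less
      show ?case
      proof (cases "p = 0")
        case True
        then show ?thesis using Pdeg[OF less.prems(1)] by simp
      next
        case False
        then have "Q (p, q)" using less.prems unfolding Q_def by simp
        then have dle: "degree m \<le> degree p" using min by fastforce
        let ?d = "degree p - degree m"
        let ?c = "lead_coeff p" and ?c' = "lead_coeff q"
        have cc: "(?c, ?c') \<in> R" using less.prems Pdeg[OF less.prems(1)] unfolding P_def by auto
        define p1 where "p1 = monom ?l 0 * p - monom ?c ?d * m"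
        define q1 where "q1 = monom ?l' 0 * q - monom ?c' ?d * m'"
        have pq1: "(p1, q1) \<in> P"
          unfolding p1_def q1_def using less.prems(1) mm ll cc by (intro Pring Pmonom)
        have pz: "poly p1 z = 0" unfolding p1_def using less.prems m0 by simp
        have "poly q1 y = 0"
        proof (cases "p1 = 0")
          case True then show ?thesis using Pdeg[OF pq1] by simp
        next
          case False
          have "degree (monom ?l 0 * p) \<le> degree p" 
            by (simp add: monom_0)
          moreover have "degree (monom ?c ?d * m) \<le> degree p"
            using degree_mult_le[of "monom ?c ?d" m] degree_monom_le[of ?c ?d] dle by linarith
          ultimately have le: "degree p1 \<le> degree p" unfolding p1_def by (rule degree_diff_le)
          have "coeff (monom ?c ?d * m) (?d + degree m) = ?c * ?l"
            using coeff_monom_mult[of ?c ?d m "?d + degree m"] by simp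
          then have "coeff p1 (degree p) = 0" unfolding p1_def using dle
            by (simp add: monom_0 mult.commute)
          then have "degree p1 \<noteq> degree p" using False by (metis leading_coeff_0_iff)
          then show ?thesis using less.hyps[OF _ pq1 pz] le by simp
        qed
        then show ?thesis unfolding q1_def using y l0 by (simp add: poly_monom)
      qed
    qed
    \<comment> \<open>\<open>R'\<close> is the ring of pairs generated by \<open>R\<close> and
      \<open>(z, y)\<close>. Its single-valuedness at 0 is \<open>key\<close>, so maximality puts
      \<open>(z, y)\<close> into \<open>R\<close>.\<close>
    define R' where "R' = {(poly p z, poly q y) | p q. (p, q) \<in> P}"
    have RR': "R \<subseteq> R'"
    proof (clarify)
      fix u v assume "(u, v) \<in> R"
      then have "(monom u 0, monom v 0) \<in> P" by (rule Pmonom)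
      then have "(poly (monom u 0) z, poly (monom v 0) y) \<in> R'" unfolding R'_def by blast
      then show "(u, v) \<in> R'" by (simp add: poly_monom)
    qed
    have "partial_iso F R'"
      unfolding partial_iso_def
    proof (intro conjI ballI allI impI)
      show "(f, f) \<in> R'" if "f \<in> F" for f using RR' partial_isoD(1)[OF R that] by blast
      fix u v u' v' assume "(u, v) \<in> R'" "(u', v') \<in> R'"
      then obtain p q p' q' where "(p, q) \<in> P" "(p', q') \<in> P"
        and e: "u = poly p z" "v = poly q y" "u' = poly p' z" "v' = poly q' y"
        unfolding R'_def by blast
      then have "(poly (p + p') z, poly (q + q') y) \<in> R'" "(poly (p * p') z, poly (q * q') y) \<in> R'"
        unfolding R'_def using Pring by blast+
      then show "(u + u', v + v') \<in> R'" "(u * u', v * v') \<in> R'" by (simp_all add: e)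
    next
      fix v assume "(0, v) \<in> R'"
      then show "v = 0" unfolding R'_def using key by auto
    qed
    then have "R' = R" using max RR' by blast
    moreover have "(poly (monom 1 1) z, poly (monom 1 1) y) \<in> R'"
      unfolding R'_def using Pmonom[OF F0(2)] by blast
    ultimately have "(z, y) \<in> R" by (simp add: poly_monom)
    then show ?thesis by blast
  qed
  then show ?thesis by blast
qed

abbreviation Aut :: "'k::field set \<Rightarrow> ('k \<Rightarrow> 'k) set" where
  "Aut F \<equiv> carrier (Gal UNIV F)"

text \<open>Zorn gives a maximal extension, which is total. Its converse is again a maximal partial
  isomorphism, hence total as well, and that is the surjectivity of the resulting
  automorphism.\<close>

theorem partial_iso_extend:
  fixes F :: "'k::field set"
  assumes F: "is_algebraic_closure_of F" and R0: "partial_iso F R0"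
  shows "\<exists>\<sigma>\<in>Aut F. \<forall>(x, y)\<in>R0. \<sigma> x = y"
proof -
  have sf: "is_subfield F" using F unfolding is_algebraic_closure_of_def by auto
  define \<A> where "\<A> = {R. partial_iso F R \<and> R0 \<subseteq> R}"
  have "\<exists>M\<in>\<A>. \<forall>X\<in>\<A>. M \<subseteq> X \<longrightarrow> X = M"
  proof (rule subset_Zorn_nonempty)
    show "\<A> \<noteq> {}" using R0 unfolding \<A>_def by blast
    fix C assume C: "C \<noteq> {}" "subset.chain \<A> C"
    then have CA: "\<And>X. X \<in> C \<Longrightarrow> partial_iso F X \<and> R0 \<subseteq> X"
      and tot: "\<And>X Y. X \<in> C \<Longrightarrow> Y \<in> C \<Longrightarrow> X \<subseteq> Y \<or> Y \<subseteq> X"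
      unfolding subset_chain_def \<A>_def by auto
    have "partial_iso F (\<Union>C)"
      unfolding partial_iso_def
    proof (intro conjI ballI allI impI)
      show "(f, f) \<in> \<Union>C" if "f \<in> F" for f using C(1) CA partial_isoD(1) that by blast
      fix u v u' v' assume "(u, v) \<in> \<Union>C" "(u', v') \<in> \<Union>C"
      then obtain X Y where "X \<in> C" "Y \<in> C" "(u, v) \<in> X" "(u', v') \<in> Y" by blast
      then obtain Z where Z: "Z \<in> C" "(u, v) \<in> Z" "(u', v') \<in> Z" using tot[of X Y] by blast
      then show "(u + u', v + v') \<in> \<Union>C" "(u * u', v * v') \<in> \<Union>C"
        using CA[OF Z(1)] partial_isoD(2,3)[of F Z u v u' v'] by blast+
    next
      fix v assume "(0, v) \<in> \<Union>C"
      then show "v = 0" using CA partial_isoD(4) by blast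
    qed
    then show "\<Union>C \<in> \<A>" using C(1) CA unfolding \<A>_def by blast
  qed
  then obtain R where R: "partial_iso F R" "R0 \<subseteq> R"
    and max: "\<And>X. partial_iso F X \<Longrightarrow> R \<subseteq> X \<Longrightarrow> X = R"
    unfolding \<A>_def by (smt (verit, best) mem_Collect_eq order_trans)
  have dom: "Domain R = UNIV" by (rule maximal_partial_iso_total[OF F R(1) max])
  have conv: "partial_iso F (R\<inverse>)" by (rule partial_iso_converse[OF R(1) F])
  have "Domain (R\<inverse>) = UNIV"
  proof (rule maximal_partial_iso_total[OF F conv])
    fix R' assume "partial_iso F R'" "R\<inverse> \<subseteq> R'"
    then have "partial_iso F (R'\<inverse>)" "R \<subseteq> R'\<inverse>" using partial_iso_converse[OF _ F] by auto
    then have "R'\<inverse> = R" by (rule max)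
    then show "R' = R\<inverse>" by auto
  qed
  then have ran: "Range R = UNIV" by simp
  have "\<forall>x. \<exists>y. (x, y) \<in> R" using dom by blast
  then obtain \<sigma> where \<sigma>: "\<And>x. (x, \<sigma> x) \<in> R" by metis
  have \<sigma>_eq: "\<sigma> x = y" if "(x, y) \<in> R" for x y
    by (rule partial_iso_unique[OF sf R(1) \<sigma> that])
  have "inj \<sigma>"
  proof (rule injI)
    fix x y assume "\<sigma> x = \<sigma> y"
    then have "(\<sigma> x, x) \<in> R\<inverse>" "(\<sigma> x, y) \<in> R\<inverse>" using \<sigma> by (auto, metis)
    then show "x = y" by (rule partial_iso_unique[OF sf conv])
  qed
  moreover have "surj \<sigma>" using ran \<sigma>_eq by (metis Range.cases UNIV_I surjI surj_def)
  ultimately have "bij \<sigma>" by (simp add: bij_def)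
  moreover have "\<sigma> (x + y) = \<sigma> x + \<sigma> y" "\<sigma> (x * y) = \<sigma> x * \<sigma> y" for x y
    using partial_isoD(2,3)[OF R(1) \<sigma>[of x] \<sigma>[of y]] by (auto intro: \<sigma>_eq)
  moreover have "\<sigma> x = x" if "x \<in> F" for x
    using partial_isoD(1)[OF R(1) that] by (rule \<sigma>_eq)
  ultimately have "\<sigma> \<in> Aut F" unfolding Gal_def by simp
  then show ?thesis using R(2) \<sigma>_eq by (intro bexI[of _ \<sigma>]) auto
qed

section \<open>Galois groups\<close>

lemma is_subfield_UNIV: "is_subfield UNIV"
  unfolding is_subfield_def by simp

lemma Gal_carrier: "\<sigma> \<in> carrier (Gal L F) \<longleftrightarrow> bij_betw \<sigma> L L \<and>
    (\<forall>x\<in>L. \<forall>y\<in>L. \<sigma> (x + y) = \<sigma> x + \<sigma> y \<and> \<sigma> (x * y) = \<sigma> x * \<sigma> y) \<and>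
    (\<forall>x\<in>F. \<sigma> x = x) \<and> (\<forall>x. x \<notin> L \<longrightarrow> \<sigma> x = x)"
  unfolding Gal_def by simp

lemma Gal_mult [simp]: "\<sigma> \<otimes>\<^bsub>Gal L F\<^esub> \<tau> = \<sigma> \<circ> \<tau>"
  unfolding Gal_def by simp

lemma Gal_one [simp]: "\<one>\<^bsub>Gal L F\<^esub> = id"
  unfolding Gal_def by simp

lemma GalD:
  assumes L: "is_subfield L" and s: "\<sigma> \<in> carrier (Gal L F)"
  shows "x \<in> L \<Longrightarrow> \<sigma> x \<in> L" "x \<in> L \<Longrightarrow> y \<in> L \<Longrightarrow> \<sigma> (x + y) = \<sigma> x + \<sigma> y"
    "x \<in> L \<Longrightarrow> y \<in> L \<Longrightarrow> \<sigma> (x * y) = \<sigma> x * \<sigma> y"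
    "x \<in> F \<Longrightarrow> \<sigma> x = x" "\<sigma> 0 = 0" "\<sigma> 1 = 1" "x \<in> L \<Longrightarrow> \<sigma> (- x) = - \<sigma> x"
    "x \<in> L \<Longrightarrow> y \<in> L \<Longrightarrow> \<sigma> (x - y) = \<sigma> x - \<sigma> y"
    "x \<in> L \<Longrightarrow> \<sigma> (inverse x) = inverse (\<sigma> x)"
    "x \<in> L \<Longrightarrow> y \<in> L \<Longrightarrow> \<sigma> (x / y) = \<sigma> x / \<sigma> y"
    "x \<in> L \<Longrightarrow> \<sigma> x = 0 \<longleftrightarrow> x = 0"
    "x \<in> L \<Longrightarrow> y \<in> L \<Longrightarrow> \<sigma> x = \<sigma> y \<longleftrightarrow> x = y"
    "x \<notin> L \<Longrightarrow> \<sigma> x = x" "x \<in> L \<Longrightarrow> \<sigma> (x ^ n) = \<sigma> x ^ n"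
proof -
  note S = is_subfieldD[OF L]
  have b: "bij_betw \<sigma> L L" using s unfolding Gal_carrier by simp
  show in_L: "\<And>x. x \<in> L \<Longrightarrow> \<sigma> x \<in> L" using b by (rule bij_betwE[rule_format])
  show add: "\<And>x y. x \<in> L \<Longrightarrow> y \<in> L \<Longrightarrow> \<sigma> (x + y) = \<sigma> x + \<sigma> y"
    and mult: "\<And>x y. x \<in> L \<Longrightarrow> y \<in> L \<Longrightarrow> \<sigma> (x * y) = \<sigma> x * \<sigma> y"
    and "x \<in> F \<Longrightarrow> \<sigma> x = x" and "x \<notin> L \<Longrightarrow> \<sigma> x = x"
    using s unfolding Gal_carrier by simp_all
  show z: "\<sigma> 0 = 0" using add[of 0 0] S(1) by (metis add_0_right add_left_cancel)
  show inj: "\<And>x y. x \<in> L \<Longrightarrow> y \<in> L \<Longrightarrow> \<sigma> x = \<sigma> y \<longleftrightarrow> x = y"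
    using b unfolding bij_betw_def inj_on_def by blast
  show z_iff: "\<And>x. x \<in> L \<Longrightarrow> \<sigma> x = 0 \<longleftrightarrow> x = 0" using inj[OF _ S(1)] z by simp
  show o: "\<sigma> 1 = 1"
    using mult[of 1 1] S(2) z_iff[of 1] by simp
  show neg: "\<And>x. x \<in> L \<Longrightarrow> \<sigma> (- x) = - \<sigma> x"
    using add z S(5) by (metis add.right_inverse add_eq_0_iff)
  show "x \<in> L \<Longrightarrow> y \<in> L \<Longrightarrow> \<sigma> (x - y) = \<sigma> x - \<sigma> y"
    using add[of x "- y"] neg[of y] S(5)[of y] by simp
  show inv: "\<And>x. x \<in> L \<Longrightarrow> \<sigma> (inverse x) = inverse (\<sigma> x)"
  proof -
    fix x assume x: "x \<in> L"
    show "\<sigma> (inverse x) = inverse (\<sigma> x)"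
    proof (cases "x = 0")
      case True then show ?thesis using z by simp
    next
      case False
      then have "\<sigma> x * \<sigma> (inverse x) = 1" using mult[OF x S(6)[OF x]] o by simp
      then show ?thesis by (metis inverse_unique)
    qed
  qed
  show "x \<in> L \<Longrightarrow> y \<in> L \<Longrightarrow> \<sigma> (x / y) = \<sigma> x / \<sigma> y"
    using mult[of x "inverse y"] inv[of y] S(6)[of y] by (simp add: divide_inverse)
  show "x \<in> L \<Longrightarrow> \<sigma> (x ^ n) = \<sigma> x ^ n"
    by (induction n) (use o mult S(9) in auto)
qed

lemma AutD:
  assumes s: "\<sigma> \<in> Aut F"
  shows "\<sigma> (x + y) = \<sigma> x + \<sigma> y" "\<sigma> (x * y) = \<sigma> x * \<sigma> y"
    "x \<in> F \<Longrightarrow> \<sigma> x = x" "\<sigma> 0 = 0" "\<sigma> 1 = 1" "\<sigma> (- x) = - \<sigma> x"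
    "\<sigma> (x - y) = \<sigma> x - \<sigma> y" "\<sigma> (inverse x) = inverse (\<sigma> x)"
    "\<sigma> (x / y) = \<sigma> x / \<sigma> y" "\<sigma> x = 0 \<longleftrightarrow> x = 0" "\<sigma> x = \<sigma> y \<longleftrightarrow> x = y"
    "\<sigma> (x ^ n) = \<sigma> x ^ n"
proof -
  note D = GalD[OF is_subfield_UNIV s]
  show "\<sigma> (x + y) = \<sigma> x + \<sigma> y" by (rule D(2)) simp_all
  show "\<sigma> (x * y) = \<sigma> x * \<sigma> y" by (rule D(3)) simp_all
  show "x \<in> F \<Longrightarrow> \<sigma> x = x" by (rule D(4))
  show "\<sigma> 0 = 0" "\<sigma> 1 = 1" by (rule D(5), rule D(6))
  show "\<sigma> (- x) = - \<sigma> x" by (rule D(7)) simp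
  show "\<sigma> (x - y) = \<sigma> x - \<sigma> y" by (rule D(8)) simp_all
  show "\<sigma> (inverse x) = inverse (\<sigma> x)" by (rule D(9)) simp
  show "\<sigma> (x / y) = \<sigma> x / \<sigma> y" by (rule D(10)) simp_all
  show "\<sigma> x = 0 \<longleftrightarrow> x = 0" by (rule D(11)) simp
  show "\<sigma> x = \<sigma> y \<longleftrightarrow> x = y" by (rule D(12)) simp_all
  show "\<sigma> (x ^ n) = \<sigma> x ^ n" by (rule D(14)) simp
qed

lemma Gal_comp:
  assumes "\<sigma> \<in> carrier (Gal L F)" "\<tau> \<in> carrier (Gal L F)"
  shows "\<sigma> \<circ> \<tau> \<in> carrier (Gal L F)"
proof -
  have "\<tau> x \<in> L" if "x \<in> L" for x
    using assms(2) that unfolding Gal_carrier bij_betw_def by blast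
  moreover have "bij_betw (\<sigma> \<circ> \<tau>) L L"
    using assms unfolding Gal_carrier by (meson bij_betw_trans)
  ultimately show ?thesis using assms unfolding Gal_carrier by simp
qed

lemma Gal_inverse:
  assumes L: "is_subfield L" and FL: "F \<subseteq> L" and s: "\<sigma> \<in> carrier (Gal L F)"
  shows "\<exists>\<tau>\<in>carrier (Gal L F). \<tau> \<circ> \<sigma> = id"
proof -
  note S = is_subfieldD[OF L] and D = GalD[OF L s]
  have b: "bij_betw \<sigma> L L" using s unfolding Gal_carrier by simp
  define \<tau> where "\<tau> = (\<lambda>x. if x \<in> L then inv_into L \<sigma> x else x)"
  have t1: "\<tau> (\<sigma> x) = x" for x
    using D(1,13)[of x] bij_betw_inv_into_left[OF b] unfolding \<tau>_def by (cases "x \<in> L") auto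
  have t2: "\<sigma> (\<tau> x) = x" if "x \<in> L" for x
    using bij_betw_inv_into_right[OF b that] that unfolding \<tau>_def by simp
  have "bij_betw \<tau> L L"
    using bij_betw_inv_into[OF b] by (subst bij_betw_cong[of _ _ "inv_into L \<sigma>"]) (auto simp: \<tau>_def)
  moreover from this have tL: "\<tau> x \<in> L" if "x \<in> L" for x
    using that bij_betwE by blast
  moreover have "\<tau> (x + y) = \<tau> x + \<tau> y" "\<tau> (x * y) = \<tau> x * \<tau> y" if "x \<in> L" "y \<in> L" for x y
    using t1 t2 that tL D(2,3) by metis+
  moreover have "\<tau> x = x" if "x \<in> F" for x using t1 D(4)[OF that] by metis
  ultimately have "\<tau> \<in> carrier (Gal L F)" unfolding Gal_carrier by (simp add: \<tau>_def)
  moreover have "\<tau> \<circ> \<sigma> = id" using t1 by auto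
  ultimately show ?thesis by blast
qed

lemma Gal_id: "id \<in> carrier (Gal L F)"
  unfolding Gal_carrier by simp

lemma group_Gal:
  assumes "is_subfield L" "F \<subseteq> L"
  shows "group (Gal L F)"
proof (rule groupI)
  show "\<exists>y\<in>carrier (Gal L F). y \<otimes>\<^bsub>Gal L F\<^esub> x = \<one>\<^bsub>Gal L F\<^esub>" if "x \<in> carrier (Gal L F)" for x
    using Gal_inverse[OF assms that] by simp
qed (simp_all add: Gal_comp Gal_id comp_assoc)

lemma Gal_mono: "F \<subseteq> K \<Longrightarrow> carrier (Gal L K) \<subseteq> carrier (Gal L F)"
  unfolding Gal_def by auto

lemma Gal_inv_apply:
  assumes "is_subfield L" "F \<subseteq> L" "\<sigma> \<in> carrier (Gal L F)"
  shows "(inv\<^bsub>Gal L F\<^esub> \<sigma>) (\<sigma> x) = x" "\<sigma> ((inv\<^bsub>Gal L F\<^esub> \<sigma>) x) = x"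
proof -
  interpret group "Gal L F" by (rule group_Gal[OF assms(1,2)])
  show "(inv\<^bsub>Gal L F\<^esub> \<sigma>) (\<sigma> x) = x" using l_inv[OF assms(3)] by (metis Gal_mult Gal_one comp_apply id_apply)
  show "\<sigma> ((inv\<^bsub>Gal L F\<^esub> \<sigma>) x) = x" using r_inv[OF assms(3)] by (metis Gal_mult Gal_one comp_apply id_apply)
qed

subsection \<open>Adjunction\<close>

lemma is_subfield_adjoin: "is_subfield (adjoin F S)"
proof -
  have I: "x \<in> adjoin F S \<longleftrightarrow> (\<forall>E. is_subfield E \<longrightarrow> F \<subseteq> E \<longrightarrow> S \<subseteq> E \<longrightarrow> x \<in> E)" for x
    unfolding adjoin_def by blast
  show ?thesis by (subst is_subfield_def) (simp add: I is_subfieldD)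
qed

lemma adjoin_superset: "F \<subseteq> adjoin F S" "S \<subseteq> adjoin F S"
  unfolding adjoin_def by blast+

lemma adjoin_least: "is_subfield E \<Longrightarrow> F \<subseteq> E \<Longrightarrow> S \<subseteq> E \<Longrightarrow> adjoin F S \<subseteq> E"
  unfolding adjoin_def by blast

lemma adjoin_empty: "is_subfield F \<Longrightarrow> adjoin F {} = F"
  using adjoin_least[of F F "{}"] adjoin_superset(1)[where F = F and S = "{}"] by blast

lemma adjoin_adjoin: "adjoin (adjoin F S) T = adjoin F (S \<union> T)"
proof
  show "adjoin (adjoin F S) T \<subseteq> adjoin F (S \<union> T)"
    by (intro adjoin_least is_subfield_adjoin) (use adjoin_superset[where F = F and S = "S \<union> T"] in auto)
  show "adjoin F (S \<union> T) \<subseteq> adjoin (adjoin F S) T"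
    by (intro adjoin_least is_subfield_adjoin)
      (meson Un_subset_iff adjoin_superset order_trans)+
qed

lemma adjoin_quadratic:
  assumes M: "is_subfield M" and d: "d * d \<in> M"
  shows "adjoin M {d} = {u + v * d | u v. u \<in> M \<and> v \<in> M}"
proof
  note S = is_subfieldD[OF M]
  let ?A = "{u + v * d | u v. u \<in> M \<and> v \<in> M}"
  have inA: "u + v * d \<in> ?A" if "u \<in> M" "v \<in> M" for u v using that by blast
  have "is_subfield ?A"
    unfolding is_subfield_def
  proof (intro conjI ballI)
    show "0 \<in> ?A" using inA[OF S(1) S(1)] by simp
    show "1 \<in> ?A" using inA[OF S(2) S(1)] by simp
    fix x assume "x \<in> ?A"
    then obtain u v where x: "x = u + v * d" and uv: "u \<in> M" "v \<in> M" by blast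
    show "- x \<in> ?A" using inA[OF S(5)[OF uv(1)] S(5)[OF uv(2)]] x by (simp add: algebra_simps)
    show "inverse x \<in> ?A"
    proof (cases "x = 0 \<or> d \<in> M")
      case True
      then have "x \<in> M" using x uv S by auto
      then show ?thesis using inA[OF S(6) S(1), of x] by simp
    next
      case False
      let ?n = "u * u - v * v * (d * d)"
      \<comment> \<open>Inversion rationalises the denominator; the conjugate can vanish only if
        \<open>d\<close> lies in \<open>M\<close> or \<open>x = 0\<close>, and both are settled
        above.\<close>
      have "u - v * d \<noteq> 0"
      proof
        assume "u - v * d = 0"
        then have "v = 0 \<or> d = u / v" by (simp add: field_simps)
        then show False using False x \<open>u - v * d = 0\<close> S(8)[OF uv] by auto
      qed
      moreover have n: "?n = x * (u - v * d)" unfolding x by (simp add: algebra_simps)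
      ultimately have "?n \<noteq> 0" using False by simp
      then have "inverse x = (u - v * d) / ?n" unfolding n using False by (simp add: field_simps)
      then have "inverse x = u / ?n + (- v / ?n) * d" by (simp add: diff_divide_distrib)
      moreover have "?n \<in> M" using uv d S by simp
      ultimately show ?thesis using inA[of "u / ?n" "- v / ?n"] S(5,8) uv by simp
    qed
    fix y assume "y \<in> ?A"
    then obtain u' v' where y: "y = u' + v' * d" and uv': "u' \<in> M" "v' \<in> M" by blast
    have "x + y = (u + u') + (v + v') * d" unfolding x y by (simp add: algebra_simps)
    then show "x + y \<in> ?A" using inA[of "u + u'" "v + v'"] S(3) uv uv' by simp
    have "x * y = (u * u' + v * v' * (d * d)) + (u * v' + v * u') * d" unfolding x y by (simp add: algebra_simps)
    then show "x * y \<in> ?A" using inA[of "u * u' + v * v' * (d * d)" "u * v' + v * u'"] S(3,4) uv uv' d by simp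
  qed
  then show "adjoin M {d} \<subseteq> ?A"
    using inA[OF _ S(1)] inA[OF S(1) S(2)] by (intro adjoin_least) auto
  show "?A \<subseteq> adjoin M {d}"
    using adjoin_superset[where F = M and S = "{d}"]
    by (auto intro!: is_subfieldD(3,4)[OF is_subfield_adjoin])
qed

text \<open>Squaring \<open>d = u + v * e\<close> shows that \<open>2 u v e\<close> lies in
  \<open>M\<close>, so \<open>u\<close> or \<open>v\<close> vanishes or \<open>e\<close> is in
  \<open>M\<close>; each option puts \<open>d\<close> or \<open>d * e\<close> into \<open>M\<close>.
  This is the independence test for all square roots below.\<close>

lemma notin_adjoin_quadratic:
  fixes M :: "'k::field set"
  assumes M: "is_subfield M" and "d * d \<in> M" "e * e \<in> M" "d \<notin> M" "d * e \<notin> M" and two: "(2::'k) \<noteq> 0"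
  shows "d \<notin> adjoin M {e}"
proof
  note S = is_subfieldD[OF M]
  assume "d \<in> adjoin M {e}"
  then obtain u v where d: "d = u + v * e" and uv: "u \<in> M" "v \<in> M"
    unfolding adjoin_quadratic[OF M assms(3)] by blast
  have eq: "2 * u * v * e = d * d - u * u - v * v * (e * e)"
    unfolding d by (simp add: algebra_simps)
  have "2 \<in> M" using S(3)[OF S(2) S(2)] by simp
  have u0: "u \<noteq> 0" using assms(5) d uv S(4)[OF uv(2) assms(3)] by (auto simp: mult.assoc)
  have v0: "v \<noteq> 0" using assms(4) d uv by auto
  have "e = (d * d - u * u - v * v * (e * e)) / (2 * u * v)"
    using eq u0 v0 two by (simp add: field_simps)
  moreover have "(d * d - u * u - v * v * (e * e)) / (2 * u * v) \<in> M"
    using assms uv \<open>2 \<in> M\<close> S(4,7,8) by simp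
  ultimately have "e \<in> M" by simp
  then show False using assms(4) d uv S(3,4) by simp
qed

lemma is_algebraic_closure_of_mono:
  assumes "is_algebraic_closure_of F" "F \<subseteq> M" "is_subfield M"
  shows "is_algebraic_closure_of M"
proof -
  have "algebraic_over M x" for x
  proof -
    obtain p where "p \<noteq> 0" "poly_over F p" "poly p x = 0"
      using assms(1) unfolding is_algebraic_closure_of_def algebraic_over_def by blast
    then show ?thesis using assms(2) unfolding algebraic_over_def poly_over_def by blast
  qed
  then show ?thesis using assms unfolding is_algebraic_closure_of_def by blast
qed

text \<open>The conjugation \<open>u + v d\<close> to \<open>u - v d\<close> of \<open>M(d)\<close>
  is a partial isomorphism and extends to the closure.\<close>

lemma ex_Aut_sqrt:
  assumes M: "is_algebraic_closure_of M" and d: "d * d \<in> M" "d \<notin> M"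
  shows "\<exists>\<sigma>\<in>Aut M. \<sigma> d = - d"
proof -
  have sf: "is_subfield M" using M unfolding is_algebraic_closure_of_def by simp
  note S = is_subfieldD[OF sf]
  define R where "R = {(u + v * d, u - v * d) | u v. u \<in> M \<and> v \<in> M}"
  have inR: "(u + v * d, u - v * d) \<in> R" if "u \<in> M" "v \<in> M" for u v
    using that unfolding R_def by blast
  have "partial_iso M R"
    unfolding partial_iso_def
  proof (intro conjI ballI allI impI)
    show "(f, f) \<in> R" if "f \<in> M" for f using inR[OF that S(1)] by simp
    fix x y x' y' assume "(x, y) \<in> R" "(x', y') \<in> R"
    then obtain u v u' v' where e: "x = u + v * d" "y = u - v * d" "x' = u' + v' * d" "y' = u' - v' * d"
      and uv: "u \<in> M" "v \<in> M" "u' \<in> M" "v' \<in> M" unfolding R_def by blast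
    show "(x + x', y + y') \<in> R"
      using inR[OF S(3)[OF uv(1,3)] S(3)[OF uv(2,4)]] unfolding e by (simp add: algebra_simps)
    have "x * x' = (u * u' + v * v' * (d * d)) + (u * v' + v * u') * d"
         "y * y' = (u * u' + v * v' * (d * d)) - (u * v' + v * u') * d"
      unfolding e by (simp_all add: algebra_simps)
    then show "(x * x', y * y') \<in> R"
      using inR[of "u * u' + v * v' * (d * d)" "u * v' + v * u'"] S(3,4) uv d by simp
  next
    fix y assume "(0, y) \<in> R"
    then obtain u v where e: "u + v * d = 0" "y = u - v * d" and uv: "u \<in> M" "v \<in> M"
      unfolding R_def by force
    have "v = 0"
    proof (rule ccontr)
      assume "v \<noteq> 0"
      then have "d = (- u) / v" using e(1) by (simp add: field_simps add_eq_0_iff)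
      then show False using d(2) S(5,8) uv by metis
    qed
    then show "y = 0" using e by simp
  qed
  then obtain \<sigma> where "\<sigma> \<in> Aut M" and R: "\<forall>(x, y)\<in>R. \<sigma> x = y" using partial_iso_extend[OF M] by blast
  then have "\<sigma> d = - d" using bspec[OF R, of "(d, - d)"] inR[OF S(1) S(2)] by simp
  then show ?thesis using \<open>\<sigma> \<in> Aut M\<close> by (rule bexI)
qed

subsection \<open>Fixed fields of towers of square roots\<close>

text \<open>Each entry is a square root over the field generated so far, but may already lie in it.
  No degree is claimed, so no independence has to be proved.\<close>

fun sqrt_tower :: "'k::field set \<Rightarrow> 'k list \<Rightarrow> bool" where
  "sqrt_tower F [] = True"
| "sqrt_tower F (d # ds) = (d * d \<in> F \<and> sqrt_tower (adjoin F {d}) ds)"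

text \<open>Automorphisms over \<open>F(d)\<close> also fix \<open>x\<close>, so induction puts
  \<open>x\<close> into \<open>F(d)\<close>; writing \<open>x = u + v d\<close>, an automorphism
  negating \<open>d\<close> forces \<open>2 v d = 0\<close>. This is how the fields built later are
  seen to have fixed field \<open>F\<close>.\<close>

lemma sqrt_tower_fixed:
  fixes F :: "'k::field set"
  assumes "is_algebraic_closure_of F" "(2::'k) \<noteq> 0" "sqrt_tower F ds"
    and "x \<in> adjoin F (set ds)" "\<And>\<sigma>. \<sigma> \<in> Aut F \<Longrightarrow> \<sigma> x = x"
  shows "x \<in> F"
  using assms
proof (induction ds arbitrary: F)
  case Nil
  then show ?case using adjoin_empty unfolding is_algebraic_closure_of_def by auto
next
  case (Cons d ds)
  have sf: "is_subfield F" using Cons.prems(1) unfolding is_algebraic_closure_of_def by simp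
  note S = is_subfieldD[OF sf]
  have dF: "d * d \<in> F" using Cons.prems by simp
  have ac: "is_algebraic_closure_of (adjoin F {d})"
    by (intro is_algebraic_closure_of_mono[OF Cons.prems(1)] adjoin_superset is_subfield_adjoin)
  have "x \<in> adjoin F {d}"
  proof (rule Cons.IH[OF ac Cons.prems(2)])
    show "sqrt_tower (adjoin F {d}) ds" using Cons.prems by simp
    show "x \<in> adjoin (adjoin F {d}) (set ds)" using Cons.prems(4) by (simp add: adjoin_adjoin)
    show "\<sigma> x = x" if "\<sigma> \<in> Aut (adjoin F {d})" for \<sigma>
      using Cons.prems(5) that Gal_mono[OF adjoin_superset(1)] by blast
  qed
  then obtain u v where x: "x = u + v * d" and uv: "u \<in> F" "v \<in> F"
    unfolding adjoin_quadratic[OF sf dF] by blast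
  show ?case
  proof (cases "d \<in> F")
    case True then show ?thesis using x uv S by simp
  next
    case False
    then obtain \<sigma> where s: "\<sigma> \<in> Aut F" "\<sigma> d = - d" using ex_Aut_sqrt[OF Cons.prems(1) dF] by blast
    then have "\<sigma> x = u - v * d" unfolding x using AutD[OF s(1)] uv by simp
    then have "2 * (v * d) = 0" using Cons.prems(5)[OF s(1)] x by (simp add: algebra_simps)
    then show ?thesis using Cons.prems(2) x uv by auto
  qed
qed

section \<open>Galois extensions from stability under automorphisms of the closure\<close>

lemma poly_Aut:
  assumes s: "\<sigma> \<in> Aut F" and p: "poly_over F p"
  shows "\<sigma> (poly p x) = poly p (\<sigma> x)"
  using p
proof (induction p)
  case 0 then show ?case using AutD(4)[OF s] by simp
next
  case (pCons c p)
  have co: "coeff (pCons c p) n \<in> F" for n using pCons.prems unfolding poly_over_def by simp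
  have "c \<in> F" using co[of 0] by simp
  moreover have "poly_over F p" unfolding poly_over_def using co[of "Suc _"] by simp
  ultimately show ?case using pCons.IH AutD(1,2,3)[OF s] by simp
qed

lemma prod_linear_monic:
  fixes A :: "'k::field set"
  assumes "finite A"
  shows "lead_coeff (\<Prod>y\<in>A. [:- y, 1:]) = 1 \<and> degree (\<Prod>y\<in>A. [:- y, 1:]) = card A"
  using assms
proof (induction A rule: finite_induct)
  case (insert x A)
  have "(\<Prod>y\<in>A. [:- y, 1:]) \<noteq> 0" using insert by auto
  then have "degree ([:- x, 1:] * (\<Prod>y\<in>A. [:- y, 1:])) = Suc (card A)"
    using insert degree_mult_eq[of "[:- x, 1:]" "\<Prod>y\<in>A. [:- y, 1:]"] by simp
  moreover have "lead_coeff ([:- x, 1:] * (\<Prod>y\<in>A. [:- y, 1:])) = 1"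
    unfolding lead_coeff_mult using conjunct1[OF insert.IH] by simp
  ultimately show ?case using insert by simp
qed simp

lemma map_poly_hom_mult:
  assumes "\<sigma> \<in> Aut F"
  shows "map_poly \<sigma> (p * q) = map_poly \<sigma> p * map_poly \<sigma> q"
proof (rule poly_eqI)
  fix n
  note D = AutD[OF assms]
  have "\<sigma> (sum f A) = (\<Sum>i\<in>A. \<sigma> (f i))" for f and A :: "nat set"
    by (induction A rule: infinite_finite_induct) (auto simp: D)
  then show "coeff (map_poly \<sigma> (p * q)) n = coeff (map_poly \<sigma> p * map_poly \<sigma> q) n"
    by (simp add: coeff_map_poly D coeff_mult)
qed

lemma poly_over_mult:
  assumes "is_subfield L" "poly_over L p" "poly_over L q"
  shows "poly_over L (p * q)"
proof -
  note S = is_subfieldD[OF assms(1)]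
  have "sum f A \<in> L" if "\<And>i. f i \<in> L" for f and A :: "nat set"
    using that S by (induction A rule: infinite_finite_induct) auto
  then show ?thesis using assms(2,3) S(4) unfolding poly_over_def coeff_mult by simp
qed

text \<open>The polynomial of \<open>x\<close> is the product of \<open>X - y\<close> over the orbit
  of \<open>x\<close> under \<open>Aut F\<close>, which is finite because it consists of roots of
  one polynomial. Its coefficients are fixed, hence in \<open>F\<close>; it is irreducible because a
  factor over \<open>F\<close> vanishing at \<open>x\<close> vanishes on the whole orbit. The linear
  factors are distinct by construction.\<close>

lemma galois_ext_if_stable:
  fixes F :: "'k::field set"
  assumes F: "is_algebraic_closure_of F" and L: "is_subfield L" "F \<subseteq> L"
    and stable: "\<And>\<sigma> x. \<sigma> \<in> Aut F \<Longrightarrow> x \<in> L \<Longrightarrow> \<sigma> x \<in> L"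
    and fixed: "\<And>x. x \<in> L \<Longrightarrow> (\<And>\<sigma>. \<sigma> \<in> Aut F \<Longrightarrow> \<sigma> x = x) \<Longrightarrow> x \<in> F"
  shows "galois_ext F L"
proof -
  have sf: "is_subfield F" and alg: "\<And>x. algebraic_over F x"
    using F unfolding is_algebraic_closure_of_def by auto
  have "\<exists>p. irreducible_over F p \<and> poly p x = 0 \<and>
        (\<exists>rs. distinct rs \<and> set rs \<subseteq> L \<and> p = smult (lead_coeff p) (\<Prod>r\<leftarrow>rs. [:- r, 1:]))" if x: "x \<in> L" for x
  proof -
    define O' where "O' = {\<sigma> x | \<sigma>. \<sigma> \<in> Aut F}"
    obtain p0 where p0: "p0 \<noteq> 0" "poly_over F p0" "poly p0 x = 0"
      using alg unfolding algebraic_over_def by blast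
    have roots: "poly q y = 0" if "poly_over F q" "poly q x = 0" "y \<in> O'" for q y
      using that poly_Aut[of _ F q x] AutD(4) unfolding O'_def by auto
    then have "O' \<subseteq> {y. poly p0 y = 0}" using p0 by blast
    then have fin: "finite O'" using poly_roots_finite[OF p0(1)] finite_subset by blast
    have xO: "x \<in> O'" unfolding O'_def using Gal_id[of UNIV F] by (metis (mono_tags, lifting) id_apply mem_Collect_eq)
    have OL: "O' \<subseteq> L" unfolding O'_def using stable x by blast
    define p where "p = (\<Prod>y\<in>O'. [:- y, 1:])"
    have pz: "poly p z = 0 \<longleftrightarrow> z \<in> O'" for z unfolding p_def poly_prod using fin by auto
    have monic: "lead_coeff p = 1" and degp: "degree p = card O'"
      unfolding p_def using prod_linear_monic[OF fin] by auto
    have "poly_over L (\<Prod>y\<in>A. [:- y, 1:])" if "finite A" "A \<subseteq> L" for A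
      using that
    proof (induction A rule: finite_induct)
      case empty
      then show ?case using is_subfieldD(1,2)[OF L(1)] unfolding poly_over_def by simp
    next
      case (insert y A)
      have "poly_over L [:- y, 1:]"
        using insert is_subfieldD(1,2,5)[OF L(1)] unfolding poly_over_def by (auto simp: coeff_pCons split: nat.splits)
      then show ?case using insert poly_over_mult[OF L(1), of "[:- y, 1:]" "\<Prod>y\<in>A. [:- y, 1:]"]
        by (simp del: mult_pCons_left)
    qed
    then have pL: "poly_over L p" unfolding p_def using fin OL by blast
    have pF: "poly_over F p"
      unfolding poly_over_def
    proof (intro allI fixed)
      fix n show "coeff p n \<in> L" using pL unfolding poly_over_def by simp
      fix \<sigma> assume s: "\<sigma> \<in> Aut F"
      have inj: "inj_on \<sigma> O'" using AutD(11)[OF s] by (simp add: inj_on_def)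
      have "\<sigma> ` O' \<subseteq> O'" unfolding O'_def using Gal_comp[OF s] by (auto simp: image_iff) (metis comp_apply)
      then have im: "\<sigma> ` O' = O'" using inj fin by (simp add: endo_inj_surj)
      have mp: "map_poly \<sigma> (\<Prod>y\<in>A. [:- y, 1:]) = (\<Prod>y\<in>A. [:- \<sigma> y, 1:])" if "finite A" for A
        using that
      proof (induction A rule: finite_induct)
        case empty then show ?case using AutD(4,5)[OF s] by (simp add: map_poly_1)
      next
        case (insert y A)
        have "map_poly \<sigma> [:- y, 1:] = [:- \<sigma> y, 1:]"
          using AutD(4,5,6)[OF s] by (simp add: map_poly_pCons)
        then show ?case using insert map_poly_hom_mult[OF s, of "[:- y, 1:]" "\<Prod>y\<in>A. [:- y, 1:]"]
          by (simp del: mult_pCons_left)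
      qed
      have "map_poly \<sigma> p = (\<Prod>y\<in>\<sigma> ` O'. [:- y, 1:])"
        unfolding p_def mp[OF fin] by (simp add: prod.reindex[OF inj])
      then have "map_poly \<sigma> p = p" using im p_def by simp
      then show "\<sigma> (coeff p n) = coeff p n"
        using coeff_map_poly[of \<sigma> p n] AutD(4)[OF s] by simp
    qed
    have irr: "degree q = 0 \<or> degree r = 0"
      if qr: "poly_over F q" "poly_over F r" "p = q * r" for q r
    proof -
      have p_nz: "p \<noteq> 0" using monic by auto
      have big: "degree p \<le> degree q" if "poly_over F q" "poly q x = 0" "q \<noteq> 0" for q
      proof -
        have "O' \<subseteq> {y. poly q y = 0}" using roots[OF that(1,2)] by blast
        then have "card O' \<le> card {y. poly q y = 0}"
          by (intro card_mono poly_roots_finite that(3))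
        also have "\<dots> \<le> degree q" by (rule card_poly_roots_bound[OF that(3)])
        finally show ?thesis using degp by simp
      qed
      have nz: "q \<noteq> 0" "r \<noteq> 0" using p_nz qr(3) by auto
      have "poly q x = 0 \<or> poly r x = 0" using pz[of x] xO qr(3) by simp
      moreover have "degree p = degree q + degree r" using qr(3) nz by (simp add: degree_mult_eq)
      ultimately show ?thesis using big[of q] big[of r] qr nz by fastforce
    qed
    have "degree p > 0" using degp xO fin card_gt_0_iff[of O'] by auto
    then have "irreducible_over F p" unfolding irreducible_over_def using pF irr by simp
    moreover obtain rs where rs: "set rs = O'" "distinct rs" using finite_distinct_list[OF fin] by blast
    moreover have "p = smult (lead_coeff p) (\<Prod>r\<leftarrow>rs. [:- r, 1:])"
      using rs monic prod.distinct_set_conv_list[OF rs(2), of "\<lambda>y. [:- y, 1:]"] unfolding p_def by simp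
    ultimately show ?thesis using pz[of x] xO OL by (intro exI[of _ p] conjI exI[of _ rs]) simp_all
  qed
  then show ?thesis unfolding galois_ext_def using sf L by simp
qed

text \<open>The identity outside \<open>L\<close> is the normalisation that \<open>Gal\<close>
  imposes on its elements.\<close>

definition restr :: "'k set \<Rightarrow> ('k \<Rightarrow> 'k) \<Rightarrow> 'k \<Rightarrow> 'k" where
  "restr L \<sigma> = (\<lambda>x. if x \<in> L then \<sigma> x else x)"

lemma restr_in_Gal:
  assumes L: "is_subfield L" and M: "is_subfield M" "L \<subseteq> M" "F \<subseteq> L"
    and stable: "\<And>\<sigma> x. \<sigma> \<in> carrier (Gal M F) \<Longrightarrow> x \<in> L \<Longrightarrow> \<sigma> x \<in> L"
    and s: "\<sigma> \<in> carrier (Gal M F)"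
  shows "restr L \<sigma> \<in> carrier (Gal L F)"
proof -
  have FM: "F \<subseteq> M" using M by blast
  note S = is_subfieldD[OF L] and D = GalD[OF M(1) s]
  obtain \<tau> where t: "\<tau> \<in> carrier (Gal M F)" "\<tau> \<circ> \<sigma> = id" using Gal_inverse[OF M(1) FM s] by blast
  interpret group "Gal M F" by (rule group_Gal[OF M(1) FM])
  have "\<sigma> \<circ> \<tau> = id"
    using inv_comm[of \<tau> \<sigma>] t s by simp
  then have "x \<in> \<sigma> ` L" if "x \<in> L" for x
    using stable[OF t(1) that] by (metis comp_apply id_apply imageI)
  then have "\<sigma> ` L = L" using stable[OF s] by blast
  moreover have "inj_on \<sigma> L" using D(12) M(2) by (meson inj_onI subsetD)
  ultimately have "bij_betw (restr L \<sigma>) L L" unfolding bij_betw_def restr_def inj_on_def by force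
  then show ?thesis
    unfolding Gal_carrier using D(2,3,4) M S(3,4) by (auto simp: restr_def subset_iff)
qed

lemma Gal_extend:
  assumes F: "is_algebraic_closure_of F" and L: "is_subfield L" "F \<subseteq> L" and s: "\<sigma> \<in> carrier (Gal L F)"
  shows "\<exists>\<tau>\<in>Aut F. \<forall>x\<in>L. \<tau> x = \<sigma> x"
proof -
  note S = is_subfieldD[OF L(1)] and D = GalD[OF L(1) s]
  define R where "R = {(x, \<sigma> x) | x. x \<in> L}"
  have "partial_iso F R"
    unfolding partial_iso_def
  proof (intro conjI ballI allI impI)
    show "(f, f) \<in> R" if "f \<in> F" for f unfolding R_def using D(4)[OF that] L(2) that by force
    fix x y x' y' assume "(x, y) \<in> R" "(x', y') \<in> R"
    then have "y = \<sigma> x" "y' = \<sigma> x'" "x \<in> L" "x' \<in> L" unfolding R_def by auto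
    then show "(x + x', y + y') \<in> R" "(x * x', y * y') \<in> R"
      unfolding R_def using D(2,3)[of x x'] S(3,4)[of x x'] by auto
  next
    fix y assume "(0, y) \<in> R" then show "y = 0" unfolding R_def using D(5) by auto
  qed
  then obtain \<tau> where "\<tau> \<in> Aut F" "\<forall>(x, y)\<in>R. \<tau> x = y" using partial_iso_extend[OF F] by blast
  then show ?thesis unfolding R_def by (intro bexI[of _ \<tau>]) auto
qed

subsection \<open>Fixed fields and normality of Galois extensions\<close>

lemma minimal_poly_dvd:
  assumes F: "is_subfield F" and m: "poly_over F m" "m \<noteq> 0" "poly m x = 0"
    and min: "\<And>p. poly_over F p \<Longrightarrow> p \<noteq> 0 \<Longrightarrow> poly p x = 0 \<Longrightarrow> degree m \<le> degree p"
    and q: "poly_over F q" "poly q x = 0"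
  shows "\<exists>k. poly_over F k \<and> q = m * k"
  using q
proof (induction "degree q" arbitrary: q rule: less_induct)
  case less
  note S = is_subfieldD[OF F]
  show ?case
  proof (cases "q = 0")
    case True
    then show ?thesis using S(1) by (intro exI[of _ 0]) (simp add: poly_over_def)
  next
    case False
    then have dle: "degree m \<le> degree q" using min less.prems by blast
    define c where "c = lead_coeff q / lead_coeff m"
    define t where "t = monom c (degree q - degree m)"
    have cF: "c \<in> F" unfolding c_def using less.prems m S(8) unfolding poly_over_def by blast
    then have tF: "poly_over F t" unfolding t_def poly_over_def using S(1) by simp
    define q1 where "q1 = q - t * m"
    have q1F: "poly_over F q1"
      unfolding q1_def poly_over_def using less.prems(1) poly_over_mult[OF F tF m(1)] S(7) unfolding poly_over_def by simp
    have q1x: "poly q1 x = 0" unfolding q1_def using less.prems m by simp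
    have "degree q1 < degree q \<or> q1 = 0"
    proof (rule disjCI)
      assume nz: "q1 \<noteq> 0"
      have "degree (t * m) \<le> degree q"
        using degree_mult_le[of t m] degree_monom_le[of c "degree q - degree m"] dle unfolding t_def by linarith
      then have "degree q1 \<le> degree q" unfolding q1_def by (intro degree_diff_le) auto
      moreover have "coeff q1 (degree q) = 0"
        using coeff_monom_mult[of c "degree q - degree m" m "degree q"] dle m(2)
        unfolding q1_def t_def c_def by simp
      ultimately show "degree q1 < degree q" using nz by (metis leading_coeff_0_iff le_neq_implies_less)
    qed
    then obtain k where k: "poly_over F k" "q1 = m * k"
    proof
      assume "degree q1 < degree q"
      then show ?thesis using less.hyps[OF _ q1F q1x] that by blast
    next
      assume "q1 = 0"
      then show ?thesis using that[of 0] S(1) by (simp add: poly_over_def)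
    qed
    have "q = m * (k + t)" using k(2) unfolding q1_def by (simp add: algebra_simps)
    moreover have "poly_over F (k + t)" using k(1) tF S(3) unfolding poly_over_def by simp
    ultimately show ?thesis by blast
  qed
qed

text \<open>The conjugation sends \<open>q(x)\<close> to \<open>q(x')\<close>. It is well defined
  because the minimal polynomial of \<open>x\<close> divides the irreducible \<open>p\<close> with
  constant cofactor and so also kills \<open>x'\<close>.\<close>

lemma ex_Aut_conjugate:
  assumes F: "is_algebraic_closure_of F" and p: "irreducible_over F p" "poly p x = 0" "poly p x' = 0"
  shows "\<exists>\<sigma>\<in>Aut F. \<sigma> x = x'"
proof -
  have sf: "is_subfield F" using F unfolding is_algebraic_closure_of_def by simp
  note S = is_subfieldD[OF sf]
  have pF: "poly_over F p" and p0: "p \<noteq> 0" using p(1) unfolding irreducible_over_def by auto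
  define Q where "Q = (\<lambda>q. poly_over F q \<and> q \<noteq> 0 \<and> poly q x = 0)"
  have "Q p" unfolding Q_def using pF p0 p(2) by simp
  then obtain m where m: "Q m" and min: "\<And>q. Q q \<Longrightarrow> degree m \<le> degree q"
    using ex_has_least_nat[of Q p degree] by blast
  have dv: "\<exists>k. poly_over F k \<and> q = m * k" if "poly_over F q" "poly q x = 0" for q
    by (rule minimal_poly_dvd[OF sf]) (use m min that in \<open>auto simp: Q_def\<close>)
  obtain k where k: "poly_over F k" "p = m * k" using dv[OF pF p(2)] by blast
  have "degree m \<noteq> 0"
  proof
    assume "degree m = 0"
    then obtain c where "m = [:c:]" by (rule degree_eq_zeroE)
    then show False using m unfolding Q_def by simp
  qed
  moreover have "degree m = 0 \<or> degree k = 0"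
    using p(1) k m unfolding irreducible_over_def Q_def by (metis (no_types, lifting))
  ultimately have "degree k = 0" by simp
  then obtain c where "k = [:c:]" by (rule degree_eq_zeroE)
  then have mx': "poly m x' = 0" using k(2) p(3) p0 by auto
  define R where "R = {(poly q x, poly q x') | q. poly_over F q}"
  have inR: "(poly q x, poly q x') \<in> R" if "poly_over F q" for q using that unfolding R_def by blast
  have "partial_iso F R"
    unfolding partial_iso_def
  proof (intro conjI ballI allI impI)
    show "(f, f) \<in> R" if "f \<in> F" for f
    proof -
      have "poly_over F [:f:]" using that S(1) unfolding poly_over_def by (simp add: coeff_pCons split: nat.splits)
      then show ?thesis using inR[of "[:f:]"] by simp
    qed
    fix u v u' v' assume "(u, v) \<in> R" "(u', v') \<in> R"
    then obtain q q' where q: "poly_over F q" "poly_over F q'"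
      and e: "u = poly q x" "v = poly q x'" "u' = poly q' x" "v' = poly q' x'" unfolding R_def by blast
    have "poly_over F (q + q')" using q S(3) unfolding poly_over_def by simp
    then show "(u + u', v + v') \<in> R" using inR[of "q + q'"] e by simp
    show "(u * u', v * v') \<in> R" using inR[of "q * q'", OF poly_over_mult[OF sf q]] e by simp
  next
    fix v assume "(0, v) \<in> R"
    then obtain q where q: "poly_over F q" "poly q x = 0" "v = poly q x'" unfolding R_def by auto
    then show "v = 0" using dv[OF q(1,2)] mx' by auto
  qed
  then obtain \<sigma> where "\<sigma> \<in> Aut F" and R: "\<forall>(x, y)\<in>R. \<sigma> x = y" using partial_iso_extend[OF F] by blast
  have "poly_over F [:0, 1:]" using S(1,2) unfolding poly_over_def by (simp add: coeff_pCons split: nat.splits)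
  then have "\<sigma> x = x'" using bspec[OF R inR[of "[:0, 1:]"]] by simp
  then show ?thesis using \<open>\<sigma> \<in> Aut F\<close> by (rule bexI)
qed

lemma poly_Gal:
  assumes L: "is_subfield L" "F \<subseteq> L" and s: "\<sigma> \<in> carrier (Gal L F)" and p: "poly_over F p" and x: "x \<in> L"
  shows "poly p x \<in> L \<and> \<sigma> (poly p x) = poly p (\<sigma> x)"
  using p
proof (induction p)
  case 0 then show ?case using GalD(5)[OF L(1) s] is_subfieldD(1)[OF L(1)] by simp
next
  case (pCons c p)
  note D = GalD[OF L(1) s] and S = is_subfieldD[OF L(1)]
  have co: "coeff (pCons c p) n \<in> F" for n using pCons.prems unfolding poly_over_def by simp
  have c: "c \<in> F" using co[of 0] by simp
  have "poly_over F p" unfolding poly_over_def using co[of "Suc _"] by simp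
  then have IH: "poly p x \<in> L" "\<sigma> (poly p x) = poly p (\<sigma> x)" using pCons.IH by auto
  have cL: "c \<in> L" using c L(2) by blast
  show ?case using D(2)[OF cL S(4)[OF x IH(1)]] D(3)[OF x IH(1)] D(4)[OF c] IH S(3)[OF cL S(4)[OF x IH(1)]] by simp
qed

lemma galois_ext_poly:
  assumes "galois_ext F L" "x \<in> L"
  obtains p rs where "irreducible_over F p" "poly p x = 0" "distinct rs" "set rs \<subseteq> L"
    "p = smult (lead_coeff p) (\<Prod>r\<leftarrow>rs. [:- r, 1:])" "\<And>z. poly p z = 0 \<longleftrightarrow> z \<in> set rs"
proof -
  obtain p rs where p: "irreducible_over F p" "poly p x = 0" "distinct rs" "set rs \<subseteq> L"
    "p = smult (lead_coeff p) (\<Prod>r\<leftarrow>rs. [:- r, 1:])"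
    using assms unfolding galois_ext_def by blast
  have "p \<noteq> 0" using p(1) unfolding irreducible_over_def by auto
  then have "lead_coeff p \<noteq> 0" by simp
  moreover have "poly (\<Prod>r\<leftarrow>rs. [:- r, 1:]) z = 0 \<longleftrightarrow> z \<in> set rs" for z
    by (induction rs) auto
  ultimately have "poly p z = 0 \<longleftrightarrow> z \<in> set rs" for z
    by (subst p(5)) (simp add: poly_smult)
  then show ?thesis using that p by blast
qed

lemma galois_ext_stable:
  assumes E: "galois_ext F E" and L: "is_subfield L" "E \<subseteq> L" and s: "\<sigma> \<in> carrier (Gal L F)" and x: "x \<in> E"
  shows "\<sigma> x \<in> E"
proof -
  obtain p rs where p: "irreducible_over F p" "poly p x = 0" "set rs \<subseteq> E" "\<And>z. poly p z = 0 \<longleftrightarrow> z \<in> set rs"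
    using galois_ext_poly[OF E x] by metis
  have FL: "F \<subseteq> L" using E L unfolding galois_ext_def by blast
  have "poly_over F p" using p(1) unfolding irreducible_over_def by simp
  then have "poly p (\<sigma> x) = \<sigma> (poly p x)" using poly_Gal[OF L(1) FL s] x L(2) by auto
  then show ?thesis using p GalD(5)[OF L(1) s] by auto
qed

text \<open>Every root of the polynomial of \<open>x\<close> is the image of \<open>x\<close> under
  an automorphism that restricts to \<open>L\<close>. If all of these fix \<open>x\<close>, the
  distinct linear factors reduce to one, and \<open>x\<close> is a quotient of coefficients.\<close>

lemma galois_ext_fixed:
  assumes F: "is_algebraic_closure_of F" and L: "galois_ext F L" and x: "x \<in> L"
    and fixed: "\<And>\<sigma>. \<sigma> \<in> carrier (Gal L F) \<Longrightarrow> \<sigma> x = x"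
  shows "x \<in> F"
proof -
  obtain p rs where p: "irreducible_over F p" "poly p x = 0" "distinct rs" "set rs \<subseteq> L"
    "p = smult (lead_coeff p) (\<Prod>r\<leftarrow>rs. [:- r, 1:])" "\<And>z. poly p z = 0 \<longleftrightarrow> z \<in> set rs"
    using galois_ext_poly[OF L x] by metis
  have sf: "is_subfield L" "F \<subseteq> L" "is_subfield F" using L unfolding galois_ext_def by auto
  have "set rs \<subseteq> {x}"
  proof
    fix x' assume "x' \<in> set rs"
    then have "poly p x' = 0" using p(6) by simp
    then obtain \<sigma> where s: "\<sigma> \<in> Aut F" "\<sigma> x = x'" using ex_Aut_conjugate[OF F p(1,2)] by blast
    have "restr L \<sigma> \<in> carrier (Gal L F)"
      by (rule restr_in_Gal[OF sf(1) is_subfield_UNIV _ sf(2) _ s(1)])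
        (use galois_ext_stable[OF L is_subfield_UNIV] in auto)
    then have "\<sigma> x = x" using fixed x unfolding restr_def by fastforce
    then show "x' \<in> {x}" using s(2) by simp
  qed
  moreover have "x \<in> set rs" using p(2,6) by simp
  ultimately have "set rs = {x}" by blast
  then have "rs = [x]" using p(3) by (metis distinct_card card_1_singleton_iff One_nat_def is_singletonI is_singleton_altdef length_0_conv length_Suc_conv list.set_intros(1) singletonD)
  then have "p = smult (lead_coeff p) [:- x, 1:]" using p(5) by simp
  then have "coeff p 0 = - (lead_coeff p * x)" by (metis coeff_pCons_0 mult_minus_right smult_pCons)
  moreover have "coeff p n \<in> F" for n using p(1) unfolding irreducible_over_def poly_over_def by simp
  moreover have "lead_coeff p \<noteq> 0" using p(1) unfolding irreducible_over_def by auto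
  ultimately have "x = - coeff p 0 / lead_coeff p" and co: "\<And>n. coeff p n \<in> F" by simp_all
  moreover have "- coeff p 0 / lead_coeff p \<in> F" by (intro is_subfieldD(5,8)[OF sf(3)] co)
  ultimately show ?thesis by simp
qed

subsection \<open>Independence of automorphisms\<close>

text \<open>Dedekind's argument: choose \<open>y\<close> with \<open>g y\<close> different from
  \<open>h y\<close> and subtract \<open>h y\<close> times the relation at \<open>x\<close> from the
  relation at \<open>y * x\<close>; the term of \<open>h\<close> drops out and induction
  applies.\<close>

lemma Gal_independent:
  assumes L: "is_subfield L" and "finite H" "H \<subseteq> carrier (Gal L F)"
    and "\<And>x. x \<in> L \<Longrightarrow> (\<Sum>h\<in>H. c h * h x) = 0"
  shows "\<forall>h\<in>H. c h = 0"
  using assms(2-)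
proof (induction H arbitrary: c rule: finite_induct)
  case (insert h H)
  note S = is_subfieldD[OF L]
  have hG: "h \<in> carrier (Gal L F)" using insert.prems by simp
  have "c g = 0" if g: "g \<in> H" for g
  proof -
    have gG: "g \<in> carrier (Gal L F)" using insert.prems g by auto
    have "g \<noteq> h" using g insert.hyps by auto
    then obtain y where "g y \<noteq> h y" by auto
    then have y: "y \<in> L" using GalD(13)[OF L gG] GalD(13)[OF L hG] by metis
    have "\<forall>f\<in>H. c f * (f y - h y) = 0"
    proof (rule insert.IH)
      show "H \<subseteq> carrier (Gal L F)" using insert.prems by simp
      fix x assume x: "x \<in> L"
      have "(\<Sum>f\<in>insert h H. c f * f (y * x)) = (\<Sum>f\<in>insert h H. c f * f y * f x)"
        by (intro sum.cong refl) (use insert.prems(1) GalD(3)[OF L _ y x] in \<open>auto simp: mult.assoc\<close>)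
      then have 1: "(\<Sum>f\<in>insert h H. c f * f y * f x) = 0" using insert.prems(2)[OF S(4)[OF y x]] by simp
      have 2: "(\<Sum>f\<in>insert h H. c f * f x) * h y = 0" using insert.prems(2)[OF x] by simp
      have "(\<Sum>f\<in>H. c f * (f y - h y) * f x) = (\<Sum>f\<in>insert h H. c f * (f y - h y) * f x)"
        using insert.hyps by simp
      also have "\<dots> = (\<Sum>f\<in>insert h H. c f * f y * f x) - (\<Sum>f\<in>insert h H. c f * f x) * h y"
        unfolding sum_distrib_right sum_subtractf[symmetric] by (intro sum.cong refl) (simp add: algebra_simps)
      finally show "(\<Sum>f\<in>H. c f * (f y - h y) * f x) = 0" using 1 2 by simp
    qed
    then show ?thesis using g \<open>g y \<noteq> h y\<close> by auto
  qed
  moreover from this have "c h = 0" using insert.prems(2)[OF S(2)] insert.hyps GalD(6)[OF L hG] by simp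
  ultimately show ?case by simp
qed simp

text \<open>The eigenvector is a Lagrange resolvent, the sum of \<open>\<psi> h * h x\<close>;
  independence of the automorphisms provides an \<open>x\<close> for which it does not
  vanish.\<close>

lemma Gal_eigenvector:
  assumes L: "is_subfield L" and K: "K \<subseteq> L" and fin: "finite (carrier (Gal L K))"
    and pm: "\<And>h. h \<in> carrier (Gal L K) \<Longrightarrow> \<psi> h = 1 \<or> \<psi> h = -1"
    and hom: "\<And>g h. g \<in> carrier (Gal L K) \<Longrightarrow> h \<in> carrier (Gal L K) \<Longrightarrow> \<psi> (g \<circ> h) = \<psi> g * \<psi> h"
  shows "\<exists>e\<in>L. e \<noteq> 0 \<and> (\<forall>h\<in>carrier (Gal L K). h e = \<psi> h * e)"
proof -
  note S = is_subfieldD[OF L]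
  let ?H = "carrier (Gal L K)"
  interpret group "Gal L K" by (rule group_Gal[OF L K])
  have "\<not> (\<forall>x\<in>L. (\<Sum>h\<in>?H. \<psi> h * h x) = 0)"
  proof
    assume "\<forall>x\<in>L. (\<Sum>h\<in>?H. \<psi> h * h x) = 0"
    then have "\<forall>h\<in>?H. \<psi> h = 0" using Gal_independent[OF L fin order_refl] by blast
    then show False using pm[OF Gal_id] Gal_id by fastforce
  qed
  then obtain x where x: "x \<in> L" "(\<Sum>h\<in>?H. \<psi> h * h x) \<noteq> 0" by blast
  define e where "e = (\<Sum>h\<in>?H. \<psi> h * h x)"
  have psiL: "\<psi> h \<in> L" if "h \<in> ?H" for h using pm[OF that] S(2) S(5)[OF S(2)] by auto
  have sumL: "sum f A \<in> L \<and> g (sum f A) = (\<Sum>a\<in>A. g (f a))"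
    if "finite A" "\<And>a. a \<in> A \<Longrightarrow> f a \<in> L" "g \<in> ?H" for A and f :: "('a \<Rightarrow> 'a) \<Rightarrow> 'a" and g
    using that(1,2)
    by (induction A rule: finite_induct) (use S(1,3) GalD(2,5)[OF L that(3)] in auto)
  have inL: "\<psi> h * h x \<in> L" if "h \<in> ?H" for h
    using S(4)[OF psiL[OF that] GalD(1)[OF L that x(1)]] .
  have "e \<in> L" unfolding e_def using sumL[of ?H "\<lambda>h. \<psi> h * h x" id] fin inL Gal_id[of L K] by simp
  moreover have "g e = \<psi> g * e" if g: "g \<in> ?H" for g
  proof -
    have gpsi: "g (\<psi> h) = \<psi> h" if "h \<in> ?H" for h
      using pm[OF that] GalD(6,7)[OF L g] S(2) by auto
    have pg: "\<psi> g * \<psi> g = 1" using pm[OF g] by auto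
    have bij: "bij_betw (\<lambda>h. g \<circ> h) ?H ?H"
    proof (rule bij_betw_byWitness[where f' = "\<lambda>h. inv\<^bsub>Gal L K\<^esub> g \<circ> h"])
      show "\<forall>h\<in>?H. inv\<^bsub>Gal L K\<^esub> g \<circ> (g \<circ> h) = h" using Gal_inv_apply[OF L K g] by auto
      show "\<forall>h\<in>?H. g \<circ> (inv\<^bsub>Gal L K\<^esub> g \<circ> h) = h" using Gal_inv_apply[OF L K g] by auto
      show "(\<lambda>h. g \<circ> h) ` ?H \<subseteq> ?H" using Gal_comp[OF g] by auto
      show "(\<lambda>h. inv\<^bsub>Gal L K\<^esub> g \<circ> h) ` ?H \<subseteq> ?H" using Gal_comp[OF inv_closed[OF g]] by auto
    qed
    have "g e = (\<Sum>h\<in>?H. g (\<psi> h * h x))" unfolding e_def using sumL[of ?H "\<lambda>h. \<psi> h * h x" g] fin inL g by simp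
    also have "\<dots> = (\<Sum>h\<in>?H. \<psi> g * (\<psi> (g \<circ> h) * (g \<circ> h) x))"
    proof (rule sum.cong[OF refl])
      fix h assume h: "h \<in> ?H"
      have "g (\<psi> h * h x) = \<psi> h * g (h x)"
        using GalD(3)[OF L g psiL[OF h] GalD(1)[OF L h x(1)]] gpsi[OF h] by simp
      then show "g (\<psi> h * h x) = \<psi> g * (\<psi> (g \<circ> h) * (g \<circ> h) x)"
        using hom[OF g h] pg by (simp add: mult.assoc[symmetric])
    qed
    also have "\<dots> = \<psi> g * (\<Sum>h\<in>?H. \<psi> (g \<circ> h) * (g \<circ> h) x)" by (simp add: sum_distrib_left)
    also have "(\<Sum>h\<in>?H. \<psi> (g \<circ> h) * (g \<circ> h) x) = e"
      unfolding e_def by (rule sum.reindex_bij_betw[OF bij])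
    finally show ?thesis .
  qed
  ultimately show ?thesis using x(2) unfolding e_def by blast
qed

section \<open>The presented groups\<close>

context group
begin

text \<open>\<open>P g k\<close> says that \<open>R\<close> is stable under right multiplication by
  \<open>(g, k)\<close>. It passes from the generators to all of \<open>G\<close>, inverses included
  because the inverse of a generator is its cube on both sides. Since \<open>R\<close> is
  single-valued, \<open>k\<close> depends only on \<open>g\<close>.\<close>

lemma ex_hom_of_relation:
  assumes H: "group H" and S: "S \<subseteq> carrier G" "generate G S = carrier G" and f: "\<And>s. s \<in> S \<Longrightarrow> f s \<in> carrier H"
    and R: "R \<subseteq> carrier G \<times> carrier H" "(\<one>, \<one>\<^bsub>H\<^esub>) \<in> R"
    and step: "\<And>g h s. (g, h) \<in> R \<Longrightarrow> s \<in> S \<Longrightarrow> (g \<otimes> s, h \<otimes>\<^bsub>H\<^esub> f s) \<in> R"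
    and uniq: "\<And>g h h'. (g, h) \<in> R \<Longrightarrow> (g, h') \<in> R \<Longrightarrow> h = h'"
    and inv: "\<And>s. s \<in> S \<Longrightarrow> inv s = s \<otimes> s \<otimes> s" "\<And>s. s \<in> S \<Longrightarrow> inv\<^bsub>H\<^esub> (f s) = f s \<otimes>\<^bsub>H\<^esub> f s \<otimes>\<^bsub>H\<^esub> f s"
  shows "\<exists>h\<in>hom G H. \<forall>s\<in>S. h s = f s"
proof -
  interpret H: group H by (rule H)
  define P where "P = (\<lambda>g k. k \<in> carrier H \<and> (\<forall>g0 h0. (g0, h0) \<in> R \<longrightarrow> (g0 \<otimes> g, h0 \<otimes>\<^bsub>H\<^esub> k) \<in> R))"
  have RC: "g \<in> carrier G" "h \<in> carrier H" if "(g, h) \<in> R" for g h using that R by auto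
  have P_mult: "P (g1 \<otimes> g2) (k1 \<otimes>\<^bsub>H\<^esub> k2)" if "P g1 k1" "P g2 k2" "g1 \<in> carrier G" "g2 \<in> carrier G" for g1 g2 k1 k2
    using that RC unfolding P_def by (auto simp: m_assoc[symmetric] H.m_assoc[symmetric])
  have P_gen: "P s (f s)" if "s \<in> S" for s
    using that f step unfolding P_def by auto
  have gen_in: "g \<in> carrier G" if "g \<in> generate G S" for g using that S(2) by simp
  have P_ex: "\<exists>k. P g k" if "g \<in> generate G S" for g
    using that
  proof (induction rule: generate.induct)
    case one
    show ?case using RC by (intro exI[of _ "\<one>\<^bsub>H\<^esub>"]) (auto simp: P_def)
  next
    case (incl h)
    then show ?case using P_gen by blast
  next
    case (inv h)
    then have "h \<in> carrier G" using S by blast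
    then have "P (h \<otimes> h \<otimes> h) (f h \<otimes>\<^bsub>H\<^esub> f h \<otimes>\<^bsub>H\<^esub> f h)" using P_gen[OF inv] by (intro P_mult) auto
    then show ?case using assms(9)[OF inv] by metis
  next
    case (eng h1 h2)
    then obtain k1 k2 where "P h1 k1" "P h2 k2" by blast
    then show ?case using P_mult eng.hyps gen_in by blast
  qed
  have P_in: "(g, k) \<in> R" if "P g k" "g \<in> carrier G" for g k
    using that R(2) unfolding P_def by fastforce
  have P_uniq: "k = k'" if "P g k" "P g k'" "g \<in> carrier G" for g k k'
    using P_in that uniq by blast
  obtain h where h: "\<And>g. g \<in> carrier G \<Longrightarrow> P g (h g)" using P_ex S(2) by metis
  have "h \<in> hom G H"
  proof (rule homI)
    fix g g' assume g: "g \<in> carrier G" "g' \<in> carrier G"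
    show "h g \<in> carrier H" using h[OF g(1)] unfolding P_def by simp
    show "h (g \<otimes> g') = h g \<otimes>\<^bsub>H\<^esub> h g'"
      using P_uniq[OF h P_mult[OF h h]] g by simp
  qed
  moreover have "h s = f s" if "s \<in> S" for s using P_uniq[OF h P_gen[OF that]] that S by blast
  ultimately show ?thesis by blast
qed

text \<open>The form of a relation \<open>a b = r\<close> that applies inside a right-nested
  word.\<close>

lemma rewr_assoc:
  "a \<otimes> b = r \<Longrightarrow> a \<in> carrier G \<Longrightarrow> b \<in> carrier G \<Longrightarrow> z \<in> carrier G \<Longrightarrow> a \<otimes> (b \<otimes> z) = r \<otimes> z"
  by (simp add: m_assoc[symmetric])

definition opt :: "bool \<Rightarrow> 'a \<Rightarrow> 'a" where
  "opt b x = (if b then x else \<one>)"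

lemma opt_simps [simp]: "opt True x = x" "opt False x = \<one>"
  by (simp_all add: opt_def)

lemma opt_closed [simp]: "x \<in> carrier G \<Longrightarrow> opt b x \<in> carrier G"
  by (simp add: opt_def)

text \<open>Two involutions whose commutator \<open>(x y)^2\<close> has order at most 2 generate a
  quotient of the dihedral group of order 8, in which that commutator is central. The relations of
  \<open>G_2\<close> contain four such pairs.\<close>

lemma dihedral_relations:
  assumes "x \<in> carrier G" "y \<in> carrier G" "x \<otimes> x = \<one>" "y \<otimes> y = \<one>"
    "commutator G x y \<otimes> commutator G x y = \<one>"
  shows "y \<otimes> x = x \<otimes> (y \<otimes> commutator G x y)"
    "commutator G x y \<otimes> x = x \<otimes> commutator G x y" "commutator G x y \<otimes> y = y \<otimes> commutator G x y"
proof -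
  define t where "t = commutator G x y"
  have ixy: "inv x = x" "inv y = y" using assms inv_equality by auto
  have t1: "t = x \<otimes> (y \<otimes> (x \<otimes> y))" unfolding t_def commutator_def ixy using assms by (simp add: m_assoc)
  have tc: "t \<in> carrier G" using t1 assms by simp
  have "t = inv t" using inv_equality[of t t] assms(5) tc unfolding t_def by simp
  also have "\<dots> = y \<otimes> (x \<otimes> (y \<otimes> x))" unfolding t1 using assms ixy by (simp add: inv_mult_group m_assoc)
  finally have t2: "t = y \<otimes> (x \<otimes> (y \<otimes> x))" .
  have x2: "x \<otimes> (x \<otimes> z) = z" "y \<otimes> (y \<otimes> z) = z" if "z \<in> carrier G" for z
    using assms that by (simp_all add: m_assoc[symmetric])
  have "x \<otimes> (y \<otimes> t) = y \<otimes> x" by (subst t2) (simp add: x2 assms)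
  moreover have "t \<otimes> x = x \<otimes> t"
  proof -
    have "t \<otimes> x = y \<otimes> (x \<otimes> y)" by (subst t2) (simp add: m_assoc assms)
    moreover have "x \<otimes> t = y \<otimes> (x \<otimes> y)" by (subst t1) (simp add: x2 assms)
    ultimately show ?thesis by simp
  qed
  moreover have "t \<otimes> y = y \<otimes> t"
  proof -
    have "t \<otimes> y = x \<otimes> (y \<otimes> x)" by (subst t1) (simp add: m_assoc assms)
    moreover have "y \<otimes> t = x \<otimes> (y \<otimes> x)" by (subst t2) (simp add: x2 assms)
    ultimately show ?thesis by simp
  qed
  ultimately show "y \<otimes> x = x \<otimes> (y \<otimes> commutator G x y)"
    "commutator G x y \<otimes> x = x \<otimes> commutator G x y" "commutator G x y \<otimes> y = y \<otimes> commutator G x y"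
    unfolding t_def by simp_all
qed

lemma commutator_closed [simp]: "x \<in> carrier G \<Longrightarrow> y \<in> carrier G \<Longrightarrow> commutator G x y \<in> carrier G"
  by (simp add: commutator_def)

subsection \<open>Normal forms in the first group\<close>

text \<open>The word x^e y^j u^f t^k c^l with u = x^2, t = [x, y] and c = [t, x]. Splitting the
  exponent of \<open>x\<close> into two bits makes all exponents boolean, which leaves at most 32
  elements.\<close>

definition nf1 :: "'a \<Rightarrow> 'a \<Rightarrow> bool \<Rightarrow> bool \<Rightarrow> bool \<Rightarrow> bool \<Rightarrow> bool \<Rightarrow> 'a" where
  "nf1 x y e j f k l = opt e x \<otimes> (opt j y \<otimes> (opt f (x \<otimes> x) \<otimes>
     (opt k (commutator G x y) \<otimes> opt l (commutator G (commutator G x y) x))))"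

lemma nf1_closed: "x \<in> carrier G \<Longrightarrow> y \<in> carrier G \<Longrightarrow> nf1 x y e j f k l \<in> carrier G"
  by (simp add: nf1_def)

text \<open>Collection rules for the order x, y, u, t, c: two letters in the wrong order are
  exchanged at the price of later letters. Only \<open>y x\<close>, \<open>t x\<close> and
  \<open>u y\<close> cost a correction, namely \<open>t\<close>, \<open>c\<close> and
  \<open>c\<close>.\<close>

lemma G1_relations:
  assumes xy: "x \<in> carrier G" "y \<in> carrier G" and r: "G1_rels G x y"
  defines "t \<equiv> commutator G x y"
  defines "c \<equiv> commutator G t x"
  defines "u \<equiv> x \<otimes> x"
  shows "t \<in> carrier G" "c \<in> carrier G" "u \<in> carrier G"
    "y \<otimes> y = \<one>" "t \<otimes> t = \<one>" "c \<otimes> c = \<one>" "u \<otimes> u = \<one>" "x \<otimes> x = u" "u \<otimes> x = x \<otimes> u"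
    "c \<otimes> x = x \<otimes> c" "c \<otimes> y = y \<otimes> c" "c \<otimes> t = t \<otimes> c" "c \<otimes> u = u \<otimes> c"
    "t \<otimes> x = x \<otimes> (t \<otimes> c)" "t \<otimes> y = y \<otimes> t" "t \<otimes> u = u \<otimes> t"
    "y \<otimes> x = x \<otimes> (y \<otimes> t)" "u \<otimes> y = y \<otimes> (u \<otimes> c)"
proof -
  show tC: "t \<in> carrier G" and cC: "c \<in> carrier G" and uC: "u \<in> carrier G"
    unfolding t_def c_def u_def using xy by simp_all
  have r': "x [^] (4::nat) = \<one>" "y [^] (2::nat) = \<one>" "t [^] (2::nat) = \<one>" "c [^] (2::nat) = \<one>"
    "c \<otimes> x = x \<otimes> c" "c \<otimes> y = y \<otimes> c"
    using r unfolding G1_rels_def Let_def t_def c_def by auto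
  show cx: "c \<otimes> x = x \<otimes> c" and cy: "c \<otimes> y = y \<otimes> c" by (rule r')+
  show y2: "y \<otimes> y = \<one>" and t2: "t \<otimes> t = \<one>" and c2: "c \<otimes> c = \<one>" and u2: "u \<otimes> u = \<one>"
    using r' xy tC cC unfolding u_def by (simp_all add: numeral_eq_Suc m_assoc)
  show xu: "x \<otimes> x = u" and "u \<otimes> x = x \<otimes> u" unfolding u_def using xy by (simp_all add: m_assoc)
  have iy: "inv y = y" and it: "inv t = t" using y2 t2 xy tC inv_equality by auto
  have tE: "t = inv x \<otimes> (y \<otimes> (x \<otimes> y))" unfolding t_def commutator_def iy using xy by (simp add: m_assoc)
  have "inv t = y \<otimes> (inv x \<otimes> (y \<otimes> x))"
    unfolding tE using xy iy by (simp add: inv_mult_group m_assoc)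
  then have tE': "t = y \<otimes> (inv x \<otimes> (y \<otimes> x))" using it by simp
  have y2': "y \<otimes> (y \<otimes> z) = z" if "z \<in> carrier G" for z using y2 xy that by (simp add: m_assoc[symmetric])
  have xi: "x \<otimes> (inv x \<otimes> z) = z" if "z \<in> carrier G" for z using xy that by (simp add: m_assoc[symmetric])
  show ty: "t \<otimes> y = y \<otimes> t"
  proof -
    have "t \<otimes> y = inv x \<otimes> (y \<otimes> x)" by (subst tE) (use xy y2 in \<open>simp add: m_assoc\<close>)
    moreover have "y \<otimes> t = inv x \<otimes> (y \<otimes> x)" by (subst tE') (use xy y2' in simp)
    ultimately show ?thesis by simp
  qed
  show yx: "y \<otimes> x = x \<otimes> (y \<otimes> t)"
  proof -
    have "x \<otimes> (t \<otimes> y) = y \<otimes> x" by (subst tE) (use xy y2 xi in \<open>simp add: m_assoc\<close>)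
    then show ?thesis using ty by simp
  qed
  have t2': "t \<otimes> (t \<otimes> z) = z" if "z \<in> carrier G" for z using t2 tC that by (simp add: m_assoc[symmetric])
  show tx: "t \<otimes> x = x \<otimes> (t \<otimes> c)"
  proof -
    have "c = t \<otimes> (inv x \<otimes> (t \<otimes> x))" unfolding c_def commutator_def it using xy tC by (simp add: m_assoc)
    then show ?thesis using xy tC t2' xi by simp
  qed
  show ct: "c \<otimes> t = t \<otimes> c"
  proof -
    have ix: "c \<otimes> inv x = inv x \<otimes> c"
      using cx xy cC by (metis inv_closed inv_solve_left inv_solve_right m_assoc m_closed)
    have e: "c \<otimes> (x \<otimes> z) = x \<otimes> (c \<otimes> z)" "c \<otimes> (y \<otimes> z) = y \<otimes> (c \<otimes> z)" "c \<otimes> (inv x \<otimes> z) = inv x \<otimes> (c \<otimes> z)"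
      if "z \<in> carrier G" for z
      using rewr_assoc[OF cx] rewr_assoc[OF cy] rewr_assoc[OF ix] xy cC that by (simp_all add: m_assoc)
    show ?thesis unfolding tE using xy cC cy by (simp add: e m_assoc)
  qed
  show cu: "c \<otimes> u = u \<otimes> c"
    unfolding u_def using rewr_assoc[OF cx] cx xy cC by (simp add: m_assoc)
  have c2': "c \<otimes> (c \<otimes> z) = z" if "z \<in> carrier G" for z using c2 cC that by (simp add: m_assoc[symmetric])
  show "t \<otimes> u = u \<otimes> t"
    unfolding u_def using rewr_assoc[OF tx] rewr_assoc[OF cx] tx cx xy tC cC c2 by (simp add: m_assoc)
  \<comment> \<open>Moving \<open>y\<close> past \<open>x\<close> twice creates \<open>t\<close>
    twice, and bringing these together past \<open>x\<close> leaves one \<open>c\<close>.\<close>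
  have yu: "y \<otimes> u = u \<otimes> (y \<otimes> c)"
    unfolding u_def using rewr_assoc[OF yx] rewr_assoc[OF tx] rewr_assoc[OF cx] yx tx cx xy tC cC t2' by (simp add: m_assoc)
  have "y \<otimes> (u \<otimes> c) = u \<otimes> y"
    using rewr_assoc[OF yu] xy cC uC c2 by (simp add: m_assoc)
  then show "u \<otimes> y = y \<otimes> (u \<otimes> c)" by simp
qed

text \<open>The exponent law is the same in every group with these relations; this is what makes the
  map between the normal forms of two such groups compatible with the generators.\<close>

lemma nf1_mult:
  assumes xy: "x \<in> carrier G" "y \<in> carrier G" and r: "G1_rels G x y"
  shows "nf1 x y e j f k l \<otimes> x = nf1 x y (\<not> e) j (f \<noteq> e) (k \<noteq> j) ((l \<noteq> k) \<noteq> (e \<and> j))" (is ?A)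
    and "nf1 x y e j f k l \<otimes> y = nf1 x y e (\<not> j) f k (l \<noteq> f)" (is ?B)
proof -
  define t c u where "t = commutator G x y" and "c = commutator G t x" and "u = x \<otimes> x"
  note R = G1_relations[OF xy r, folded t_def, folded c_def u_def]
  note C = R(1-3) and E = R(4-7,9-) u_def[symmetric]
  note E' = E[THEN rewr_assoc, OF _ _ _]
  have D: "nf1 x y e j f k l = opt e x \<otimes> (opt j y \<otimes> (opt f u \<otimes> (opt k t \<otimes> opt l c)))" for e j f k l
    unfolding nf1_def t_def[symmetric] c_def[symmetric] u_def[symmetric] ..
  show ?A unfolding D
    by (cases e; cases j; cases f; cases k; cases l) (simp_all add: m_assoc xy C E E')
  show ?B unfolding D
    by (cases e; cases j; cases f; cases k; cases l) (simp_all add: m_assoc xy C E E')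
qed

lemma G1_rels_inv:
  assumes "x \<in> carrier G" "y \<in> carrier G" "G1_rels G x y" "s \<in> {x, y}"
  shows "inv s = s \<otimes> s \<otimes> s"
proof -
  note R = G1_relations[OF assms(1-3)]
  have "s \<in> carrier G" "(s \<otimes> s \<otimes> s) \<otimes> s = \<one>" using assms(1,2,4) R(4,7) by (auto simp: m_assoc)
  then show ?thesis using inv_equality by simp
qed

text \<open>Distinctness of the normal forms suffices: pairing forms with equal exponents in
  \<open>G\<close> and \<open>H\<close> is then a single-valued relation, stable under right
  multiplication by the generators.\<close>

lemma iso_G1I:
  assumes xy: "x \<in> carrier G" "y \<in> carrier G" and r: "G1_rels G x y" and gen: "generate G {x, y} = carrier G"
    and inj: "\<And>e j f k l e' j' f' k' l'. nf1 x y e j f k l = nf1 x y e' j' f' k' l' \<Longrightarrow>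
      e = e' \<and> j = j' \<and> f = f' \<and> k = k' \<and> l = l'"
  shows "iso_G1 G"
proof -
  have "\<exists>h\<in>hom G H. h x = a \<and> h y = b"
    if H: "group H" "a \<in> carrier H" "b \<in> carrier H" "G1_rels H a b" for H :: "nat monoid" and a b
  proof -
    interpret H: group H by (rule H)
    have xny: "x \<noteq> y"
    proof
      assume "x = y"
      then have "nf1 x y True False False False False = nf1 x y False True False False False"
        unfolding nf1_def using xy by simp
      then show False using inj by blast
    qed
    define f where "f = (\<lambda>s. if s = x then a else b)"
    define R where "R = {(nf1 x y e j f k l, H.nf1 a b e j f k l) | e j f k l. True}"
    have inR: "(nf1 x y e j f k l, H.nf1 a b e j f k l) \<in> R" for e j f k l unfolding R_def by blast
    have "\<exists>h\<in>hom G H. \<forall>s\<in>{x, y}. h s = f s"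
    proof (rule ex_hom_of_relation[OF H(1) _ gen, where R = R])
      show "{x, y} \<subseteq> carrier G" using xy by simp
      show "\<And>s. s \<in> {x, y} \<Longrightarrow> f s \<in> carrier H" using H f_def by simp
      show "R \<subseteq> carrier G \<times> carrier H" unfolding R_def using nf1_closed[OF xy] H.nf1_closed[OF H(2,3)] by auto
      show "(\<one>, \<one>\<^bsub>H\<^esub>) \<in> R" using inR[of False False False False False] by (simp add: nf1_def H.nf1_def)
      show "(g \<otimes> s, h \<otimes>\<^bsub>H\<^esub> f s) \<in> R" if gh: "(g, h) \<in> R" and s: "s \<in> {x, y}" for g h s
      proof -
        obtain e j i k l where g: "g = nf1 x y e j i k l" and h: "h = H.nf1 a b e j i k l"
          using gh unfolding R_def by blast
        show ?thesis unfolding g h using s xny inR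
          by (auto simp: f_def nf1_mult[OF xy r] H.nf1_mult[OF H(2-4)])
      qed
      show "h = h'" if gh: "(g, h) \<in> R" and gh': "(g, h') \<in> R" for g h h'
      proof -
        obtain e j i k l where 1: "g = nf1 x y e j i k l" "h = H.nf1 a b e j i k l"
          using gh unfolding R_def by blast
        obtain e' j' i' k' l' where 2: "g = nf1 x y e' j' i' k' l'" "h' = H.nf1 a b e' j' i' k' l'"
          using gh' unfolding R_def by blast
        show ?thesis using inj[of e j i k l e' j' i' k' l'] 1 2 by simp
      qed
      show "\<And>s. s \<in> {x, y} \<Longrightarrow> inv s = s \<otimes> s \<otimes> s" by (rule G1_rels_inv[OF xy r])
      show "\<And>s. s \<in> {x, y} \<Longrightarrow> inv\<^bsub>H\<^esub> (f s) = f s \<otimes>\<^bsub>H\<^esub> f s \<otimes>\<^bsub>H\<^esub> f s"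
        by (rule H.G1_rels_inv[OF H(2-4)]) (simp add: f_def)
    qed
    then show ?thesis using xny by (auto simp: f_def)
  qed
  then show ?thesis unfolding iso_G1_def using group_axioms xy r gen by blast
qed

text \<open>Finiteness is needed for the Lagrange resolvent. It follows from the presentation alone,
  since the finitely many normal forms are closed under right multiplication by the
  generators.\<close>

lemma G1_finite:
  assumes xy: "x \<in> carrier G" "y \<in> carrier G" and r: "G1_rels G x y" and gen: "generate G {x, y} = carrier G"
  shows "finite (carrier G)"
proof -
  define N where "N = (\<lambda>(e, j, f, k, l). nf1 x y e j f k l) ` UNIV"
  have inN: "nf1 x y e j f k l \<in> N" for e j f k l
    unfolding N_def by (rule image_eqI[of _ _ "(e, j, f, k, l)"]) auto
  have N_sub: "N \<subseteq> carrier G" unfolding N_def using nf1_closed[OF xy] by auto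
  have step: "n \<otimes> s \<in> N" if n: "n \<in> N" and s: "s \<in> {x, y}" for n s
  proof -
    obtain e j i k l where n: "n = nf1 x y e j i k l" using n unfolding N_def by auto
    show ?thesis unfolding n using s inN by (auto simp: nf1_mult[OF xy r])
  qed
  have "n \<otimes> g \<in> N" if "g \<in> generate G {x, y}" "n \<in> N" for g n
    using that
  proof (induction arbitrary: n rule: generate.induct)
    case one then show ?case using N_sub by auto
  next
    case (incl h) then show ?case using step by blast
  next
    case (inv h)
    have hC: "h \<in> carrier G" "n \<in> carrier G" using inv xy N_sub by auto
    have "n \<otimes> h \<otimes> h \<otimes> h \<in> N" using inv step by blast
    then show ?case using G1_rels_inv[OF xy r inv(1)] hC by (simp add: m_assoc)
  next
    case (eng h1 h2)
    then have "n \<otimes> h1 \<otimes> h2 \<in> N" by blast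
    moreover have "h1 \<in> carrier G" "h2 \<in> carrier G" "n \<in> carrier G" using eng gen N_sub by auto
    ultimately show ?case by (simp add: m_assoc)
  qed
  moreover have "\<one> \<in> N" using inN[of False False False False False] by (simp add: nf1_def)
  ultimately have "carrier G \<subseteq> N" using gen l_one by (metis subsetI)
  moreover have "finite N" unfolding N_def by (intro finite_imageI finite)
  ultimately show ?thesis by (rule finite_subset)
qed

subsection \<open>Normal forms in the second group\<close>

text \<open>The letters are x, y, z, t, s, w with t = [x, y], s = [x, z] and w = [y, s]. All square
  to 1, so there are at most 64 values.\<close>

definition nf2 :: "'a \<Rightarrow> 'a \<Rightarrow> 'a \<Rightarrow> bool \<Rightarrow> bool \<Rightarrow> bool \<Rightarrow> bool \<Rightarrow> bool \<Rightarrow> bool \<Rightarrow> 'a" where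
  "nf2 x y z i j k l m n = opt i x \<otimes> (opt j y \<otimes> (opt k z \<otimes> (opt l (commutator G x y) \<otimes>
     (opt m (commutator G x z) \<otimes> opt n (commutator G y (commutator G x z))))))"

lemma nf2_closed: "x \<in> carrier G \<Longrightarrow> y \<in> carrier G \<Longrightarrow> z \<in> carrier G \<Longrightarrow> nf2 x y z i j k l m n \<in> carrier G"
  by (simp add: nf2_def)

text \<open>\<open>dihedral_relations\<close> applies to the pairs \<open>x, y\<close>;
  \<open>x, z\<close>; \<open>y, s\<close>; \<open>z, t\<close>, with commutators \<open>t\<close>,
  \<open>s\<close>, \<open>w\<close>, \<open>w\<close>. What remains is \<open>z y = y z\<close> and
  \<open>s t = t s\<close>; the latter holds because \<open>s\<close> passes both letters
  \<open>y\<close> of \<open>t = x y x y\<close> and the two resulting factors \<open>w\<close>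
  cancel.\<close>

lemma G2_relations:
  assumes xyz: "x \<in> carrier G" "y \<in> carrier G" "z \<in> carrier G" and r: "G2_rels G x y z"
  defines "t \<equiv> commutator G x y"
  defines "s \<equiv> commutator G x z"
  defines "w \<equiv> commutator G y s"
  shows "t \<in> carrier G" "s \<in> carrier G" "w \<in> carrier G"
    "x \<otimes> x = \<one>" "y \<otimes> y = \<one>" "z \<otimes> z = \<one>" "t \<otimes> t = \<one>" "s \<otimes> s = \<one>" "w \<otimes> w = \<one>"
    "w \<otimes> x = x \<otimes> w" "w \<otimes> y = y \<otimes> w" "w \<otimes> z = z \<otimes> w" "w \<otimes> t = t \<otimes> w" "w \<otimes> s = s \<otimes> w"
    "y \<otimes> x = x \<otimes> (y \<otimes> t)" "z \<otimes> x = x \<otimes> (z \<otimes> s)" "t \<otimes> x = x \<otimes> t" "s \<otimes> x = x \<otimes> s"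
    "z \<otimes> y = y \<otimes> z" "t \<otimes> y = y \<otimes> t" "s \<otimes> y = y \<otimes> (s \<otimes> w)" "t \<otimes> z = z \<otimes> (t \<otimes> w)" "s \<otimes> z = z \<otimes> s"
    "s \<otimes> t = t \<otimes> s"
    "w = commutator G z t"
proof -
  show C: "t \<in> carrier G" "s \<in> carrier G" "w \<in> carrier G"
    unfolding t_def s_def w_def using xyz by simp_all
  have r': "x [^] (2::nat) = \<one>" "y [^] (2::nat) = \<one>" "z [^] (2::nat) = \<one>" "t [^] (2::nat) = \<one>"
    "s [^] (2::nat) = \<one>" "commutator G y z = \<one>" "w = commutator G z t" "w [^] (2::nat) = \<one>"
    "w \<otimes> x = x \<otimes> w" "w \<otimes> y = y \<otimes> w" "w \<otimes> z = z \<otimes> w"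
    using r unfolding G2_rels_def Let_def t_def s_def w_def by auto
  show wx: "w \<otimes> x = x \<otimes> w" and wy: "w \<otimes> y = y \<otimes> w" and "w \<otimes> z = z \<otimes> w" and wzt: "w = commutator G z t"
    by (rule r')+
  show x2: "x \<otimes> x = \<one>" and y2: "y \<otimes> y = \<one>" and z2: "z \<otimes> z = \<one>" and t2: "t \<otimes> t = \<one>"
    and s2: "s \<otimes> s = \<one>" and w2: "w \<otimes> w = \<one>"
    using r' xyz C by (simp_all add: numeral_eq_Suc)
  note A = dihedral_relations[OF xyz(1,2) x2 y2, folded t_def, OF t2]
  note B = dihedral_relations[OF xyz(1,3) x2 z2, folded s_def, OF s2]
  note Y = dihedral_relations[OF xyz(2) C(2) y2 s2, folded w_def, OF w2]
  note Z = dihedral_relations[OF xyz(3) C(1) z2 t2, folded wzt, OF w2]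
  show "y \<otimes> x = x \<otimes> (y \<otimes> t)" and tx: "t \<otimes> x = x \<otimes> t" and "t \<otimes> y = y \<otimes> t" by (rule A)+
  show "z \<otimes> x = x \<otimes> (z \<otimes> s)" and sx: "s \<otimes> x = x \<otimes> s" and "s \<otimes> z = z \<otimes> s" by (rule B)+
  show sy: "s \<otimes> y = y \<otimes> (s \<otimes> w)" and ws: "w \<otimes> s = s \<otimes> w" by (rule Y)+
  show "t \<otimes> z = z \<otimes> (t \<otimes> w)" and "w \<otimes> t = t \<otimes> w" by (rule Z)+
  have i: "inv x = x" "inv y = y" "inv z = z" using x2 y2 z2 xyz inv_equality by auto
  show "z \<otimes> y = y \<otimes> z"
  proof -
    have "inv (z \<otimes> y) \<otimes> (y \<otimes> z) = \<one>" using r'(6) xyz unfolding commutator_def by (simp add: inv_mult_group m_assoc)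
    then have "inv (y \<otimes> z) = inv (z \<otimes> y)" by (rule inv_equality) (use xyz in auto)
    then have "inv (inv (y \<otimes> z)) = inv (inv (z \<otimes> y))" by simp
    then show ?thesis using xyz by simp
  qed
  have tE: "t = x \<otimes> (y \<otimes> (x \<otimes> y))" unfolding t_def commutator_def i using xyz by (simp add: m_assoc)
  show "s \<otimes> t = t \<otimes> s"
    unfolding tE using rewr_assoc[OF sx] rewr_assoc[OF sy] rewr_assoc[OF wx] rewr_assoc[OF wy] sx sy wx wy w2 xyz C
    by (simp add: m_assoc)
qed

lemma nf2_mult:
  assumes xyz: "x \<in> carrier G" "y \<in> carrier G" "z \<in> carrier G" and r: "G2_rels G x y z"
  shows "nf2 x y z i j k l m n \<otimes> x = nf2 x y z (\<not> i) j k (l \<noteq> j) (m \<noteq> k) (n \<noteq> (j \<and> k))" (is ?A)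
    and "nf2 x y z i j k l m n \<otimes> y = nf2 x y z i (\<not> j) k l m (n \<noteq> m)" (is ?B)
    and "nf2 x y z i j k l m n \<otimes> z = nf2 x y z i j (\<not> k) l m (n \<noteq> l)" (is ?C)
proof -
  define t s w where "t = commutator G x y" and "s = commutator G x z" and "w = commutator G y s"
  note R = G2_relations[OF xyz r, folded t_def s_def, folded w_def]
  note C = R(1-3) and E = R(4-24)
  note E' = E[THEN rewr_assoc, OF _ _ _]
  have D: "nf2 x y z i j k l m n = opt i x \<otimes> (opt j y \<otimes> (opt k z \<otimes> (opt l t \<otimes> (opt m s \<otimes> opt n w))))" for i j k l m n
    unfolding nf2_def t_def[symmetric] s_def[symmetric] w_def[symmetric] ..
  show ?A unfolding D
    by (cases i; cases j; cases k; cases l; cases m; cases n) (simp_all add: m_assoc xyz C E E')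
  show ?B unfolding D
    by (cases i; cases j; cases k; cases l; cases m; cases n) (simp_all add: m_assoc xyz C E E')
  show ?C unfolding D
    by (cases i; cases j; cases k; cases l; cases m; cases n) (simp_all add: m_assoc xyz C E E')
qed

lemma G2_rels_inv:
  assumes "x \<in> carrier G" "y \<in> carrier G" "z \<in> carrier G" "G2_rels G x y z" "s \<in> {x, y, z}"
  shows "inv s = s" "s \<otimes> s = \<one>"
proof -
  note R = G2_relations[OF assms(1-4)]
  show "s \<otimes> s = \<one>" using assms(5) R(4-6) by auto
  then show "inv s = s" using assms inv_equality by auto
qed

lemma iso_G2I:
  assumes xyz: "x \<in> carrier G" "y \<in> carrier G" "z \<in> carrier G" and r: "G2_rels G x y z"
    and gen: "generate G {x, y, z} = carrier G"
    and inj: "\<And>i j k l m n i' j' k' l' m' n'. nf2 x y z i j k l m n = nf2 x y z i' j' k' l' m' n' \<Longrightarrow>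
      i = i' \<and> j = j' \<and> k = k' \<and> l = l' \<and> m = m' \<and> n = n'"
  shows "iso_G2 G"
proof -
  have "\<exists>h\<in>hom G H. h x = a \<and> h y = b \<and> h z = c"
    if H: "group H" "a \<in> carrier H" "b \<in> carrier H" "c \<in> carrier H" "G2_rels H a b c" for H :: "nat monoid" and a b c
  proof -
    interpret H: group H by (rule H)
    let ?g = "\<lambda>i j k. nf2 x y z i j k False False False"
    have "?g True False False = x" "?g False True False = y" "?g False False True = z"
      unfolding nf2_def using xyz by simp_all
    then have ne: "x \<noteq> y" "x \<noteq> z" "y \<noteq> z" using inj by metis+
    define f where "f = (\<lambda>s. if s = x then a else if s = y then b else c)"
    define R where "R = {(nf2 x y z i j k l m n, H.nf2 a b c i j k l m n) | i j k l m n. True}"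
    have inR: "(nf2 x y z i j k l m n, H.nf2 a b c i j k l m n) \<in> R" for i j k l m n unfolding R_def by blast
    have "\<exists>h\<in>hom G H. \<forall>s\<in>{x, y, z}. h s = f s"
    proof (rule ex_hom_of_relation[OF H(1) _ gen, where R = R])
      show "{x, y, z} \<subseteq> carrier G" using xyz by simp
      show "\<And>s. s \<in> {x, y, z} \<Longrightarrow> f s \<in> carrier H" using H f_def by simp
      show "R \<subseteq> carrier G \<times> carrier H" unfolding R_def using nf2_closed[OF xyz] H.nf2_closed[OF H(2-4)] by auto
      show "(\<one>, \<one>\<^bsub>H\<^esub>) \<in> R" using inR[of False False False False False False] by (simp add: nf2_def H.nf2_def)
      show "(g \<otimes> s, h \<otimes>\<^bsub>H\<^esub> f s) \<in> R" if gh: "(g, h) \<in> R" and s: "s \<in> {x, y, z}" for g h s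
      proof -
        obtain i j k l m n where g: "g = nf2 x y z i j k l m n" and h: "h = H.nf2 a b c i j k l m n"
          using gh unfolding R_def by blast
        show ?thesis unfolding g h using s ne inR
          by (auto simp: f_def nf2_mult[OF xyz r] H.nf2_mult[OF H(2-5)])
      qed
      show "h = h'" if gh: "(g, h) \<in> R" and gh': "(g, h') \<in> R" for g h h'
      proof -
        obtain i j k l m n where 1: "g = nf2 x y z i j k l m n" "h = H.nf2 a b c i j k l m n"
          using gh unfolding R_def by blast
        obtain i' j' k' l' m' n' where 2: "g = nf2 x y z i' j' k' l' m' n'" "h' = H.nf2 a b c i' j' k' l' m' n'"
          using gh' unfolding R_def by blast
        show ?thesis using inj[of i j k l m n i' j' k' l' m' n'] 1 2 by simp
      qed
      show "inv s = s \<otimes> s \<otimes> s" if "s \<in> {x, y, z}" for s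
        using G2_rels_inv[OF xyz r that] that xyz by auto
      show "inv\<^bsub>H\<^esub> (f s) = f s \<otimes>\<^bsub>H\<^esub> f s \<otimes>\<^bsub>H\<^esub> f s" if "s \<in> {x, y, z}" for s
        using H.G2_rels_inv[OF H(2-5), of "f s"] H(2-4) by (auto simp: f_def)
    qed
    then show ?thesis using ne by (auto simp: f_def)
  qed
  then show ?thesis unfolding iso_G2_def using group_axioms xyz r gen by blast
qed

end

subsection \<open>Homomorphic images of the presented groups\<close>

lemma (in group_hom) hom_commutator:
  "x \<in> carrier G \<Longrightarrow> y \<in> carrier G \<Longrightarrow> h (commutator G x y) = commutator H (h x) (h y)"
  by (simp add: commutator_def)

lemma (in group_hom) G1_rels_image:
  assumes "x \<in> carrier G" "y \<in> carrier G" "G1_rels G x y"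
  shows "G1_rels H (h x) (h y)"
proof -
  have pow: "h z [^]\<^bsub>H\<^esub> n = h (z [^]\<^bsub>G\<^esub> n)" if "z \<in> carrier G" for z and n :: nat
    using that hom_nat_pow by simp
  show ?thesis
    using assms unfolding G1_rels_def Let_def
    by (simp add: hom_commutator[symmetric] G.commutator_closed pow hom_mult[symmetric] del: hom_mult)
qed

lemma (in group_hom) G2_rels_image:
  assumes "x \<in> carrier G" "y \<in> carrier G" "z \<in> carrier G" "G2_rels G x y z"
  shows "G2_rels H (h x) (h y) (h z)"
proof -
  have pow: "h z [^]\<^bsub>H\<^esub> n = h (z [^]\<^bsub>G\<^esub> n)" if "z \<in> carrier G" for z and n :: nat
    using that hom_nat_pow by simp
  define w where "w = commutator G y (commutator G x z)"
  have w: "w = commutator G z (commutator G x y)" "w \<in> carrier G"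
    using assms unfolding w_def G2_rels_def Let_def by (simp_all add: G.commutator_closed)
  have hw: "commutator H (h y) (commutator H (h x) (h z)) = h w"
    "commutator H (h z) (commutator H (h x) (h y)) = h w"
    using assms(1-3) unfolding w_def by (simp add: hom_commutator G.commutator_closed)
      (use assms(1-3) in \<open>simp add: w(1)[unfolded w_def] hom_commutator[symmetric] G.commutator_closed\<close>)
  have r: "w [^]\<^bsub>G\<^esub> (2::nat) = \<one>\<^bsub>G\<^esub>" "w \<otimes>\<^bsub>G\<^esub> x = x \<otimes>\<^bsub>G\<^esub> w" "w \<otimes>\<^bsub>G\<^esub> y = y \<otimes>\<^bsub>G\<^esub> w" "w \<otimes>\<^bsub>G\<^esub> z = z \<otimes>\<^bsub>G\<^esub> w"
    using assms(4) unfolding w_def G2_rels_def Let_def by blast+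
  show ?thesis
    using assms unfolding G2_rels_def Let_def hw
    by (simp add: hom_commutator[symmetric] G.commutator_closed pow hom_mult[symmetric] w(2) r del: hom_mult)
qed

text \<open>The universal properties quantify over groups carried by naturals; \<open>D8\<close>
  lives on pairs and enters through a coded copy.\<close>

definition nat_copy :: "'a::countable monoid \<Rightarrow> nat monoid" where
  "nat_copy H = \<lparr>carrier = to_nat ` carrier H,
     monoid.mult = (\<lambda>m n. to_nat (from_nat m \<otimes>\<^bsub>H\<^esub> from_nat n)), one = to_nat (\<one>\<^bsub>H\<^esub>)\<rparr>"

lemma nat_copy_simps:
  "carrier (nat_copy H) = to_nat ` carrier H"
  "m \<otimes>\<^bsub>nat_copy H\<^esub> n = to_nat (from_nat m \<otimes>\<^bsub>H\<^esub> from_nat n)"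
  "\<one>\<^bsub>nat_copy H\<^esub> = to_nat (\<one>\<^bsub>H\<^esub>)"
  by (simp_all add: nat_copy_def)

lemma group_nat_copy:
  assumes "group H"
  shows "group (nat_copy H)"
proof -
  interpret group H by (rule assms)
  show ?thesis
  proof (rule groupI)
    show "\<exists>y\<in>carrier (nat_copy H). y \<otimes>\<^bsub>nat_copy H\<^esub> x = \<one>\<^bsub>nat_copy H\<^esub>" if x: "x \<in> carrier (nat_copy H)" for x
    proof -
      obtain z where z: "z \<in> carrier H" "x = to_nat z" using x by (auto simp: nat_copy_simps)
      then show ?thesis by (intro bexI[of _ "to_nat (inv\<^bsub>H\<^esub> z)"]) (simp_all add: nat_copy_simps)
    qed
  qed (auto simp: nat_copy_simps m_assoc)
qed

lemma to_nat_group_hom: "group H \<Longrightarrow> group_hom H (nat_copy H) to_nat"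
  by (intro group_hom.intro group_nat_copy group_hom_axioms.intro)
    (auto simp: hom_def nat_copy_simps)

lemma from_nat_hom: "from_nat \<in> hom (nat_copy H) H" if "group H"
proof -
  interpret group H by (rule that)
  show ?thesis by (auto simp: hom_def nat_copy_simps)
qed

subsection \<open>The dihedral group and its central square\<close>

lemma D8_carrier: "carrier D8 = {0, 1, 2, 3} \<times> UNIV"
  unfolding D8_def by auto

lemma D8_carrierE:
  assumes "p \<in> carrier D8"
  obtains "p = (0, False)" | "p = (1, False)" | "p = (2, False)" | "p = (3, False)"
    | "p = (0, True)" | "p = (1, True)" | "p = (2, True)" | "p = (3, True)"
proof -
  obtain k b where p: "p = (k, b)" by (cases p)
  then have "k = 0 \<or> k = 1 \<or> k = 2 \<or> k = 3" using assms unfolding D8_carrier by simp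
  then show ?thesis using that p by (cases b) (elim disjE; simp)+
qed

lemma D8_mult: "(k1, b1) \<otimes>\<^bsub>D8\<^esub> (k2, b2) = ((if b1 then k1 + 4 - k2 else k1 + k2) mod 4, b1 \<noteq> b2)"
  unfolding D8_def by simp

lemma D8_one: "\<one>\<^bsub>D8\<^esub> = (0, False)"
  unfolding D8_def by simp

lemma D8_in: "k < 4 \<Longrightarrow> (k, b) \<in> carrier D8"
  unfolding D8_def by simp

lemma group_D8: "group D8"
proof (rule groupI)
  show "x \<otimes>\<^bsub>D8\<^esub> y \<in> carrier D8" if "x \<in> carrier D8" "y \<in> carrier D8" for x y
    using that unfolding D8_def by auto
  show "\<one>\<^bsub>D8\<^esub> \<in> carrier D8" by (simp add: D8_one D8_in)
  show "x \<otimes>\<^bsub>D8\<^esub> y \<otimes>\<^bsub>D8\<^esub> z = x \<otimes>\<^bsub>D8\<^esub> (y \<otimes>\<^bsub>D8\<^esub> z)"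
    if "x \<in> carrier D8" "y \<in> carrier D8" "z \<in> carrier D8" for x y z
    by (rule D8_carrierE[OF that(1)]; rule D8_carrierE[OF that(2)]; rule D8_carrierE[OF that(3)];
        simp add: D8_mult)
  show "\<one>\<^bsub>D8\<^esub> \<otimes>\<^bsub>D8\<^esub> x = x" if "x \<in> carrier D8" for x
    by (rule D8_carrierE[OF that]; simp add: D8_mult D8_one)
  show "\<exists>y\<in>carrier D8. y \<otimes>\<^bsub>D8\<^esub> x = \<one>\<^bsub>D8\<^esub>" if "x \<in> carrier D8" for x
    by (rule D8_carrierE[OF that]; rule bexI[of _ "(if snd x then fst x else (4 - fst x) mod 4, snd x)"];
        simp add: D8_mult D8_one D8_in)
qed

lemma D8_inv: "k < 4 \<Longrightarrow> inv\<^bsub>D8\<^esub> (k, b) = (if b then k else (4 - k) mod 4, b)"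
proof (rule group.inv_equality[OF group_D8])
  assume k: "k < 4"
  then have "k = 0 \<or> k = 1 \<or> k = 2 \<or> k = 3" by auto
  then show "(if b then k else (4 - k) mod 4, b) \<otimes>\<^bsub>D8\<^esub> (k, b) = \<one>\<^bsub>D8\<^esub>"
    by (auto simp: D8_mult D8_one)
qed (simp_all add: D8_in)

lemma (in monoid) nat_pow_2_4:
  assumes "x \<in> carrier G"
  shows "x [^] (2::nat) = x \<otimes> x" "x [^] (4::nat) = x \<otimes> x \<otimes> (x \<otimes> x)"
  using assms by (simp_all add: numeral_eq_Suc m_assoc)

lemma D8_pow:
  "k < 4 \<Longrightarrow> (k, b) [^]\<^bsub>D8\<^esub> (2::nat) = (k, b) \<otimes>\<^bsub>D8\<^esub> (k, b)"
  "k < 4 \<Longrightarrow> (k, b) [^]\<^bsub>D8\<^esub> (4::nat) = (k, b) \<otimes>\<^bsub>D8\<^esub> (k, b) \<otimes>\<^bsub>D8\<^esub> ((k, b) \<otimes>\<^bsub>D8\<^esub> (k, b))"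
  using monoid.nat_pow_2_4[OF group.is_monoid[OF group_D8] D8_in] by simp_all

lemma D8_commutator:
  "p \<in> carrier D8 \<Longrightarrow> q \<in> carrier D8 \<Longrightarrow> commutator D8 p q \<in> {(0, False), (2, False)}"
  by (erule D8_carrierE; erule D8_carrierE; simp add: commutator_def D8_inv D8_mult)

lemma D8_central:
  assumes "p \<in> carrier D8" "p \<otimes>\<^bsub>D8\<^esub> (1, False) = (1, False) \<otimes>\<^bsub>D8\<^esub> p"
    "p \<otimes>\<^bsub>D8\<^esub> (0, True) = (0, True) \<otimes>\<^bsub>D8\<^esub> p"
  shows "p \<in> {(0, False), (2, False)}"
  using assms by (elim D8_carrierE) (simp_all add: D8_mult)

text \<open>\<open>x\<close> and \<open>y\<close> go to the reflections r s and s. Their commutator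
  is the central r^2, so \<open>[[x, y], x]\<close> dies and all relations hold.\<close>

lemma ex_hom_D8_of_G1:
  assumes "iso_G1 G"
  obtains x y \<pi> where "x \<in> carrier G" "y \<in> carrier G" "G1_rels G x y" "generate G {x, y} = carrier G"
    "\<pi> \<in> hom G D8" "\<pi> x = (1, True)" "\<pi> y = (0, True)"
proof -
  obtain x y where xy: "x \<in> carrier G" "y \<in> carrier G" "G1_rels G x y" "generate G {x, y} = carrier G"
    and univ: "\<And>(H :: nat monoid) a b. group H \<Longrightarrow> a \<in> carrier H \<Longrightarrow> b \<in> carrier H \<Longrightarrow> G1_rels H a b \<Longrightarrow>
        \<exists>h \<in> hom G H. h x = a \<and> h y = b"
    using assms unfolding iso_G1_def by blast
  interpret h: group_hom D8 "nat_copy D8" to_nat by (rule to_nat_group_hom[OF group_D8])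
  let ?a = "(1 :: nat, True)" and ?b = "(0 :: nat, True)"
  have ab: "?a \<in> carrier D8" "?b \<in> carrier D8" by (simp_all add: D8_in)
  have "G1_rels D8 ?a ?b"
    by (simp add: G1_rels_def Let_def commutator_def D8_inv D8_mult D8_pow D8_one)
  then have "G1_rels (nat_copy D8) (to_nat ?a) (to_nat ?b)" by (rule h.G1_rels_image[OF ab])
  then obtain f where f: "f \<in> hom G (nat_copy D8)" "f x = to_nat ?a" "f y = to_nat ?b"
    using univ[OF h.H.group_axioms h.hom_closed[OF ab(1)] h.hom_closed[OF ab(2)]] by blast
  have "from_nat \<circ> f \<in> hom G D8" using hom_compose[OF f(1) from_nat_hom[OF group_D8]] by simp
  then show ?thesis using that[OF xy] f by simp
qed

text \<open>Killing \<open>z\<close> or killing \<open>y\<close> leaves a dihedral quotient. Both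
  are provided because the norm obtained from a single one might lie in -aF^2.\<close>

lemma ex_hom_D8_of_G2:
  assumes "iso_G2 G"
  obtains x y z \<pi> \<rho> where "x \<in> carrier G" "y \<in> carrier G" "z \<in> carrier G" "G2_rels G x y z"
    "generate G {x, y, z} = carrier G"
    "\<pi> \<in> hom G D8" "\<pi> x = (1, True)" "\<pi> y = (0, True)" "\<pi> z = (0, False)"
    "\<rho> \<in> hom G D8" "\<rho> x = (1, True)" "\<rho> y = (0, False)" "\<rho> z = (0, True)"
proof -
  from assms have "\<exists>x\<in>carrier G. \<exists>y\<in>carrier G. \<exists>z\<in>carrier G. G2_rels G x y z \<and>
     generate G {x, y, z} = carrier G \<and>
     (\<forall>(H :: nat monoid) a b c. group H \<and> a \<in> carrier H \<and> b \<in> carrier H \<and> c \<in> carrier H \<and>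
        G2_rels H a b c \<longrightarrow> (\<exists>h \<in> hom G H. h x = a \<and> h y = b \<and> h z = c))"
    unfolding iso_G2_def by (rule conjunct2)
  then obtain x y z where xyz': "x \<in> carrier G" "y \<in> carrier G" "z \<in> carrier G"
    and U: "G2_rels G x y z \<and> generate G {x, y, z} = carrier G \<and>
     (\<forall>(H :: nat monoid) a b c. group H \<and> a \<in> carrier H \<and> b \<in> carrier H \<and> c \<in> carrier H \<and>
        G2_rels H a b c \<longrightarrow> (\<exists>h \<in> hom G H. h x = a \<and> h y = b \<and> h z = c))"
    by (elim bexE)
  note xyz = xyz' conjunct1[OF U] conjunct1[OF conjunct2[OF U]]
  have univ: "\<exists>h \<in> hom G H. h x = a \<and> h y = b \<and> h z = c"
    if "group H" "a \<in> carrier H" "b \<in> carrier H" "c \<in> carrier H" "G2_rels H a b c" for H :: "nat monoid" and a b c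
    by (rule conjunct2[OF conjunct2[OF U], rule_format]) (use that in simp)
  interpret h: group_hom D8 "nat_copy D8" to_nat by (rule to_nat_group_hom[OF group_D8])
  have ex: "\<exists>\<pi>\<in>hom G D8. \<pi> x = a \<and> \<pi> y = b \<and> \<pi> z = c"
    if abc: "a \<in> carrier D8" "b \<in> carrier D8" "c \<in> carrier D8" and r: "G2_rels D8 a b c" for a b c
  proof -
    have "G2_rels (nat_copy D8) (to_nat a) (to_nat b) (to_nat c)" by (rule h.G2_rels_image[OF abc r])
    then obtain f where f: "f \<in> hom G (nat_copy D8)" "f x = to_nat a" "f y = to_nat b" "f z = to_nat c"
      using univ[OF h.H.group_axioms h.hom_closed[OF abc(1)] h.hom_closed[OF abc(2)] h.hom_closed[OF abc(3)]] by blast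
    have "from_nat \<circ> f \<in> hom G D8" using hom_compose[OF f(1) from_nat_hom[OF group_D8]] by simp
    then show ?thesis using f by (intro bexI[of _ "from_nat \<circ> f"]) simp_all
  qed
  have "G2_rels D8 (1, True) (0, True) (0, False)" "G2_rels D8 (1, True) (0, False) (0, True)"
    by (simp_all add: G2_rels_def Let_def commutator_def D8_inv D8_mult D8_pow D8_one)
  then obtain \<pi> \<rho> where "\<pi> \<in> hom G D8" "\<pi> x = (1, True)" "\<pi> y = (0, True)" "\<pi> z = (0, False)"
    "\<rho> \<in> hom G D8" "\<rho> x = (1, True)" "\<rho> y = (0, False)" "\<rho> z = (0, True)"
    using ex[of "(1, True)" "(0, True)" "(0, False)"] ex[of "(1, True)" "(0, False)" "(0, True)"]
    by (auto simp: D8_in)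
  then show ?thesis by (rule that[OF xyz])
qed

abbreviation DD_kernel :: "((nat \<times> bool) \<times> (nat \<times> bool)) set" where
  "DD_kernel \<equiv> {((0, False), (0, False)), ((2, False), (2, False))}"

lemma DD_kernel_normal: "DD_kernel \<lhd> D8 \<times>\<times> D8"
proof -
  interpret P: group "D8 \<times>\<times> D8" by (rule DirProd_group[OF group_D8 group_D8])
  have sub: "subgroup DD_kernel (D8 \<times>\<times> D8)"
  proof (rule P.subgroupI)
    show "DD_kernel \<subseteq> carrier (D8 \<times>\<times> D8)" by (auto simp: D8_in)
    show "inv\<^bsub>D8 \<times>\<times> D8\<^esub> p \<in> DD_kernel" if "p \<in> DD_kernel" for p
      using that by (auto simp: inv_DirProd[OF group_D8 group_D8] D8_in D8_inv)
  qed (auto simp: D8_mult)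
  have comm: "p \<otimes>\<^bsub>D8 \<times>\<times> D8\<^esub> k = k \<otimes>\<^bsub>D8 \<times>\<times> D8\<^esub> p" if p: "p \<in> carrier (D8 \<times>\<times> D8)" and k: "k \<in> DD_kernel" for p k
  proof -
    have "q \<otimes>\<^bsub>D8\<^esub> c = c \<otimes>\<^bsub>D8\<^esub> q" if "q \<in> carrier D8" "c \<in> {(0, False), (2, False)}" for q c
      using that by (elim D8_carrierE) (auto simp: D8_mult)
    note c = this
    obtain p1 p2 where "p = (p1, p2)" "p1 \<in> carrier D8" "p2 \<in> carrier D8" using p by (cases p) auto
    then show ?thesis using k c[of p1 "(0, False)"] c[of p1 "(2, False)"] c[of p2 "(0, False)"] c[of p2 "(2, False)"] by auto
  qed
  have "p \<otimes>\<^bsub>D8 \<times>\<times> D8\<^esub> k \<otimes>\<^bsub>D8 \<times>\<times> D8\<^esub> inv\<^bsub>D8 \<times>\<times> D8\<^esub> p \<in> DD_kernel"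
    if p: "p \<in> carrier (D8 \<times>\<times> D8)" and k: "k \<in> DD_kernel" for p k
  proof -
    have "k \<in> carrier (D8 \<times>\<times> D8)" using k by (auto simp: D8_in)
    then have "p \<otimes>\<^bsub>D8 \<times>\<times> D8\<^esub> k \<otimes>\<^bsub>D8 \<times>\<times> D8\<^esub> inv\<^bsub>D8 \<times>\<times> D8\<^esub> p = k"
      unfolding comm[OF p k] using p by (simp only: P.m_assoc P.inv_closed P.r_inv P.r_one)
    then show ?thesis using k by simp
  qed
  then show ?thesis using sub P.normal_inv_iff by blast
qed

text \<open>Replaces \<open>DD\<close> by a surjection from the direct product with known kernel, so
  that later arguments use representatives instead of cosets.\<close>

lemma iso_DD_obtains_hom:
  assumes M: "group M" and iso: "M \<cong> DD"
  obtains \<theta> where "\<theta> \<in> hom (D8 \<times>\<times> D8) M" "\<theta> ` carrier (D8 \<times>\<times> D8) = carrier M"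
    "\<And>p. p \<in> carrier (D8 \<times>\<times> D8) \<Longrightarrow> \<theta> p = \<one>\<^bsub>M\<^esub> \<Longrightarrow> p \<in> DD_kernel" "\<theta> ((2, False), (2, False)) = \<one>\<^bsub>M\<^esub>"
proof -
  interpret M: group M by (rule M)
  interpret N: normal DD_kernel "D8 \<times>\<times> D8" by (rule DD_kernel_normal)
  have DD: "group DD" unfolding DD_def by (rule N.factorgroup_is_group)
  interpret D: group DD by (rule DD)
  have "DD \<cong> M" using M.iso_sym[OF iso] .
  then obtain \<psi> where psi: "\<psi> \<in> iso DD M" unfolding is_iso_def by blast
  then have psi_hom: "\<psi> \<in> hom DD M" and bij: "bij_betw \<psi> (carrier DD) (carrier M)" unfolding iso_def by auto
  interpret \<psi>: group_hom DD M \<psi> by (intro group_hom.intro DD M group_hom_axioms.intro psi_hom)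
  define q where "q = (\<lambda>p. DD_kernel #>\<^bsub>D8 \<times>\<times> D8\<^esub> p)"
  have q_hom: "q \<in> hom (D8 \<times>\<times> D8) DD" unfolding q_def DD_def by (rule N.r_coset_hom_Mod)
  have q_surj: "q ` carrier (D8 \<times>\<times> D8) = carrier DD"
    unfolding q_def DD_def FactGroup_def RCOSETS_def by auto
  have q_one: "\<one>\<^bsub>DD\<^esub> = DD_kernel" unfolding DD_def FactGroup_def by simp
  have qC: "q p \<in> carrier DD" if "p \<in> carrier (D8 \<times>\<times> D8)" for p using that q_surj by blast
  show ?thesis
  proof
    show "\<psi> \<circ> q \<in> hom (D8 \<times>\<times> D8) M" using hom_compose[OF q_hom psi_hom] by simp
    show "(\<psi> \<circ> q) ` carrier (D8 \<times>\<times> D8) = carrier M"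
      using q_surj bij by (simp only: image_comp[symmetric] bij_betw_def)
    show "p \<in> DD_kernel" if p: "p \<in> carrier (D8 \<times>\<times> D8)" "(\<psi> \<circ> q) p = \<one>\<^bsub>M\<^esub>" for p
    proof -
      have "\<psi> (q p) = \<psi> \<one>\<^bsub>DD\<^esub>" using p by simp
      then have "q p = \<one>\<^bsub>DD\<^esub>" using bij qC[OF p(1)] D.one_closed unfolding bij_betw_def inj_on_def by blast
      then have "DD_kernel #>\<^bsub>D8 \<times>\<times> D8\<^esub> p = DD_kernel" unfolding q_one by (simp add: q_def)
      then show ?thesis using N.coset_join1[OF _ p(1) N.subgroup_axioms] by blast
    qed
    have "((2, False), (2, False)) \<in> carrier (D8 \<times>\<times> D8)" by (simp add: D8_in)
    then have "q ((2, False), (2, False)) = \<one>\<^bsub>DD\<^esub>"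
      unfolding q_one q_def by (rule N.coset_join2[OF _ N.subgroup_axioms]) simp
    then show "(\<psi> \<circ> q) ((2, False), (2, False)) = \<one>\<^bsub>M\<^esub>" by simp
  qed
qed

lemma iso_DD_of_hom:
  assumes M: "group M" and "\<theta> \<in> hom (D8 \<times>\<times> D8) M" "carrier M \<subseteq> \<theta> ` carrier (D8 \<times>\<times> D8)"
    "\<And>p. p \<in> carrier (D8 \<times>\<times> D8) \<Longrightarrow> \<theta> p = \<one>\<^bsub>M\<^esub> \<longleftrightarrow> p \<in> DD_kernel"
  shows "M \<cong> DD"
proof -
  interpret h: group_hom "D8 \<times>\<times> D8" M \<theta>
    by (intro group_hom.intro DirProd_group group_D8 M group_hom_axioms.intro assms(2))
  have "\<theta> ` carrier (D8 \<times>\<times> D8) = carrier M" using assms(3) h.hom_closed by blast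
  moreover have "kernel (D8 \<times>\<times> D8) M \<theta> = DD_kernel"
    unfolding kernel_def using assms(4) by (auto simp: D8_in)
  ultimately have "DD \<cong> M" unfolding DD_def using h.FactGroup_iso by simp
  moreover have "group DD" unfolding DD_def by (rule normal.factorgroup_is_group[OF DD_kernel_normal])
  ultimately show ?thesis using group.iso_sym by blast
qed

text \<open>\<open>DD\<close> is extraspecial: its commutators and its centre lie in one and the
  same \<open>{1, c}\<close>, where \<open>c\<close> is the common image of (r^2, 1) and (1, r^2).
  This and finiteness are the facts about \<open>DD\<close> that the converse uses.\<close>

lemma DD_commutators_centre:
  assumes M: "group M" and iso: "M \<cong> DD"
  obtains c where "\<And>g h. g \<in> carrier M \<Longrightarrow> h \<in> carrier M \<Longrightarrow> commutator M g h \<in> {\<one>\<^bsub>M\<^esub>, c}"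
    "\<And>g. g \<in> carrier M \<Longrightarrow> (\<And>h. h \<in> carrier M \<Longrightarrow> g \<otimes>\<^bsub>M\<^esub> h = h \<otimes>\<^bsub>M\<^esub> g) \<Longrightarrow> g \<in> {\<one>\<^bsub>M\<^esub>, c}"
    "finite (carrier M)"
proof -
  interpret D: group D8 by (rule group_D8)
  obtain \<theta> where th: "\<theta> \<in> hom (D8 \<times>\<times> D8) M" "\<theta> ` carrier (D8 \<times>\<times> D8) = carrier M"
    and ker: "\<And>p. p \<in> carrier (D8 \<times>\<times> D8) \<Longrightarrow> \<theta> p = \<one>\<^bsub>M\<^esub> \<Longrightarrow> p \<in> DD_kernel"
    and th2: "\<theta> ((2, False), (2, False)) = \<one>\<^bsub>M\<^esub>"
    using iso_DD_obtains_hom[OF M iso] by blast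
  interpret h: group_hom "D8 \<times>\<times> D8" M \<theta>
    by (intro group_hom.intro DirProd_group group_D8 M group_hom_axioms.intro th(1))
  define c where "c = \<theta> ((2, False), (0, False))"
  have 0: "\<theta> ((0, False), (0, False)) = \<one>\<^bsub>M\<^esub>" using h.hom_one by (simp add: D8_one one_DirProd)
  have "\<theta> ((0, False), (2, False)) = \<theta> ((2, False), (0, False)) \<otimes>\<^bsub>M\<^esub> \<theta> ((2, False), (2, False))"
    by (subst h.hom_mult[symmetric]) (simp_all add: D8_in D8_mult numeral_2_eq_2)
  then have c': "\<theta> ((0, False), (2, False)) = c" unfolding th2 c_def by (simp add: D8_in)
  have four: "\<theta> p \<in> {\<one>\<^bsub>M\<^esub>, c}" if "p \<in> {(0, False), (2, False)} \<times> {(0, False), (2, False)}" for p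
    using that 0 c' th2 c_def by auto
  show ?thesis
  proof
    fix g assume "g \<in> carrier M"
    then obtain p1 p2 where p: "g = \<theta> (p1, p2)" "p1 \<in> carrier D8" "p2 \<in> carrier D8" using th(2) by force
    show "commutator M g h \<in> {\<one>\<^bsub>M\<^esub>, c}" if "h \<in> carrier M" for h
    proof -
      obtain q1 q2 where q: "h = \<theta> (q1, q2)" "q1 \<in> carrier D8" "q2 \<in> carrier D8" using \<open>h \<in> carrier M\<close> th(2) by force
      have "commutator M g h = \<theta> (commutator (D8 \<times>\<times> D8) (p1, p2) (q1, q2))"
        unfolding p q using p q by (simp add: h.hom_commutator)
      also have "commutator (D8 \<times>\<times> D8) (p1, p2) (q1, q2) = (commutator D8 p1 q1, commutator D8 p2 q2)"
        unfolding commutator_def using p q by (simp add: inv_DirProd[OF group_D8 group_D8])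
      finally show ?thesis using four[of "(commutator D8 p1 q1, commutator D8 p2 q2)"]
          D8_commutator[OF p(2) q(2)] D8_commutator[OF p(3) q(3)] by (simp only: mem_Times_iff fst_conv snd_conv simp_thms)
    qed
    assume cent: "\<And>h. h \<in> carrier M \<Longrightarrow> g \<otimes>\<^bsub>M\<^esub> h = h \<otimes>\<^bsub>M\<^esub> g"
    have key: "P \<otimes>\<^bsub>D8 \<times>\<times> D8\<^esub> Q \<otimes>\<^bsub>D8 \<times>\<times> D8\<^esub> inv\<^bsub>D8 \<times>\<times> D8\<^esub> (Q \<otimes>\<^bsub>D8 \<times>\<times> D8\<^esub> P) \<in> DD_kernel"
      if "P = (p1, p2)" "Q \<in> carrier (D8 \<times>\<times> D8)" for P Q
    proof (rule ker)
      have P: "P \<in> carrier (D8 \<times>\<times> D8)" using that p by simp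
      show "P \<otimes>\<^bsub>D8 \<times>\<times> D8\<^esub> Q \<otimes>\<^bsub>D8 \<times>\<times> D8\<^esub> inv\<^bsub>D8 \<times>\<times> D8\<^esub> (Q \<otimes>\<^bsub>D8 \<times>\<times> D8\<^esub> P) \<in> carrier (D8 \<times>\<times> D8)"
        using P that by (simp only: h.G.m_closed h.G.inv_closed)
      have "\<theta> P \<otimes>\<^bsub>M\<^esub> \<theta> Q = \<theta> Q \<otimes>\<^bsub>M\<^esub> \<theta> P" using cent[OF h.hom_closed[OF that(2)]] that p by simp
      then show "\<theta> (P \<otimes>\<^bsub>D8 \<times>\<times> D8\<^esub> Q \<otimes>\<^bsub>D8 \<times>\<times> D8\<^esub> inv\<^bsub>D8 \<times>\<times> D8\<^esub> (Q \<otimes>\<^bsub>D8 \<times>\<times> D8\<^esub> P)) = \<one>\<^bsub>M\<^esub>"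
        using P that(2) by (simp only: h.hom_mult h.hom_inv h.G.m_closed h.G.inv_closed h.hom_closed h.H.m_closed h.H.r_inv)
    qed
    \<comment> \<open>\<open>DD_kernel\<close> meets each factor trivially, so commuting with
      \<open>(q, 1)\<close> modulo the kernel is the same as commuting with
      \<open>q\<close>.\<close>
    have c1: "p1 \<otimes>\<^bsub>D8\<^esub> q = q \<otimes>\<^bsub>D8\<^esub> p1" if "q \<in> carrier D8" for q
    proof -
      have "(p1 \<otimes>\<^bsub>D8\<^esub> q \<otimes>\<^bsub>D8\<^esub> inv\<^bsub>D8\<^esub> (q \<otimes>\<^bsub>D8\<^esub> p1), \<one>\<^bsub>D8\<^esub>) \<in> DD_kernel"
        using key[OF refl, of "(q, \<one>\<^bsub>D8\<^esub>)"] that p by (simp add: inv_DirProd[OF group_D8 group_D8])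
      then have "p1 \<otimes>\<^bsub>D8\<^esub> q \<otimes>\<^bsub>D8\<^esub> inv\<^bsub>D8\<^esub> (q \<otimes>\<^bsub>D8\<^esub> p1) = \<one>\<^bsub>D8\<^esub>" by (auto simp: D8_one)
      then show ?thesis using that p by (metis D.inv_closed D.inv_equality D.inv_inv D.m_closed)
    qed
    have c2: "p2 \<otimes>\<^bsub>D8\<^esub> q = q \<otimes>\<^bsub>D8\<^esub> p2" if "q \<in> carrier D8" for q
    proof -
      have "(\<one>\<^bsub>D8\<^esub>, p2 \<otimes>\<^bsub>D8\<^esub> q \<otimes>\<^bsub>D8\<^esub> inv\<^bsub>D8\<^esub> (q \<otimes>\<^bsub>D8\<^esub> p2)) \<in> DD_kernel"
        using key[OF refl, of "(\<one>\<^bsub>D8\<^esub>, q)"] that p by (simp add: inv_DirProd[OF group_D8 group_D8])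
      then have "p2 \<otimes>\<^bsub>D8\<^esub> q \<otimes>\<^bsub>D8\<^esub> inv\<^bsub>D8\<^esub> (q \<otimes>\<^bsub>D8\<^esub> p2) = \<one>\<^bsub>D8\<^esub>" by (auto simp: D8_one)
      then show ?thesis using that p by (metis D.inv_closed D.inv_equality D.inv_inv D.m_closed)
    qed
    have "p1 \<in> {(0, False), (2, False)}" "p2 \<in> {(0, False), (2, False)}"
      using D8_central[OF p(2) c1 c1] D8_central[OF p(3) c2 c2] by (auto simp: D8_in)
    then show "g \<in> {\<one>\<^bsub>M\<^esub>, c}" unfolding p(1) by (intro four) blast
  next
    show "finite (carrier M)" unfolding th(2)[symmetric] by (simp add: D8_carrier)
  qed
qed

section \<open>From Galois groups to norms\<close>

lemma adjoin_sqrt_eq: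
  assumes "g * g = a"
  shows "adjoin_sqrt F a = adjoin F {g}"
proof -
  have "{x. x * x = a} = {g, - g}" using assms by (auto simp: square_eq_iff)
  moreover have "adjoin F {g, - g} = adjoin F {g}"
    by (intro antisym adjoin_least is_subfield_adjoin)
      (use adjoin_superset[where F = F and S = "{g}"] adjoin_superset[where F = F and S = "{g, - g}"]
        is_subfieldD(5)[OF is_subfield_adjoin[of F "{g}"]] in auto)
  ultimately show ?thesis unfolding adjoin_sqrt_def by simp
qed

section \<open>A Galois extension with a marked quadratic subfield F(g)\<close>

locale sqrt_ext =
  fixes F L :: "'k::field set" and g :: 'k
  assumes ac: "is_algebraic_closure_of F" and gal: "galois_ext F L" and two: "(2::'k) \<noteq> 0"
    and gL: "g \<in> L" and gF: "g \<notin> F" and g2: "g * g \<in> F"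
begin

lemma sfF: "is_subfield F" and sfL: "is_subfield L" and FL: "F \<subseteq> L"
  using gal unfolding galois_ext_def by auto

lemma g0: "g \<noteq> 0"
  using gF is_subfieldD(1)[OF sfF] by auto

lemma twoF: "2 \<in> F"
  using is_subfieldD(3)[OF sfF is_subfieldD(2)[OF sfF] is_subfieldD(2)[OF sfF]] by simp

sublocale group "Gal L F"
  by (rule group_Gal[OF sfL FL])

lemma adjoin_g_subset: "adjoin F {g} \<subseteq> L"
  by (rule adjoin_least[OF sfL FL]) (simp add: gL)

text \<open>Allows \<open>Gal(L/F(g))\<close> to be handled as the stabiliser of \<open>g\<close>,
  which keeps most arguments inside one group.\<close>

lemma Gal_adjoin_g_iff: "\<sigma> \<in> carrier (Gal L (adjoin F {g})) \<longleftrightarrow> \<sigma> \<in> carrier (Gal L F) \<and> \<sigma> g = g"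
proof
  assume "\<sigma> \<in> carrier (Gal L (adjoin F {g}))"
  then show "\<sigma> \<in> carrier (Gal L F) \<and> \<sigma> g = g"
    using Gal_mono[OF adjoin_superset(1)] adjoin_superset(2)[where F = F and S = "{g}"] GalD(4)[OF sfL] by blast
next
  assume "\<sigma> \<in> carrier (Gal L F) \<and> \<sigma> g = g"
  then have s: "\<sigma> \<in> carrier (Gal L F)" "\<sigma> g = g" by auto
  have "\<sigma> x = x" if x: "x \<in> adjoin F {g}" for x
  proof -
    obtain u v where "x = u + v * g" "u \<in> F" "v \<in> F" using x unfolding adjoin_quadratic[OF sfF g2] by blast
    moreover from this have "u \<in> L" "v \<in> L" using FL by auto
    ultimately show ?thesis using s(2) GalD(2,3,4)[OF sfL s(1)] is_subfieldD(4)[OF sfL] gL by simp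
  qed
  then show "\<sigma> \<in> carrier (Gal L (adjoin F {g}))" using s unfolding Gal_carrier by simp
qed

lemma Gal_g:
  assumes "\<sigma> \<in> carrier (Gal L F)"
  shows "\<sigma> g = g \<or> \<sigma> g = - g"
proof -
  have "\<sigma> g * \<sigma> g = g * g" using GalD(3,4)[OF sfL assms] gL g2 by metis
  then show ?thesis by (simp add: square_eq_iff)
qed

lemma ex_Gal_moves_g: "\<exists>\<sigma>\<in>carrier (Gal L F). \<sigma> g = - g"
  using galois_ext_fixed[OF ac gal gL] gF Gal_g by metis

lemma minus_g: "- g \<noteq> g"
  using two g0 by (metis add.inverse_inverse add_eq_0_iff mult_2 mult_eq_0_iff)

text \<open>The stabiliser of \<open>g\<close> has index 2 and \<open>X\<close> represents the other
  coset, so these invariances amount to invariance under the whole group.\<close>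

lemma fixed_by_coset:
  assumes X: "X \<in> carrier (Gal L F)" "X g = - g" and x: "x \<in> L" "X x = x"
    and H: "\<And>h. h \<in> carrier (Gal L F) \<Longrightarrow> h g = g \<Longrightarrow> h x = x"
  shows "x \<in> F"
proof (rule galois_ext_fixed[OF ac gal x(1)])
  fix \<sigma> assume s: "\<sigma> \<in> carrier (Gal L F)"
  let ?X' = "inv\<^bsub>Gal L F\<^esub> X"
  have X': "?X' \<in> carrier (Gal L F)" using X by simp
  show "\<sigma> x = x"
  proof (cases "\<sigma> g = g")
    case True then show ?thesis using H s by simp
  next
    case False
    then have "\<sigma> g = - g" using Gal_g s by blast
    then have "(?X' \<circ> \<sigma>) g = g" using X Gal_inv_apply(1)[OF sfL FL X(1), of g] by simp
    then have "(?X' \<circ> \<sigma>) x = x" by (rule H[OF Gal_comp[OF X' s]])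
    then have "X (?X' (\<sigma> x)) = X x" by simp
    then show ?thesis using Gal_inv_apply(2)[OF sfL FL X(1)] x by simp
  qed
qed

text \<open>The fixed field of the stabiliser of \<open>g\<close> is \<open>F(g)\<close>, with
  \<open>X\<close> as its conjugation: \<open>u\<close> is half the sum of \<open>x\<close> and
  \<open>X x\<close>, and \<open>v\<close> is half their difference divided by \<open>g\<close>.
  Both are fixed by \<open>X\<close> because \<open>X (X x) = x\<close>.\<close>

lemma norm_of_fixed:
  assumes X: "X \<in> carrier (Gal L F)" "X g = - g" and x: "x \<in> L"
    and H: "\<And>h. h \<in> carrier (Gal L F) \<Longrightarrow> h g = g \<Longrightarrow> h x = x"
  shows "\<exists>u\<in>F. \<exists>v\<in>F. x = u + v * g \<and> X x = u - v * g"
proof -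
  note S = is_subfieldD[OF sfL] and D = GalD[OF sfL X(1)]
  let ?X' = "inv\<^bsub>Gal L F\<^esub> X"
  have X': "?X' \<in> carrier (Gal L F)" using X by simp
  have XXg: "(X \<circ> X) g = g" using X D(7)[OF gL] by simp
  have XX: "X (X x) = x" using H[OF Gal_comp[OF X(1) X(1)] XXg] by simp
  have X'g: "?X' g = - g"
    using Gal_inv_apply(1)[OF sfL FL X(1), of "- g"] X D(7)[OF gL] by simp
  have HX: "h (X x) = X x" if h: "h \<in> carrier (Gal L F)" "h g = g" for h
  proof -
    have "(?X' \<circ> (h \<circ> X)) g = g"
      using X h X'g GalD(7)[OF sfL h(1) gL] GalD(7)[OF sfL X' gL] by simp
    then have "(?X' \<circ> (h \<circ> X)) x = x" by (intro H Gal_comp X' h X)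
    then have "X (?X' (h (X x))) = X x" by simp
    then show ?thesis using Gal_inv_apply(2)[OF sfL FL X(1)] by simp
  qed
  define u where "u = (x + X x) / 2"
  define v where "v = (x - X x) / (2 * g)"
  have inL: "X x \<in> L" "x + X x \<in> L" "x - X x \<in> L" "2 \<in> L" "2 * g \<in> L"
    using D(1)[OF x] x S twoF FL gL by auto
  then have uvL: "u \<in> L" "v \<in> L" unfolding u_def v_def using S(8) by auto
  have X2: "\<sigma> 2 = 2" if "\<sigma> \<in> carrier (Gal L F)" for \<sigma> using GalD(4)[OF sfL that twoF] .
  have "u \<in> F"
  proof (rule fixed_by_coset[OF X uvL(1)])
    show "X u = u" unfolding u_def using D(2,10) inL x XX X2[OF X(1)] by (simp add: add.commute)
    show "h u = u" if "h \<in> carrier (Gal L F)" "h g = g" for h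
      unfolding u_def using GalD(2,10)[OF sfL that(1)] inL x HX[OF that] H[OF that] X2[OF that(1)] by simp
  qed
  moreover have "v \<in> F"
  proof (rule fixed_by_coset[OF X uvL(2)])
    have "X v = (X x - x) / (2 * (- g))"
      unfolding v_def using D(3,8,10) inL x gL XX X2[OF X(1)] X by simp
    then show "X v = v" unfolding v_def using g0 two by (simp add: field_simps)
    show "h v = v" if "h \<in> carrier (Gal L F)" "h g = g" for h
      unfolding v_def using GalD(3,8,10)[OF sfL that(1)] inL x gL HX[OF that] H[OF that] X2[OF that(1)] that by simp
  qed
  moreover have "(4::'k) \<noteq> 0" using two mult_eq_0_iff[of "2::'k" 2] by simp
  then have "x = u + v * g" "X x = u - v * g"
    unfolding u_def v_def using two g0 by (simp_all add: field_simps)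
  ultimately show ?thesis by blast
qed

text \<open>The Kummer generator \<open>e\<close> of the character \<open>\<psi>\<close> gives \<open>d = e \<cdot> X e\<close>, whose square is the
  norm of \<open>e\<^sup>2\<close>.\<close>
lemma norm_from_character:
  assumes X: "X \<in> carrier (Gal L F)" "X g = - g"
    and fin: "finite (carrier (Gal L (adjoin F {g})))"
    and pm: "\<And>h. h \<in> carrier (Gal L F) \<Longrightarrow> h g = g \<Longrightarrow> \<psi> h = 1 \<or> \<psi> h = -1"
    and hom: "\<And>h k. h \<in> carrier (Gal L F) \<Longrightarrow> h g = g \<Longrightarrow> k \<in> carrier (Gal L F) \<Longrightarrow> k g = g \<Longrightarrow>
      \<psi> (h \<circ> k) = \<psi> h * \<psi> k"
    and XX: "\<psi> (X \<circ> X) = 1"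
  shows "\<exists>d\<in>L. d \<noteq> 0 \<and> (\<exists>u\<in>F. \<exists>v\<in>F. d * d = u * u - g * g * (v * v)) \<and> X d = d \<and>
    (\<forall>h\<in>carrier (Gal L F). h g = g \<longrightarrow> h d = \<psi> h * \<psi> (inv\<^bsub>Gal L F\<^esub> X \<circ> (h \<circ> X)) * d)"
proof -
  note S = is_subfieldD[OF sfL] and D = GalD[OF sfL X(1)]
  let ?X' = "inv\<^bsub>Gal L F\<^esub> X"
  have X': "?X' \<in> carrier (Gal L F)" using X by simp
  have X'g: "?X' g = - g"
    using Gal_inv_apply(1)[OF sfL FL X(1), of "- g"] X D(7)[OF gL] by simp
  have "\<exists>e\<in>L. e \<noteq> 0 \<and> (\<forall>h\<in>carrier (Gal L (adjoin F {g})). h e = \<psi> h * e)"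
    by (rule Gal_eigenvector[OF sfL adjoin_g_subset fin]) (use pm hom in \<open>simp_all add: Gal_adjoin_g_iff\<close>)
  then obtain e where e: "e \<in> L" "e \<noteq> 0"
    and all: "\<forall>h\<in>carrier (Gal L (adjoin F {g})). h e = \<psi> h * e" by (elim bexE conjE)
  have he: "h e = \<psi> h * e" if "h \<in> carrier (Gal L F)" "h g = g" for h
    by (rule bspec[OF all]) (simp add: Gal_adjoin_g_iff that)
  have XXg: "(X \<circ> X) g = g" using X D(7)[OF gL] by simp
  have XXe: "X (X e) = e" using he[OF Gal_comp[OF X(1) X(1)] XXg] unfolding XX by simp
  have psiL: "\<psi> h \<in> L \<and> \<sigma> (\<psi> h) = \<psi> h" if "h \<in> carrier (Gal L F)" "h g = g" "\<sigma> \<in> carrier (Gal L F)" for h \<sigma>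
    using pm[OF that(1,2)] S(2) S(5)[OF S(2)] GalD(6,7)[OF sfL that(3)] by auto
  have psi2: "\<psi> h * \<psi> h = 1" if "h \<in> carrier (Gal L F)" "h g = g" for h
    using pm[OF that] by auto
  define d where "d = e * X e"
  have dL: "d \<in> L" unfolding d_def using e D(1) S(4) by simp
  have Xd: "X d = d" unfolding d_def using D(3)[OF e(1) D(1)[OF e(1)]] XXe by simp
  \<comment> \<open>With \<open>k = X^-1 h X\<close> one has
    \<open>h (X e) = X (k e) = \<psi> k * X e\<close>.\<close>
  have hd: "h d = \<psi> h * \<psi> (?X' \<circ> (h \<circ> X)) * d" if h: "h \<in> carrier (Gal L F)" "h g = g" for h
  proof -
    define k where "k = ?X' \<circ> (h \<circ> X)"
    have k: "k \<in> carrier (Gal L F)" unfolding k_def by (intro Gal_comp X' h X)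
    have kg: "k g = g"
      unfolding k_def using X h X'g GalD(7)[OF sfL h(1) gL] GalD(7)[OF sfL X' gL] by simp
    have "X (k e) = h (X e)" unfolding k_def using Gal_inv_apply(2)[OF sfL FL X(1)] by simp
    moreover have "X (k e) = \<psi> k * X e"
      using he[OF k kg] D(3)[OF _ e(1), of "\<psi> k"] psiL[OF k kg X(1)] by simp
    ultimately have "h (X e) = \<psi> k * X e" by simp
    then show ?thesis
      unfolding d_def k_def[symmetric] using GalD(3)[OF sfL h(1) e(1) D(1)[OF e(1)]] he[OF h] by (simp add: mult.assoc mult.left_commute)
  qed
  have ee: "e * e \<in> L" using e S(4) by simp
  have "h (e * e) = e * e" if h: "h \<in> carrier (Gal L F)" "h g = g" for h
  proof -
    have "h (e * e) = (\<psi> h * \<psi> h) * (e * e)"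
      using GalD(3)[OF sfL h(1) e(1) e(1)] he[OF h] by (simp add: mult.assoc mult.left_commute)
    then show ?thesis using psi2[OF h] by simp
  qed
  then obtain u v where uv: "u \<in> F" "v \<in> F" "e * e = u + v * g" "X (e * e) = u - v * g"
    using norm_of_fixed[OF X ee] by blast
  have "d * d = (e * e) * X (e * e)" unfolding d_def using D(3)[OF e(1) e(1)] by (simp add: mult.assoc mult.left_commute)
  also have "\<dots> = (u + v * g) * (u - v * g)" by (subst uv(4)) (simp only: uv(3))
  also have "\<dots> = u * u - g * g * (v * v)" by (simp add: algebra_simps)
  finally have "d * d = u * u - g * g * (v * v)" .
  moreover have "d \<noteq> 0" unfolding d_def using e D(11) by simp
  ultimately show ?thesis using dL Xd hd uv by blast
qed

text \<open>The elements fixing \<open>g\<close> map into the Klein four-group 1, r^2, s, r^2 s. The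
  character \<open>\<psi>\<close> is -1 on r^2 and r^2 s; conjugation by the image r s of
  \<open>X\<close> exchanges s and r^2 s, so \<open>\<psi>\<close> times its conjugate is -1 exactly
  on these two reflections.\<close>

lemma norm_from_D8:
  assumes X: "X \<in> carrier (Gal L F)" "X g = - g"
    and fin: "finite (carrier (Gal L (adjoin F {g})))"
    and pi: "\<pi> \<in> hom (Gal L F) D8" "\<pi> X = (1, True)"
    and par: "\<And>h. h \<in> carrier (Gal L F) \<Longrightarrow> h g = g \<longleftrightarrow> even (fst (\<pi> h))"
  shows "\<exists>d\<in>L. d \<noteq> 0 \<and> (\<exists>u\<in>F. \<exists>v\<in>F. d * d = u * u - g * g * (v * v)) \<and> X d = d \<and>
    (\<forall>h\<in>carrier (Gal L F). h g = g \<longrightarrow> h d = (if snd (\<pi> h) then - d else d))"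
proof -
  interpret p: group_hom "Gal L F" D8 \<pi>
    by (intro group_hom.intro group_axioms group_D8 group_hom_axioms.intro pi(1))
  define \<psi> :: "('k \<Rightarrow> 'k) \<Rightarrow> 'k" where "\<psi> = (\<lambda>h. if fst (\<pi> h) = 2 then -1 else 1)"
  have even: "\<pi> h \<in> {(0, False), (2, False), (0, True), (2, True)}" if "h \<in> carrier (Gal L F)" "h g = g" for h
  proof -
    have "\<pi> h \<in> carrier D8" "even (fst (\<pi> h))" using that p.hom_closed par by auto
    then show ?thesis by (elim D8_carrierE) simp_all
  qed
  have pc: "\<pi> (h \<circ> k) = \<pi> h \<otimes>\<^bsub>D8\<^esub> \<pi> k" if "h \<in> carrier (Gal L F)" "k \<in> carrier (Gal L F)" for h k
    using p.hom_mult[OF that] by simp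
  have "\<exists>d\<in>L. d \<noteq> 0 \<and> (\<exists>u\<in>F. \<exists>v\<in>F. d * d = u * u - g * g * (v * v)) \<and> X d = d \<and>
    (\<forall>h\<in>carrier (Gal L F). h g = g \<longrightarrow> h d = \<psi> h * \<psi> (inv\<^bsub>Gal L F\<^esub> X \<circ> (h \<circ> X)) * d)"
  proof (rule norm_from_character[OF X fin])
    show "\<psi> h = 1 \<or> \<psi> h = -1" for h unfolding \<psi>_def by simp
    show "\<psi> (h \<circ> k) = \<psi> h * \<psi> k"
      if "h \<in> carrier (Gal L F)" "h g = g" "k \<in> carrier (Gal L F)" "k g = g" for h k
      using even[OF that(1,2)] even[OF that(3,4)] pc[OF that(1,3)] by (auto simp: \<psi>_def D8_mult)
    show "\<psi> (X \<circ> X) = 1" using pc[OF X(1) X(1)] pi(2) by (simp add: \<psi>_def D8_mult)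
  qed
  moreover have "\<psi> h * \<psi> (inv\<^bsub>Gal L F\<^esub> X \<circ> (h \<circ> X)) = (if snd (\<pi> h) then -1 else 1)"
    if h: "h \<in> carrier (Gal L F)" "h g = g" for h
  proof -
    have "\<pi> (inv\<^bsub>Gal L F\<^esub> X \<circ> (h \<circ> X)) = (1, True) \<otimes>\<^bsub>D8\<^esub> (\<pi> h \<otimes>\<^bsub>D8\<^esub> (1, True))"
      using pc[OF inv_closed[OF X(1)] Gal_comp[OF h(1) X(1)]] pc[OF h(1) X(1)] p.hom_inv[OF X(1)] pi(2)
      by (simp add: D8_inv)
    then show ?thesis using even[OF h] by (auto simp: \<psi>_def D8_mult)
  qed
  ultimately show ?thesis by fastforce
qed

text \<open>The parity of the first coordinate is a character of \<open>D8\<close>, and the sign of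
  the action on \<open>g\<close> is one of the Galois group; two characters that agree on generators
  agree.\<close>

lemma parity_of_generators:
  assumes gen: "generate (Gal L F) S = carrier (Gal L F)" "S \<subseteq> carrier (Gal L F)" and pi: "\<pi> \<in> hom (Gal L F) D8"
    and S: "\<And>s. s \<in> S \<Longrightarrow> s g = (if even (fst (\<pi> s)) then g else - g)" and h: "h \<in> carrier (Gal L F)"
  shows "h g = g \<longleftrightarrow> even (fst (\<pi> h))"
proof -
  interpret p: group_hom "Gal L F" D8 \<pi>
    by (intro group_hom.intro group_axioms group_D8 group_hom_axioms.intro pi(1))
  let ?P = "\<lambda>h. h g = (if even (fst (\<pi> h)) then g else - g)"
  have pmul: "even (fst (p \<otimes>\<^bsub>D8\<^esub> q)) \<longleftrightarrow> even (fst p) = even (fst q)" if "p \<in> carrier D8" "q \<in> carrier D8" for p q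
    using that by (elim D8_carrierE) (simp_all add: D8_mult)
  have mul: "?P (h \<circ> k)" if "?P h" "?P k" "h \<in> carrier (Gal L F)" "k \<in> carrier (Gal L F)" for h k
  proof -
    have "\<pi> (h \<circ> k) = \<pi> h \<otimes>\<^bsub>D8\<^esub> \<pi> k" using p.hom_mult[OF that(3,4)] by simp
    then have "even (fst (\<pi> (h \<circ> k))) \<longleftrightarrow> even (fst (\<pi> h)) = even (fst (\<pi> k))"
      using pmul p.hom_closed that by simp
    then show ?thesis using that(1,2) GalD(7)[OF sfL that(3) gL] by auto
  qed
  have "h \<in> generate (Gal L F) S" using h gen by simp
  then have "?P h"
  proof (induction rule: generate.induct)
    case one
    have "\<pi> id = (0, False)" using p.hom_one by (simp only: Gal_one D8_one)
    then show ?case unfolding Gal_one \<open>\<pi> id = (0, False)\<close> by simp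
  next
    case (incl h) then show ?case using S by blast
  next
    case (inv h)
    let ?h' = "inv\<^bsub>Gal L F\<^esub> h"
    have hC: "h \<in> carrier (Gal L F)" using inv gen by blast
    have "even (fst (inv\<^bsub>D8\<^esub> q)) \<longleftrightarrow> even (fst q)" if "q \<in> carrier D8" for q
      using that by (elim D8_carrierE) (simp_all add: D8_inv)
    then have "even (fst (\<pi> ?h')) \<longleftrightarrow> even (fst (\<pi> h))" using p.hom_inv[OF hC] p.hom_closed[OF hC] by simp
    moreover have "?h' (h g) = g" by (rule Gal_inv_apply(1)[OF sfL FL hC])
    ultimately show ?case using S[OF inv] GalD(7)[OF sfL inv_closed[OF hC] gL]
      by (cases "even (fst (\<pi> h))") (auto, metis add.inverse_inverse)
  next
    case (eng h1 h2)
    then have "h1 \<in> carrier (Gal L F)" "h2 \<in> carrier (Gal L F)" using gen by simp_all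
    then show ?case unfolding Gal_mult using eng.IH by (intro mul)
  qed
  then show ?thesis using minus_g by (simp split: if_splits)
qed

text \<open>A generator \<open>c\<close> of the cyclic group negates \<open>g\<close>. For
  \<open>e\<close> with \<open>c (c e) = - e\<close> one has \<open>e^2 = u + v g\<close>, and
  \<open>w = e * c e / g\<close> is fixed by \<open>c\<close>, hence in \<open>F\<close>. The norm
  equation \<open>w^2 g^2 = u^2 - v^2 g^2\<close> is then solved for -1. The second claim holds
  because the only involution is \<open>c^2\<close>.\<close>

lemma C4_imp_minus_one_norm:
  assumes iso: "Gal L F \<cong> C4"
  shows "\<exists>p\<in>F. \<exists>q\<in>F. -1 = p * p - g * g * (q * q)"
    and "\<sigma> \<in> carrier (Gal L F) \<Longrightarrow> \<sigma> \<circ> \<sigma> = id \<Longrightarrow> \<sigma> g = g"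
proof -
  note S = is_subfieldD[OF sfL] and SF = is_subfieldD[OF sfF]
  obtain f where "f \<in> iso (Gal L F) C4" using iso unfolding is_iso_def by blast
  then have f: "f \<in> hom (Gal L F) C4" and bij: "bij_betw f (carrier (Gal L F)) (carrier C4)" unfolding iso_def by auto
  have fm: "f (s \<circ> t) = (f s + f t) mod 4" if "s \<in> carrier (Gal L F)" "t \<in> carrier (Gal L F)" for s t
    using f that unfolding hom_def by simp
  have inj: "s = t" if "f s = f t" "s \<in> carrier (Gal L F)" "t \<in> carrier (Gal L F)" for s t
    using bij that unfolding bij_betw_def inj_on_def by blast
  have "1 \<in> carrier C4" by (simp add: carrier_integer_mod_group)
  then obtain c where c: "c \<in> carrier (Gal L F)" "f c = 1" using bij unfolding bij_betw_def by (metis imageE)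
  have c2: "c \<circ> c \<in> carrier (Gal L F)" "f (c \<circ> c) = 2" using Gal_comp[OF c(1) c(1)] fm[OF c(1) c(1)] c(2) by auto
  have c3: "c \<circ> (c \<circ> c) \<in> carrier (Gal L F)" "f (c \<circ> (c \<circ> c)) = 3"
    using Gal_comp[OF c(1) c2(1)] fm[OF c(1) c2(1)] c(2) c2(2) by auto
  have range: "f s = 0 \<or> f s = 1 \<or> f s = 2 \<or> f s = 3" if "s \<in> carrier (Gal L F)" for s
  proof -
    have "f s \<in> {0..<4}" using bij that unfolding bij_betw_def by (auto simp: carrier_integer_mod_group)
    then show ?thesis by auto
  qed
  have f0: "f id = 0"
    using fm[OF Gal_id Gal_id] range[OF Gal_id] unfolding comp_id by auto
  have c4: "c \<circ> (c \<circ> (c \<circ> c)) = id"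
    using fm[OF c(1) c3(1)] c(2) c3(2) f0 by (intro inj Gal_comp c Gal_id) simp
  have all: "s = id \<or> s = c \<or> s = c \<circ> c \<or> s = c \<circ> (c \<circ> c)" if s: "s \<in> carrier (Gal L F)" for s
  proof -
    show ?thesis using range[OF s] inj[OF _ s] f0 c c2 c3 Gal_id[of L F] by metis
  qed
  note D = GalD[OF sfL c(1)]
  have cg: "c g = - g"
  proof (rule ccontr)
    assume "c g \<noteq> - g"
    then have "c g = g" using Gal_g[OF c(1)] by simp
    then have "s g = g" if "s \<in> carrier (Gal L F)" for s using all[OF that] by auto
    then show False using ex_Gal_moves_g minus_g by metis
  qed
  have ccg: "c (c g) = g" using cg D(7)[OF gL] by simp
  show "\<sigma> g = g" if "\<sigma> \<in> carrier (Gal L F)" "\<sigma> \<circ> \<sigma> = id" for \<sigma>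
  proof -
    have "(f \<sigma> + f \<sigma>) mod 4 = 0" using fm[OF that(1) that(1)] that(2) f0 by simp
    then have "f \<sigma> \<noteq> 1" "f \<sigma> \<noteq> 3" by auto
    then have "\<sigma> \<noteq> c" "\<sigma> \<noteq> c \<circ> (c \<circ> c)" using c c3 by auto
    then have "\<sigma> = id \<or> \<sigma> = c \<circ> c" using all[OF that(1)] by blast
    then show ?thesis using ccg by auto
  qed
  have "c \<circ> c \<noteq> id" using c2 f0 by auto
  then obtain x where "c (c x) \<noteq> x" by (metis comp_apply eq_id_iff)
  then have xL: "x \<in> L" using GalD(13)[OF sfL c(1)] by metis
  have c4x: "c (c (c (c z))) = z" for z using fun_cong[OF c4, of z] by simp
  define e where "e = x - c (c x)"
  have eL: "e \<in> L" "e \<noteq> 0" unfolding e_def using xL S(7) D(1) \<open>c (c x) \<noteq> x\<close> by auto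
  have cce: "c (c e) = - e" unfolding e_def using xL D(1,8) c4x by simp
  have H: "h (e * e) = e * e" if h: "h \<in> carrier (Gal L F)" "h g = g" for h
  proof -
    have "h = id \<or> h = c \<circ> c" using all[OF h(1)] h(2) cg ccg minus_g by auto
    then show ?thesis using D(3) D(1) eL cce by auto
  qed
  have ee: "e * e \<in> L" using eL S(4) by simp
  obtain u v where uv: "u \<in> F" "v \<in> F" "e * e = u + v * g" "c (e * e) = u - v * g"
    using norm_of_fixed[OF c(1) cg ee] H by blast
  define w where "w = e * c e / g"
  have wL: "w \<in> L" unfolding w_def using eL gL D(1) S(4,8) by simp
  have cw: "c w = w"
    unfolding w_def using D(3)[OF eL(1) D(1)[OF eL(1)]] D(10)[OF S(4)[OF eL(1) D(1)[OF eL(1)]] gL] cce cg by simp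
  have wF: "w \<in> F"
  proof (rule fixed_by_coset[OF c(1) cg wL cw])
    show "h w = w" if h: "h \<in> carrier (Gal L F)" "h g = g" for h
    proof -
      have "h = id \<or> h = c \<circ> c" using all[OF h(1)] h(2) cg ccg minus_g by auto
      then show ?thesis using cw by auto
    qed
  qed
  have w0: "w \<noteq> 0" unfolding w_def using eL g0 D(11) by simp
  have "w * w * (g * g) = (e * e) * c (e * e)" unfolding w_def using D(3)[OF eL(1) eL(1)] g0 by simp
  also have "\<dots> = (u + v * g) * (u - v * g)" by (subst uv(4)) (simp only: uv(3))
  finally have eq: "w * w * (g * g) = u * u - v * v * (g * g)" by (simp add: algebra_simps)
  \<comment> \<open>From \<open>u^2 = (w^2 + v^2) g^2\<close> by division by \<open>w^2 g^2\<close>;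
    \<open>u / g\<close> is written as \<open>g * (u / g^2)\<close> so that the coefficient stays in
    \<open>F\<close>.\<close>
  have "-1 = (v / w) * (v / w) - g * g * ((u / (g * g * w)) * (u / (g * g * w)))"
  proof -
    have "u * u = (w * w + v * v) * (g * g)" using eq by (simp add: algebra_simps)
    moreover have "g * g * ((u / (g * g * w)) * (u / (g * g * w))) = u * u / (g * g * (w * w))"
      using g0 w0 by (simp add: field_simps)
    ultimately show ?thesis using g0 w0 by (simp add: field_simps)
  qed
  moreover have "v / w \<in> F" "u / (g * g * w) \<in> F" using uv wF g2 SF(4,8) by auto
  ultimately show "\<exists>p\<in>F. \<exists>q\<in>F. -1 = p * p - g * g * (q * q)" by blast
qed

text \<open>\<open>Y\<close> keeps \<open>d\<close> out of \<open>F\<close>; and if \<open>d\<close>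
  were \<open>g f\<close> up to sign, \<open>X\<close> would negate \<open>d\<close> along with
  \<open>g\<close>.\<close>

lemma nonsquare_from_automorphisms:
  assumes "d \<in> L" "d * d \<in> F" "d \<noteq> 0"
    and Y: "Y \<in> carrier (Gal L F)" "Y g = g" "Y d = - d" and X: "X \<in> carrier (Gal L F)" "X g = - g" "X d = d"
    and f: "f \<in> F"
  shows "d * d \<noteq> f * f" "d * d \<noteq> g * g * (f * f)"
proof -
  have ne: "- d \<noteq> d" using two assms(3) by (metis add.inverse_inverse add_eq_0_iff mult_2 mult_eq_0_iff)
  have fL: "f \<in> L" using f FL by blast
  show "d * d \<noteq> f * f"
  proof
    assume "d * d = f * f"
    then have "d = f \<or> d = - f" by (simp add: square_eq_iff)
    then have "d \<in> F" using f is_subfieldD(5)[OF sfF] by auto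
    then show False using GalD(4)[OF sfL Y(1)] Y(3) ne by simp
  qed
  show "d * d \<noteq> g * g * (f * f)"
  proof
    assume "d * d = g * g * (f * f)"
    then have "d * d = (g * f) * (g * f)" by (simp add: algebra_simps)
    then have d: "d = g * f \<or> d = - (g * f)" by (simp add: square_eq_iff)
    have "X (g * f) = - (g * f)" using GalD(3,4)[OF sfL X(1)] gL fL f X by simp
    moreover have "g * f \<in> L" using is_subfieldD(4)[OF sfL gL fL] .
    ultimately have "X d = - d" using d GalD(7)[OF sfL X(1)] by auto
    then show False using X ne by simp
  qed
qed

text \<open>A priori \<open>F(g)\<close> could belong to any nontrivial sign character of
  \<open>G_2\<close>, so \<open>x\<close> must first be shown to move \<open>g\<close> while
  \<open>y\<close> and \<open>z\<close> fix it. The tool is that commutators of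
  \<open>Gal(L/F(g))\<close> lie in \<open>{1, c}\<close>. The two dihedral quotients then supply
  two norms, at least one of them new.\<close>

lemma norms_of_G2:
  assumes iso: "iso_G2 (Gal L F)" and DD: "Gal L (adjoin F {g}) \<cong> DD"
  shows "\<exists>u\<in>F. \<exists>v\<in>F. u * u - g * g * (v * v) \<noteq> 0 \<and>
    (\<forall>f\<in>F. u * u - g * g * (v * v) \<noteq> f * f \<and> u * u - g * g * (v * v) \<noteq> - (g * g * (f * f)))"
proof -
  let ?G = "Gal L F" and ?M = "Gal L (adjoin F {g})"
  note SF = is_subfieldD[OF sfF]
  obtain x y z \<pi> \<rho> where xyz: "x \<in> carrier ?G" "y \<in> carrier ?G" "z \<in> carrier ?G" and r: "G2_rels ?G x y z"
    and gen: "generate ?G {x, y, z} = carrier ?G"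
    and pi: "\<pi> \<in> hom ?G D8" "\<pi> x = (1, True)" "\<pi> y = (0, True)" "\<pi> z = (0, False)"
    and rho: "\<rho> \<in> hom ?G D8" "\<rho> x = (1, True)" "\<rho> y = (0, False)" "\<rho> z = (0, True)"
    by (rule ex_hom_D8_of_G2[OF iso])
  interpret p: group_hom ?G D8 \<pi> by (intro group_hom.intro group_axioms group_D8 group_hom_axioms.intro pi(1))
  interpret q: group_hom ?G D8 \<rho> by (intro group_hom.intro group_axioms group_D8 group_hom_axioms.intro rho(1))
  interpret M: group ?M by (rule group_Gal[OF sfL adjoin_g_subset])
  define t s w where "t = commutator ?G x y" and "s = commutator ?G x z" and "w = commutator ?G y s"
  note R = G2_relations[OF xyz r, folded t_def s_def, folded w_def]
  note C = R(1-3)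
  obtain c where cM: "\<And>g h. g \<in> carrier ?M \<Longrightarrow> h \<in> carrier ?M \<Longrightarrow> commutator ?M g h \<in> {\<one>\<^bsub>?M\<^esub>, c}"
    and zM: "\<And>g. g \<in> carrier ?M \<Longrightarrow> (\<And>h. h \<in> carrier ?M \<Longrightarrow> g \<otimes>\<^bsub>?M\<^esub> h = h \<otimes>\<^bsub>?M\<^esub> g) \<Longrightarrow> g \<in> {\<one>\<^bsub>?M\<^esub>, c}"
    and fin: "finite (carrier ?M)"
    using DD_commutators_centre[OF M.group_axioms DD] by blast
  have Minv: "inv\<^bsub>?M\<^esub> h = inv\<^bsub>?G\<^esub> h" if "h \<in> carrier ?M" for h
  proof (rule M.inv_equality[OF _ that])
    have hG: "h \<in> carrier ?G" using that Gal_adjoin_g_iff by blast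
    show "inv\<^bsub>?G\<^esub> h \<otimes>\<^bsub>?M\<^esub> h = \<one>\<^bsub>?M\<^esub>" using l_inv[OF hG] by (simp only: Gal_mult Gal_one)
    have "(inv\<^bsub>?G\<^esub> h) (h g) = g" by (rule Gal_inv_apply(1)[OF sfL FL hG])
    then show "inv\<^bsub>?G\<^esub> h \<in> carrier ?M" using that hG unfolding Gal_adjoin_g_iff by simp
  qed
  have comm: "commutator ?M h k = commutator ?G h k" if "h \<in> carrier ?M" "k \<in> carrier ?M" for h k
    unfolding commutator_def Minv[OF that(1)] Minv[OF that(2)] by (simp only: Gal_mult)
  have MG: "h \<in> carrier ?M \<longleftrightarrow> h \<in> carrier ?G \<and> h g = g" for h by (rule Gal_adjoin_g_iff)
  have comm_M: "commutator ?G h k \<in> carrier ?M" if "h \<in> carrier ?G" "k \<in> carrier ?G" for h k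
  proof -
    have e: "\<sigma> (- g) = - \<sigma> g" if "\<sigma> \<in> carrier ?G" for \<sigma> using GalD(7)[OF sfL that gL] .
    have i: "(inv\<^bsub>?G\<^esub> \<sigma>) g = \<sigma> g" if "\<sigma> \<in> carrier ?G" for \<sigma>
      using Gal_g[OF that] Gal_inv_apply(1)[OF sfL FL that, of g] e[OF inv_closed[OF that]] by (metis minus_minus)
    have "commutator ?G h k g = (inv\<^bsub>?G\<^esub> h) ((inv\<^bsub>?G\<^esub> k) (h (k g)))"
      unfolding commutator_def by (simp only: Gal_mult comp_apply)
    also have "\<dots> = g"
      using Gal_g[OF that(1)] Gal_g[OF that(2)] i[OF that(1)] i[OF that(2)] e[OF that(1)] e[OF that(2)]
        e[OF inv_closed[OF that(1)]] e[OF inv_closed[OF that(2)]] by auto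
    finally show ?thesis using commutator_closed[OF that] MG by simp
  qed
  have tM: "t \<in> carrier ?M" and sM: "s \<in> carrier ?M" and wM: "w \<in> carrier ?M"
    unfolding t_def w_def using comm_M xyz C(2) s_def by simp_all
  have pt: "\<pi> t = (2, False)" "\<pi> s = (0, False)" "\<pi> w = (0, False)"
    "\<rho> t = (0, False)" "\<rho> s = (2, False)" "\<rho> w = (0, False)"
    unfolding t_def s_def w_def using xyz
    by (simp_all add: p.hom_commutator q.hom_commutator pi rho commutator_def[of D8] D8_inv D8_mult)
  have one: "\<pi> id = (0, False)" "\<rho> id = (0, False)"
    using p.hom_one q.hom_one by (simp_all only: Gal_one D8_one)
  have ts: "t \<noteq> id" "s \<noteq> id" "t \<noteq> s"
    using pt one by auto
  have in_gen: "h \<circ> k = k \<circ> h" if h: "h \<in> carrier ?G" and k: "k \<in> carrier ?G"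
    and "h \<circ> x = x \<circ> h" "h \<circ> y = y \<circ> h" "h \<circ> z = z \<circ> h" for h k
  proof -
    have "k \<in> generate ?G {x, y, z}" using gen k by simp
    then have "h \<otimes>\<^bsub>?G\<^esub> k = k \<otimes>\<^bsub>?G\<^esub> h"
    proof (induction rule: generate.induct)
      case one then show ?case using h by (simp only: l_one r_one)
    next
      case (incl k) then show ?case using that(3-5) by (auto simp only: Gal_mult insert_iff empty_iff)
    next
      case (inv k)
      then have "inv\<^bsub>?G\<^esub> k = k" using G2_rels_inv[OF xyz r] by blast
      then show ?case using inv that(3-5) by (auto simp only: Gal_mult insert_iff empty_iff)
    next
      case (eng k1 k2)
      then have "k1 \<in> carrier ?G" "k2 \<in> carrier ?G" using gen by simp_all
      then show ?case using eng.IH h by (metis m_assoc)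
    qed
    then show ?thesis by (simp only: Gal_mult)
  qed
  \<comment> \<open>Were \<open>w\<close> trivial, \<open>t\<close> and \<open>s\<close> would
    commute with all generators, giving with 1 three central elements of a group isomorphic to
    \<open>DD\<close>.\<close>
  have w1: "w \<noteq> id"
  proof
    assume w: "w = id"
    have "t \<in> {\<one>\<^bsub>?M\<^esub>, c}"
    proof (rule zM[OF tM])
      fix h assume "h \<in> carrier ?M"
      then show "t \<otimes>\<^bsub>?M\<^esub> h = h \<otimes>\<^bsub>?M\<^esub> t"
        unfolding Gal_mult using R(17,20,22) w C MG in_gen[OF C(1), of h] by (simp only: Gal_mult o_id)
    qed
    moreover have "s \<in> {\<one>\<^bsub>?M\<^esub>, c}"
    proof (rule zM[OF sM])
      fix h assume "h \<in> carrier ?M"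
      then show "s \<otimes>\<^bsub>?M\<^esub> h = h \<otimes>\<^bsub>?M\<^esub> s"
        unfolding Gal_mult using R(18,21,23) w C MG in_gen[OF C(2), of h] by (simp only: Gal_mult o_id)
    qed
    ultimately show False using ts by (simp only: Gal_one insert_iff empty_iff) auto
  qed
  \<comment> \<open>Once \<open>w\<close> is a commutator inside \<open>?M\<close>, it must be
    \<open>c\<close>, so every commutator of \<open>?M\<close> dies under both \<open>\<pi>\<close>
    and \<open>\<rho>\<close>.\<close>
  have two_comm: False if hk: "h \<in> carrier ?M" "k \<in> carrier ?M" "h' \<in> carrier ?M" "k' \<in> carrier ?M"
    and "commutator ?G h k = w" and "\<pi> (commutator ?G h' k') \<noteq> (0, False) \<or> \<rho> (commutator ?G h' k') \<noteq> (0, False)"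
    for h k h' k'
  proof -
    have "w \<in> {id, c}" "commutator ?G h' k' \<in> {id, c}"
      using cM[OF hk(1,2)] cM[OF hk(3,4)] comm[OF hk(1,2)] comm[OF hk(3,4)] that(5) by (simp_all only: Gal_one)
    then have "commutator ?G h' k' = id \<or> commutator ?G h' k' = w" using w1 by auto
    then show False using that(6) pt one by auto
  qed
  have neg: "\<sigma> (- g) = - \<sigma> g" if "\<sigma> \<in> carrier ?G" for \<sigma> using GalD(7)[OF sfL that gL] .
  have prodM: "h \<circ> k \<in> carrier ?M" if "h \<in> carrier ?G" "k \<in> carrier ?G" "h g = k g" for h k
    using that Gal_comp[OF that(1,2)] Gal_g[OF that(1)] neg[OF that(1)] MG by auto
  have pm: "\<pi> (h \<circ> k) = \<pi> h \<otimes>\<^bsub>D8\<^esub> \<pi> k" "\<rho> (h \<circ> k) = \<rho> h \<otimes>\<^bsub>D8\<^esub> \<rho> k" if "h \<in> carrier ?G" "k \<in> carrier ?G" for h k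
    using p.hom_mult[OF that] q.hom_mult[OF that] by simp_all
  have xC: "x \<circ> y \<in> carrier ?G" "x \<circ> z \<in> carrier ?G" "y \<circ> z \<in> carrier ?G" using Gal_comp xyz by auto
  \<comment> \<open>If \<open>z\<close> moves \<open>g\<close>, then \<open>x\<close> or
    \<open>x z\<close> lies in \<open>?M\<close>, and so does \<open>y\<close> or
    \<open>y z\<close>. The commutator of the latter with \<open>s\<close> is \<open>w\<close>,
    whereas the commutator of the two is still visible under \<open>\<pi>\<close>.\<close>
  have zg: "z g = g"
  proof (rule ccontr)
    assume "z g \<noteq> g"
    then have zg: "z g = - g" using Gal_g[OF xyz(3)] by blast
    show False
    proof (cases "y g = g")
      case True
      then have yM: "y \<in> carrier ?M" using MG xyz by simp
      have "x \<in> carrier ?M \<or> x \<circ> z \<in> carrier ?M" using Gal_g[OF xyz(1)] MG xyz prodM[OF xyz(1,3)] zg by auto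
      moreover have "\<pi> (commutator ?G x y) \<noteq> (0, False)" using pt(1) unfolding t_def by simp
      moreover have "\<pi> (commutator ?G (x \<circ> z) y) \<noteq> (0, False)"
        using xyz xC pm[OF xyz(1,3)] by (simp add: p.hom_commutator pi commutator_def[of D8] D8_inv D8_mult)
      ultimately show False using two_comm[OF yM sM _ yM] w_def by metis
    next
      case False
      then have yg: "y g = - g" using Gal_g[OF xyz(2)] by blast
      have yzM: "y \<circ> z \<in> carrier ?M" using prodM[OF xyz(2,3)] yg zg by simp
      have "x \<in> carrier ?M \<or> x \<circ> z \<in> carrier ?M" using Gal_g[OF xyz(1)] MG xyz prodM[OF xyz(1,3)] zg by auto
      moreover have "\<pi> (commutator ?G x (y \<circ> z)) \<noteq> (0, False)" "\<pi> (commutator ?G (x \<circ> z) (y \<circ> z)) \<noteq> (0, False)"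
        using xyz xC pm[OF xyz(1,3)] pm[OF xyz(2,3)]
        by (simp_all add: p.hom_commutator pi commutator_def[of D8] D8_inv D8_mult)
      moreover have "commutator ?G (y \<circ> z) s = w"
      proof -
        note E = R(4-24)
        have "(y \<otimes>\<^bsub>?G\<^esub> z) \<otimes>\<^bsub>?G\<^esub> (s \<otimes>\<^bsub>?G\<^esub> w) = s \<otimes>\<^bsub>?G\<^esub> (y \<otimes>\<^bsub>?G\<^esub> z)"
          using E[THEN rewr_assoc] E xyz C by (simp add: m_assoc del: Gal_mult)
        then have "w = inv\<^bsub>?G\<^esub> s \<otimes>\<^bsub>?G\<^esub> (inv\<^bsub>?G\<^esub> (y \<otimes>\<^bsub>?G\<^esub> z) \<otimes>\<^bsub>?G\<^esub> (s \<otimes>\<^bsub>?G\<^esub> (y \<otimes>\<^bsub>?G\<^esub> z)))"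
          using xyz C by (metis inv_solve_left m_closed)
        then have "w = inv\<^bsub>?G\<^esub> (commutator ?G (y \<otimes>\<^bsub>?G\<^esub> z) s)"
          using xyz C unfolding commutator_def by (simp add: inv_mult_group m_assoc del: Gal_mult)
        then have "inv\<^bsub>?G\<^esub> w = commutator ?G (y \<otimes>\<^bsub>?G\<^esub> z) s" using xyz C by (simp del: Gal_mult)
        moreover have "inv\<^bsub>?G\<^esub> w = w" using R(9) C inv_equality by blast
        ultimately show ?thesis by (simp only: Gal_mult)
      qed
      ultimately show False using two_comm[OF yzM sM _ yzM] by metis
    qed
  qed
  then have zM': "z \<in> carrier ?M" using MG xyz by simp
  \<comment> \<open>The same argument with \<open>[z, t] = w\<close> and the quotient
    \<open>\<rho>\<close>, now that \<open>z\<close> is known to lie in \<open>?M\<close>.\<close>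
  have yg: "y g = g"
  proof (rule ccontr)
    assume "y g \<noteq> g"
    then have yg: "y g = - g" using Gal_g[OF xyz(2)] by blast
    have "x \<in> carrier ?M \<or> x \<circ> y \<in> carrier ?M" using Gal_g[OF xyz(1)] MG xyz prodM[OF xyz(1,2)] yg by auto
    moreover have "\<rho> (commutator ?G x z) \<noteq> (0, False)" using pt(5) unfolding s_def by simp
    moreover have "\<rho> (commutator ?G (x \<circ> y) z) \<noteq> (0, False)"
      using xyz xC pm[OF xyz(1,2)] by (simp add: q.hom_commutator rho commutator_def[of D8] D8_inv D8_mult)
    moreover have "commutator ?G z t = w" using R(25) by simp
    ultimately show False using two_comm[OF zM' tM _ zM'] by metis
  qed
  have xg: "x g = - g"
  proof (rule ccontr)
    assume "x g \<noteq> - g"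
    then have "x g = g" using Gal_g[OF xyz(1)] by blast
    then have "\<sigma> g = g" if "\<sigma> \<in> carrier ?G" for \<sigma>
    proof -
      have "\<sigma> \<in> generate ?G {x, y, z}" using gen that by simp
      then show ?thesis
      proof (induction rule: generate.induct)
        case (inv h)
        then have "inv\<^bsub>?G\<^esub> h = h" using G2_rels_inv[OF xyz r] by blast
        then show ?case using inv \<open>x g = g\<close> yg zg by auto
      qed (use \<open>x g = g\<close> yg zg in auto)
    qed
    then show False using ex_Gal_moves_g minus_g by metis
  qed
  have S: "{x, y, z} \<subseteq> carrier ?G" using xyz by simp
  have par1: "h g = g \<longleftrightarrow> even (fst (\<pi> h))" if "h \<in> carrier ?G" for h
    by (rule parity_of_generators[OF gen S pi(1) _ that]) (auto simp: xg yg zg pi)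
  have par2: "h g = g \<longleftrightarrow> even (fst (\<rho> h))" if "h \<in> carrier ?G" for h
    by (rule parity_of_generators[OF gen S rho(1) _ that]) (auto simp: xg yg zg rho)
  obtain d u v where d: "d \<in> L" "d \<noteq> 0" "u \<in> F" "v \<in> F" "d * d = u * u - g * g * (v * v)" "x d = d"
    and dh: "\<And>h. h \<in> carrier ?G \<Longrightarrow> h g = g \<Longrightarrow> h d = (if snd (\<pi> h) then - d else d)"
    using norm_from_D8[OF xyz(1) xg fin pi(1,2) par1] by blast
  obtain d' u' v' where d': "d' \<in> L" "d' \<noteq> 0" "u' \<in> F" "v' \<in> F" "d' * d' = u' * u' - g * g * (v' * v')" "x d' = d'"
    and dh': "\<And>h. h \<in> carrier ?G \<Longrightarrow> h g = g \<Longrightarrow> h d' = (if snd (\<rho> h) then - d' else d')"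
    using norm_from_D8[OF xyz(1) xg fin rho(1,2) par2] by blast
  have yd: "y d = - d" "z d = d" "y d' = d'" "z d' = - d'"
    using dh[OF xyz(2) yg] dh[OF xyz(3) zg] dh'[OF xyz(2) yg] dh'[OF xyz(3) zg] pi rho by simp_all
  have dF: "d * d \<in> F" "d' * d' \<in> F" unfolding d(5) d'(5) using d d' g2 SF(4,7) by auto
  have n1: "\<forall>f\<in>F. d * d \<noteq> f * f" and n2: "\<forall>f\<in>F. d' * d' \<noteq> f * f"
    using nonsquare_from_automorphisms(1)[OF d(1) dF(1) d(2) xyz(2) yg yd(1) xyz(1) xg d(6)]
      nonsquare_from_automorphisms(1)[OF d'(1) dF(2) d'(2) xyz(3) zg yd(4) xyz(1) xg d'(6)] by auto
  \<comment> \<open>If both norms were in -aF^2, then \<open>d / d'\<close> would lie in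
    \<open>F\<close>, although \<open>y\<close> negates \<open>d\<close> and fixes
    \<open>d'\<close>.\<close>
  have "(\<forall>f\<in>F. d * d \<noteq> - (g * g * (f * f))) \<or> (\<forall>f\<in>F. d' * d' \<noteq> - (g * g * (f * f)))"
  proof (rule ccontr)
    assume "\<not> ?thesis"
    then obtain f f' where f: "f \<in> F" "f' \<in> F" "d * d = - (g * g * (f * f))" "d' * d' = - (g * g * (f' * f'))" by blast
    have "f' \<noteq> 0" using f(4) d'(2) by auto
    have "(d * d) * (f' * f') = (d' * d') * (f * f)" unfolding f(3,4) by simp
    then have "(d * f') * (d * f') = (d' * f) * (d' * f)" by (simp add: mult.assoc mult.left_commute)
    then have "d * f' = d' * f \<or> d * f' = - (d' * f)" by (simp add: square_eq_iff)
    then have "d = d' * (f / f') \<or> d = d' * (- f / f')" using \<open>f' \<noteq> 0\<close> by (simp add: field_simps)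
    then obtain k where k: "k \<in> F" "d = d' * k" using f SF(5,8) by metis
    have "y d = d" unfolding k(2) using GalD(3,4)[OF sfL xyz(2)] d'(1) k(1) FL yd(3) by (simp add: subset_iff)
    then have "d = - d" using yd(1) by simp
    then show False using two d(2) by (metis add_eq_0_iff mult_2 mult_eq_0_iff add.inverse_inverse)
  qed
  then show ?thesis
  proof
    assume "\<forall>f\<in>F. d * d \<noteq> - (g * g * (f * f))"
    then show ?thesis using n1 d by (intro bexI[of _ u] bexI[of _ v]) auto
  next
    assume "\<forall>f\<in>F. d' * d' \<noteq> - (g * g * (f * f))"
    then show ?thesis using n2 d' by (intro bexI[of _ u'] bexI[of _ v']) auto
  qed
qed

text \<open>The cyclic quartic field makes -1 a norm. If -1 is not a square, it is itself the new
  norm, because \<open>1 = g^2 f^2\<close> would put \<open>g\<close> into \<open>F\<close>. If it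
  is a square, then -aF^2 = aF^2, and the dihedral quotient of \<open>G_1\<close> provides the
  norm.\<close>

lemma norms_of_G1:
  assumes iso: "iso_G1 (Gal L F)" and E: "E \<subseteq> L" "galois_ext F E" "g \<in> E" "Gal E F \<cong> C4"
  shows "\<exists>u\<in>F. \<exists>v\<in>F. u * u - g * g * (v * v) \<noteq> 0 \<and>
    (\<forall>f\<in>F. u * u - g * g * (v * v) \<noteq> f * f \<and> u * u - g * g * (v * v) \<noteq> - (g * g * (f * f)))"
proof -
  let ?G = "Gal L F"
  note SF = is_subfieldD[OF sfF]
  interpret E: sqrt_ext F E g by unfold_locales (use ac E two gF g2 in auto)
  obtain p q where pq: "p \<in> F" "q \<in> F" "-1 = p * p - g * g * (q * q)"
    using E.C4_imp_minus_one_norm(1)[OF E(4)] by blast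
  show ?thesis
  proof (cases "\<exists>i\<in>F. -1 = i * i")
    case False
    have "-1 \<noteq> - (g * g * (f * f))" if f: "f \<in> F" for f
    proof
      assume "-1 = - (g * g * (f * f))"
      then have "(g * f) * (g * f) = 1" by (simp add: algebra_simps)
      then have "g * f = 1 \<or> g * f = - 1" by (simp add: square_eq_1_iff)
      moreover from this have "f \<noteq> 0" by auto
      ultimately have "g = 1 / f \<or> g = (- 1) / f" by (simp add: field_simps)
      moreover have "1 / f \<in> F" "(- 1) / f \<in> F" using SF(2,5,8) f by auto
      ultimately show False using gF by auto
    qed
    then have "(-1::'k) \<noteq> 0 \<and> (\<forall>f\<in>F. -1 \<noteq> f * f \<and> -1 \<noteq> - (g * g * (f * f)))" using False by auto
    then show ?thesis unfolding pq(3) using pq(1,2) by blast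
  next
    case True
    then obtain i where i: "i \<in> F" "-1 = i * i" by blast
    obtain x y \<pi> where xy: "x \<in> carrier ?G" "y \<in> carrier ?G" "G1_rels ?G x y" "generate ?G {x, y} = carrier ?G"
      and pi: "\<pi> \<in> hom ?G D8" "\<pi> x = (1, True)" "\<pi> y = (0, True)"
      by (rule ex_hom_D8_of_G1[OF iso])
    note R = G1_relations[OF xy(1-3)]
    have stab: "\<sigma> e \<in> E" if "\<sigma> \<in> carrier ?G" "e \<in> E" for \<sigma> e
      by (rule galois_ext_stable[OF E(2) sfL E(1) that])
    \<comment> \<open>The restriction of \<open>y\<close> has order at most 2 in a cyclic group of
      order 4, hence fixes the quadratic subfield. This identifies \<open>x\<close> as the generator
      that moves \<open>g\<close>.\<close>
    have "restr E y \<in> carrier (Gal E F)"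
      by (rule restr_in_Gal[OF E.sfL sfL E(1) E.FL _ xy(2)]) (rule stab)
    moreover have "y (y e) = e" for e using R(4) by (metis Gal_mult Gal_one comp_apply id_apply)
    then have "restr E y \<circ> restr E y = id" using stab[OF xy(2)] by (auto simp: restr_def)
    ultimately have "restr E y g = g" by (rule E.C4_imp_minus_one_norm(2)[OF E(4)])
    then have yg: "y g = g" using E(3) by (simp add: restr_def)
    have xg: "x g = - g"
    proof (rule ccontr)
      assume "x g \<noteq> - g"
      then have xg: "x g = g" using Gal_g[OF xy(1)] by blast
      have "\<sigma> g = g" if "\<sigma> \<in> carrier ?G" for \<sigma>
      proof -
        have "\<sigma> \<in> generate ?G {x, y}" using xy(4) that by simp
        then show ?thesis
        proof (induction rule: generate.induct)
          case (inv h)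
          then have "h \<in> carrier ?G" "h g = g" using xy xg yg by auto
          then show ?case using Gal_inv_apply(1)[OF sfL FL, of h g] by simp
        qed (use xg yg in auto)
      qed
      then show False using ex_Gal_moves_g minus_g by metis
    qed
    have fin: "finite (carrier (Gal L (adjoin F {g})))"
      by (rule finite_subset[OF Gal_mono[OF adjoin_superset(1)] G1_finite[OF xy]])
    have S: "{x, y} \<subseteq> carrier ?G" using xy by simp
    have par: "h g = g \<longleftrightarrow> even (fst (\<pi> h))" if "h \<in> carrier ?G" for h
      by (rule parity_of_generators[OF xy(4) S pi(1) _ that]) (auto simp: xg yg pi)
    obtain d u v where d: "d \<in> L" "d \<noteq> 0" "u \<in> F" "v \<in> F" "d * d = u * u - g * g * (v * v)" "x d = d"
      and dh: "\<And>h. h \<in> carrier ?G \<Longrightarrow> h g = g \<Longrightarrow> h d = (if snd (\<pi> h) then - d else d)"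
      using norm_from_D8[OF xy(1) xg fin pi(1,2) par] by blast
    have yd: "y d = - d" using dh[OF xy(2) yg] pi by simp
    have dF: "d * d \<in> F" unfolding d(5) using d g2 SF(4,7) by auto
    note n = nonsquare_from_automorphisms[OF d(1) dF d(2) xy(2) yg yd xy(1) xg d(6)]
    have "d * d \<noteq> - (g * g * (f * f))" if "f \<in> F" for f
    proof -
      have "- (g * g * (f * f)) = (i * i) * (g * g * (f * f))" unfolding i(2)[symmetric] by simp
      also have "\<dots> = g * g * ((i * f) * (i * f))" by (simp add: algebra_simps)
      finally show ?thesis using n(2)[of "i * f"] SF(4)[OF i(1) that] by simp
    qed
    then show ?thesis using n(1) d by (intro bexI[of _ u] bexI[of _ v]) auto
  qed
qed

end

section \<open>Constructing the extensions\<close>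

text \<open>Signs are encoded by bits so that multiplying them becomes exclusive or.\<close>

definition sg :: "bool \<Rightarrow> 'k::field \<Rightarrow> 'k" where
  "sg b x = (if b then - x else x)"

lemma sg_simps [simp]: "sg True x = - x" "sg False x = x"
  by (simp_all add: sg_def)

lemma sg_sg: "sg a (sg b x) = sg (a \<noteq> b) x"
  by (simp add: sg_def)

lemma sg_mult: "sg a x * sg b y = sg (a \<noteq> b) (x * y)"
  by (simp add: sg_def)

lemma ex_sg: "x * x = y * y \<Longrightarrow> \<exists>b. x = sg b y"
  unfolding sg_def square_eq_iff by (metis (full_types))

lemma adjoin_I: "x \<in> M \<Longrightarrow> x \<in> adjoin M S" "x \<in> S \<Longrightarrow> x \<in> adjoin M S"
  using adjoin_superset by blast+

lemma adjoin_stable: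
  assumes s: "\<sigma> \<in> Aut F" and S: "\<And>d. d \<in> S \<Longrightarrow> \<sigma> d \<in> adjoin F S" and x: "x \<in> adjoin F S"
  shows "\<sigma> x \<in> adjoin F S"
proof -
  note M = is_subfieldD[OF is_subfield_adjoin[of F S]]
  have "is_subfield {x. \<sigma> x \<in> adjoin F S}"
    unfolding is_subfield_def using M by (simp add: AutD[OF s])
  moreover have "F \<subseteq> {x. \<sigma> x \<in> adjoin F S}" using AutD(3)[OF s] adjoin_I(1) by (metis mem_Collect_eq subsetI)
  ultimately have "adjoin F S \<subseteq> {x. \<sigma> x \<in> adjoin F S}" using S by (intro adjoin_least) auto
  then show ?thesis using x by blast
qed

lemma Gal_adjoin_eqI:
  assumes s: "\<sigma> \<in> carrier (Gal (adjoin F S) F)" and t: "\<tau> \<in> carrier (Gal (adjoin F S) F)"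
    and eq: "\<And>d. d \<in> S \<Longrightarrow> \<sigma> d = \<tau> d"
  shows "\<sigma> = \<tau>"
proof
  note L = is_subfield_adjoin[of F S]
  note M = is_subfieldD[OF L]
  fix x
  have "is_subfield {x \<in> adjoin F S. \<sigma> x = \<tau> x}"
    unfolding is_subfield_def using M by (simp add: GalD[OF L s] GalD[OF L t])
  moreover have "F \<subseteq> {x \<in> adjoin F S. \<sigma> x = \<tau> x}"
    using GalD(4)[OF L s] GalD(4)[OF L t] adjoin_superset(1)[where F = F and S = S] by auto
  ultimately have "adjoin F S \<subseteq> {x \<in> adjoin F S. \<sigma> x = \<tau> x}"
    using eq adjoin_superset(2)[where F = F and S = S] by (intro adjoin_least) auto
  then show "\<sigma> x = \<tau> x" using GalD(13)[OF L s, of x] GalD(13)[OF L t, of x] by (cases "x \<in> adjoin F S") auto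
qed

section \<open>The field generated by a fourth root and the products of the
  \<open>s_k\<close>\<close>

locale root4 =
  fixes F :: "'k::field set" and i r s0 s1 s2 s3 :: 'k
  assumes ac: "is_algebraic_closure_of F" and two: "(2::'k) \<noteq> 0" and i2: "i * i = -1"
    and aF: "(r * r) * (r * r) \<in> F" and gF: "r * r \<notin> F"
    and s0: "s0 * s0 = 1 + r" and s1: "s1 * s1 = 1 + i * r" and s2: "s2 * s2 = 1 - r" and s3: "s3 * s3 = 1 - i * r"
begin

definition g where "g = r * r"
definition u01 where "u01 = s0 * s1"
definition u02 where "u02 = s0 * s2"
definition u03 where "u03 = s0 * s3"
definition u12 where "u12 = s1 * s2"
definition u13 where "u13 = s1 * s3"
definition u23 where "u23 = s2 * s3"
text \<open>\<open>g = r^2\<close> is listed because the tower of square roots passes through it: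
  \<open>g^2\<close> is in \<open>F\<close>, but \<open>r^2\<close> is not.\<close>

definition L where "L = adjoin F {i, g, r, u01, u02, u03, u12, u13, u23}"

lemmas u_defs = u01_def u02_def u03_def u12_def u13_def u23_def

lemma sfF: "is_subfield F" using ac unfolding is_algebraic_closure_of_def by simp
lemma sfL: "is_subfield L" unfolding L_def by (rule is_subfield_adjoin)
lemma FL: "F \<subseteq> L" unfolding L_def by (rule adjoin_superset)

lemmas SF = is_subfieldD[OF sfF]
lemmas SL = is_subfieldD[OF sfL]

lemma in_L [simp]: "i \<in> L" "g \<in> L" "r \<in> L" "u01 \<in> L" "u02 \<in> L" "u03 \<in> L" "u12 \<in> L" "u13 \<in> L" "u23 \<in> L"
  unfolding L_def by (simp_all add: adjoin_I)

lemma g2: "g * g \<in> F" and gnF: "g \<notin> F"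
  using aF gF by (simp_all add: g_def)

lemma r0 [simp]: "r \<noteq> 0" and i0 [simp]: "i \<noteq> 0" and g0 [simp]: "g \<noteq> 0"
  using gF SF(1) i2 by (auto simp: g_def)

lemma sqs:
  "u01 * u01 = (1 + r) * (1 + i * r)" "u02 * u02 = 1 - g" "u03 * u03 = (1 + r) * (1 - i * r)"
  "u12 * u12 = (1 + i * r) * (1 - r)" "u13 * u13 = 1 + g" "u23 * u23 = (1 - r) * (1 - i * r)"
proof -
  have e: "(x * y) * (x * y) = (x * x) * (y * y)" for x y :: 'k by (simp add: algebra_simps)
  have i2': "i * (i * x) = - x" for x using i2 by (metis mult.assoc mult_minus1)
  show "u01 * u01 = (1 + r) * (1 + i * r)" "u03 * u03 = (1 + r) * (1 - i * r)"
    "u12 * u12 = (1 + i * r) * (1 - r)" "u23 * u23 = (1 - r) * (1 - i * r)"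
    unfolding u_defs e s0 s1 s2 s3 by simp_all
  show "u02 * u02 = 1 - g" "u13 * u13 = 1 + g"
    unfolding u_defs e s0 s1 s2 s3 g_def by (simp_all add: algebra_simps i2')
qed

lemma prod_eq: "u02 * u13 = u01 * u23" "u03 * u12 = u01 * u23"
  by (simp_all add: u_defs)

text \<open>The four radicands \<open>1 + i^k r\<close> multiply to \<open>1 - r^4\<close>, so
  \<open>u01 * u23\<close> is the square root of the norm called \<open>b\<close> in the
  overview.\<close>

lemma sqb: "(u01 * u23) * (u01 * u23) = 1 - g * g"
proof -
  have "(u01 * u23) * (u01 * u23) = (u02 * u02) * (u13 * u13)"
    unfolding prod_eq(1)[symmetric] by (simp add: algebra_simps)
  then show ?thesis unfolding sqs by (simp add: algebra_simps)
qed

lemma b0: "1 - g * g \<noteq> 0"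
proof
  assume "1 - g * g = 0"
  then have "g = 1 \<or> g = -1" by (simp add: square_eq_1_iff)
  then show False using gnF SF(2,5) by auto
qed

lemma u0 [simp]: "u01 \<noteq> 0" "u02 \<noteq> 0" "u03 \<noteq> 0" "u12 \<noteq> 0" "u13 \<noteq> 0" "u23 \<noteq> 0"
proof -
  have "u01 * u23 \<noteq> 0" using sqb b0 by auto
  then have "s0 \<noteq> 0" "s1 \<noteq> 0" "s2 \<noteq> 0" "s3 \<noteq> 0" by (auto simp: u_defs)
  then show "u01 \<noteq> 0" "u02 \<noteq> 0" "u03 \<noteq> 0" "u12 \<noteq> 0" "u13 \<noteq> 0" "u23 \<noteq> 0" by (simp_all add: u_defs)
qed

lemma tower: "sqrt_tower F [i, g, r, u01, u02, u03, u12, u13, u23]"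
proof -
  have sq: "u01 * u01 \<in> M" "u02 * u02 \<in> M" "u03 * u03 \<in> M" "u12 * u12 \<in> M" "u13 * u13 \<in> M" "u23 * u23 \<in> M"
    if M: "is_subfield M" "i \<in> M" "r \<in> M" for M
    unfolding sqs g_def by (intro is_subfieldD(2-4,7)[OF M(1)] M)+
  show ?thesis
    by (simp add: i2 SF(2,5) g2 adjoin_I g_def[symmetric] sq is_subfield_adjoin)
qed

lemma Aut_i: "\<sigma> \<in> Aut F \<Longrightarrow> \<sigma> i = i \<or> \<sigma> i = - i"
proof -
  assume s: "\<sigma> \<in> Aut F"
  have "\<sigma> i * \<sigma> i = i * i" using AutD(2)[OF s, of i i] AutD(5,6)[OF s] i2 by simp
  then show ?thesis by (simp add: square_eq_iff)
qed

lemma Aut_r: "\<sigma> \<in> Aut F \<Longrightarrow> \<sigma> r \<in> {r, i * r, - r, - (i * r)}"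
proof -
  assume s: "\<sigma> \<in> Aut F"
  have "\<sigma> g * \<sigma> g = g * g" using AutD(2)[OF s, of g g] AutD(3)[OF s g2] by simp
  then have "\<sigma> g = g \<or> \<sigma> g = - g" by (simp add: square_eq_iff)
  moreover have "\<sigma> g = \<sigma> r * \<sigma> r" unfolding g_def by (rule AutD(2)[OF s])
  moreover have "- g = (i * r) * (i * r)" unfolding g_def using i2 by (metis mult.assoc mult.left_commute mult_minus1)
  ultimately have "\<sigma> r * \<sigma> r = r * r \<or> \<sigma> r * \<sigma> r = (i * r) * (i * r)" by (simp add: g_def)
  then show ?thesis by (auto simp: square_eq_iff)
qed

text \<open>Sending \<open>i\<close> to \<open>i\<close> or \<open>- i\<close> and \<open>r\<close>
  to some \<open>i^j r\<close> permutes the four radicands, so the \<open>s_k\<close> are permuted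
  up to sign.\<close>

lemma Aut_s:
  assumes s: "\<sigma> \<in> Aut F" and x: "x \<in> {s0, s1, s2, s3}"
  shows "\<exists>b. \<exists>y\<in>{s0, s1, s2, s3}. \<sigma> x = sg b y"
proof -
  note D = AutD[OF s]
  have i2': "i * (i * x) = - x" for x using i2 by (metis mult.assoc mult_minus1)
  have sq: "\<sigma> x * \<sigma> x = \<sigma> (x * x)" by (simp add: D)
  have "\<sigma> y \<in> {1 + r, 1 + i * r, 1 - r, 1 - i * r}" if "y \<in> {1 + r, 1 + i * r, 1 - r, 1 - i * r}" for y
    using that Aut_i[OF s] Aut_r[OF s] by (auto simp: D i2')
  moreover have "x * x \<in> {1 + r, 1 + i * r, 1 - r, 1 - i * r}" using x s0 s1 s2 s3 by auto
  ultimately have "\<sigma> (x * x) \<in> {1 + r, 1 + i * r, 1 - r, 1 - i * r}" by blast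
  then have "\<exists>y\<in>{s0, s1, s2, s3}. \<sigma> x * \<sigma> x = y * y" unfolding sq s0[symmetric] s1[symmetric] s2[symmetric] s3[symmetric] by auto
  then show ?thesis using ex_sg by blast
qed

lemma ss_in_L:
  assumes "x \<in> {s0, s1, s2, s3}" "y \<in> {s0, s1, s2, s3}"
  shows "x * y \<in> L"
proof -
  have sq: "s0 * s0 \<in> L" "s1 * s1 \<in> L" "s2 * s2 \<in> L" "s3 * s3 \<in> L"
    unfolding s0 s1 s2 s3 by (intro SL(2-4,7) in_L)+
  have "s0 * s1 \<in> L" "s0 * s2 \<in> L" "s0 * s3 \<in> L" "s1 * s2 \<in> L" "s1 * s3 \<in> L" "s2 * s3 \<in> L"
    using in_L(4-) unfolding u_defs by simp_all
  then show ?thesis using assms sq by (auto simp: mult.commute)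
qed

lemma stable:
  assumes s: "\<sigma> \<in> Aut F" and x: "x \<in> L"
  shows "\<sigma> x \<in> L"
proof -
  note D = AutD[OF s]
  have r: "\<sigma> r \<in> L" using Aut_r[OF s] SL(4,5) by auto
  have ss: "\<sigma> (x * y) \<in> L" if xy: "x \<in> {s0, s1, s2, s3}" "y \<in> {s0, s1, s2, s3}" for x y
  proof -
    obtain b x' where x': "x' \<in> {s0, s1, s2, s3}" "\<sigma> x = sg b x'" using Aut_s[OF s xy(1)] by blast
    obtain c y' where y': "y' \<in> {s0, s1, s2, s3}" "\<sigma> y = sg c y'" using Aut_s[OF s xy(2)] by blast
    have "\<sigma> (x * y) = sg (b \<noteq> c) (x' * y')" using x' y' by (simp add: D sg_mult)
    then show ?thesis using ss_in_L[OF x'(1) y'(1)] SL(5) by (simp add: sg_def)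
  qed
  have "\<sigma> u01 \<in> L" "\<sigma> u02 \<in> L" "\<sigma> u03 \<in> L" "\<sigma> u12 \<in> L" "\<sigma> u13 \<in> L" "\<sigma> u23 \<in> L"
    unfolding u_defs by (rule ss; simp)+
  moreover have "\<sigma> i \<in> L" using Aut_i[OF s] SL(5)[OF in_L(1)] in_L(1) by metis
  moreover have "\<sigma> g \<in> L" unfolding g_def D(2) using r SL(4) by blast
  ultimately have "\<sigma> d \<in> L" if "d \<in> {i, g, r, u01, u02, u03, u12, u13, u23}" for d
    using that r by (elim insertE) (simp_all only: empty_iff)
  then show ?thesis using adjoin_stable[OF s _ x[unfolded L_def]] unfolding L_def by blast
qed

lemma galois_L: "galois_ext F L"
proof (rule galois_ext_if_stable[OF ac sfL FL])
  show "\<sigma> x \<in> L" if "\<sigma> \<in> Aut F" "x \<in> L" for \<sigma> x using that by (rule stable)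
  show "x \<in> F" if "x \<in> L" "\<And>\<sigma>. \<sigma> \<in> Aut F \<Longrightarrow> \<sigma> x = x" for x
    using sqrt_tower_fixed[OF ac two tower] that unfolding L_def by simp
qed

sublocale sqrt_ext F L g
  by unfold_locales (use ac galois_L two gnF g2 in auto)

lemma restr_L: "\<sigma> \<in> Aut F \<Longrightarrow> restr L \<sigma> \<in> carrier (Gal L F)"
  by (rule restr_in_Gal[OF sfL is_subfield_UNIV _ FL]) (auto intro: stable)

section \<open>Automorphisms of L as signed permutations modulo a global sign\<close>

definition acts where
  "acts \<sigma> i' r' v01 v02 v03 v12 v13 v23 \<longleftrightarrow> \<sigma> \<in> carrier (Gal L F) \<and> \<sigma> i = i' \<and> \<sigma> r = r' \<and>
    \<sigma> u01 = v01 \<and> \<sigma> u02 = v02 \<and> \<sigma> u03 = v03 \<and> \<sigma> u12 = v12 \<and> \<sigma> u13 = v13 \<and> \<sigma> u23 = v23"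

lemma actsD:
  assumes "acts \<sigma> i' r' v01 v02 v03 v12 v13 v23"
  shows "\<sigma> \<in> carrier (Gal L F)" "\<sigma> i = i'" "\<sigma> r = r'"
    "\<sigma> u01 = v01" "\<sigma> u02 = v02" "\<sigma> u03 = v03" "\<sigma> u12 = v12" "\<sigma> u13 = v13" "\<sigma> u23 = v23"
  using assms unfolding acts_def by auto

lemma acts_unique:
  assumes "acts \<sigma> i' r' v01 v02 v03 v12 v13 v23" "acts \<tau> i' r' v01 v02 v03 v12 v13 v23"
  shows "\<sigma> = \<tau>"
proof -
  note A = actsD[OF assms(1)] and B = actsD[OF assms(2)]
  have "\<sigma> g = \<tau> g" unfolding g_def using GalD(3)[OF sfL A(1)] GalD(3)[OF sfL B(1)] A(3) B(3) by simp
  then show ?thesis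
    by (intro Gal_adjoin_eqI[OF A(1)[unfolded L_def] B(1)[unfolded L_def]]) (use A B in auto)
qed

lemma Gal_simps:
  assumes "\<sigma> \<in> carrier (Gal L F)"
  shows "x \<in> L \<Longrightarrow> y \<in> L \<Longrightarrow> \<sigma> (x * y) = \<sigma> x * \<sigma> y" "x \<in> L \<Longrightarrow> \<sigma> (- x) = - \<sigma> x" "x \<in> L \<Longrightarrow> \<sigma> (sg b x) = sg b (\<sigma> x)"
  using GalD(3,7)[OF sfL assms] by (auto simp: sg_def)

lemma mult_in_L [simp]: "x \<in> L \<Longrightarrow> y \<in> L \<Longrightarrow> x * y \<in> L" and minus_in_L [simp]: "x \<in> L \<Longrightarrow> - x \<in> L"
  by (erule (1) SL(4), erule SL(5))

lemma ii [simp]: "i * (i * x) = - x"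
  using i2 by (metis mult.assoc mult_minus1)

text \<open>The \<open>s_k\<close> need not lie in \<open>L\<close>, so \<open>\<sigma>\<close> is
  first extended to the closure. The extension determines the four bits, of which only the
  differences are visible on \<open>L\<close>.\<close>

lemma Gal_on_s:
  assumes s: "\<sigma> \<in> carrier (Gal L F)"
    and t: "t0 * t0 = 1 + \<sigma> r" "t1 * t1 = 1 + \<sigma> i * \<sigma> r" "t2 * t2 = 1 - \<sigma> r" "t3 * t3 = 1 - \<sigma> i * \<sigma> r"
  shows "\<exists>b0 b1 b2 b3 :: bool. acts \<sigma> (\<sigma> i) (\<sigma> r) (sg (b0 \<noteq> b1) (t0 * t1)) (sg (b0 \<noteq> b2) (t0 * t2)) (sg (b0 \<noteq> b3) (t0 * t3))
    (sg (b1 \<noteq> b2) (t1 * t2)) (sg (b1 \<noteq> b3) (t1 * t3)) (sg (b2 \<noteq> b3) (t2 * t3))"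
proof -
  obtain \<tau> where tau: "\<tau> \<in> Aut F" and ext: "\<And>x. x \<in> L \<Longrightarrow> \<tau> x = \<sigma> x" using Gal_extend[OF ac sfL FL s] by blast
  note D = AutD[OF tau]
  have ir: "\<tau> i = \<sigma> i" "\<tau> r = \<sigma> r" using ext by simp_all
  have "\<tau> s0 * \<tau> s0 = t0 * t0" "\<tau> s1 * \<tau> s1 = t1 * t1" "\<tau> s2 * \<tau> s2 = t2 * t2" "\<tau> s3 * \<tau> s3 = t3 * t3"
    unfolding D(2)[symmetric] s0 s1 s2 s3 t by (simp_all add: D ir)
  then obtain b0 b1 b2 b3 where b: "\<tau> s0 = sg b0 t0" "\<tau> s1 = sg b1 t1" "\<tau> s2 = sg b2 t2" "\<tau> s3 = sg b3 t3"
    using ex_sg by metis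
  have "\<sigma> u01 = sg (b0 \<noteq> b1) (t0 * t1)" "\<sigma> u02 = sg (b0 \<noteq> b2) (t0 * t2)" "\<sigma> u03 = sg (b0 \<noteq> b3) (t0 * t3)"
    "\<sigma> u12 = sg (b1 \<noteq> b2) (t1 * t2)" "\<sigma> u13 = sg (b1 \<noteq> b3) (t1 * t3)" "\<sigma> u23 = sg (b2 \<noteq> b3) (t2 * t3)"
    by (subst ext[symmetric], simp, simp add: u_defs D b sg_mult)+
  then have "acts \<sigma> (\<sigma> i) (\<sigma> r) (sg (b0 \<noteq> b1) (t0 * t1)) (sg (b0 \<noteq> b2) (t0 * t2)) (sg (b0 \<noteq> b3) (t0 * t3))
    (sg (b1 \<noteq> b2) (t1 * t2)) (sg (b1 \<noteq> b3) (t1 * t3)) (sg (b2 \<noteq> b3) (t2 * t3))"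
    unfolding acts_def using s by simp
  then show ?thesis by blast
qed

text \<open>\<open>\<sigma>\<close> fixes \<open>i\<close> and \<open>r\<close> and changes the sign of \<open>s\<^sub>k\<close> iff \<open>b\<^sub>k\<close>; since \<open>s\<^sub>k\<close> itself need not lie in \<open>L\<close>,
  this is determined only up to negating all four \<open>b\<^sub>k\<close>.\<close>
definition pattern :: "('k \<Rightarrow> 'k) \<Rightarrow> bool \<Rightarrow> bool \<Rightarrow> bool \<Rightarrow> bool \<Rightarrow> bool" where
  "pattern \<sigma> b0 b1 b2 b3 \<longleftrightarrow> acts \<sigma> i r (sg (b0 \<noteq> b1) u01) (sg (b0 \<noteq> b2) u02) (sg (b0 \<noteq> b3) u03)
    (sg (b1 \<noteq> b2) u12) (sg (b1 \<noteq> b3) u13) (sg (b2 \<noteq> b3) u23)"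

lemma ex_pattern:
  assumes "\<sigma> \<in> carrier (Gal L F)" "\<sigma> i = i" "\<sigma> r = r"
  shows "\<exists>b0 b1 b2 b3. pattern \<sigma> b0 b1 b2 b3"
  using Gal_on_s[OF assms(1), of s0 s1 s2 s3] assms s0 s1 s2 s3 unfolding pattern_def by (simp add: u_defs)

text \<open>On the square with vertices \<open>s0\<close>, \<open>s1\<close>, \<open>s2\<close>,
  \<open>s3\<close> the map \<open>r\<close> to \<open>i r\<close> is the rotation to the next
  vertex. Negating \<open>i\<close> in addition gives the reflection exchanging \<open>s0\<close>
  with \<open>s1\<close> and \<open>s2\<close> with \<open>s3\<close>; negating \<open>i\<close>
  alone exchanges \<open>s1\<close> with \<open>s3\<close>.\<close>

lemma type_rotation:
  assumes "\<sigma> \<in> carrier (Gal L F)" "\<sigma> i = i" "\<sigma> r = i * r"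
  shows "\<exists>b0 b1 b2 b3 :: bool. acts \<sigma> i (i * r) (sg (b0 \<noteq> b1) u12) (sg (b0 \<noteq> b2) u13) (sg (b0 \<noteq> b3) u01)
    (sg (b1 \<noteq> b2) u23) (sg (b1 \<noteq> b3) u02) (sg (b2 \<noteq> b3) u03)"
  using Gal_on_s[OF assms(1), of s1 s2 s3 s0] assms s0 s1 s2 s3 by (simp add: u_defs mult.commute)

lemma type_edge_reflection:
  assumes "\<sigma> \<in> carrier (Gal L F)" "\<sigma> i = - i" "\<sigma> r = i * r"
  shows "\<exists>b0 b1 b2 b3 :: bool. acts \<sigma> (- i) (i * r) (sg (b0 \<noteq> b1) u01) (sg (b0 \<noteq> b2) u13) (sg (b0 \<noteq> b3) u12)
    (sg (b1 \<noteq> b2) u03) (sg (b1 \<noteq> b3) u02) (sg (b2 \<noteq> b3) u23)"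
  using Gal_on_s[OF assms(1), of s1 s0 s3 s2] assms s0 s1 s2 s3 by (simp add: u_defs mult.commute)

lemma type_vertex_reflection:
  assumes "\<sigma> \<in> carrier (Gal L F)" "\<sigma> i = - i" "\<sigma> r = r"
  shows "\<exists>b0 b1 b2 b3 :: bool. acts \<sigma> (- i) r (sg (b0 \<noteq> b1) u03) (sg (b0 \<noteq> b2) u02) (sg (b0 \<noteq> b3) u01)
    (sg (b1 \<noteq> b2) u23) (sg (b1 \<noteq> b3) u13) (sg (b2 \<noteq> b3) u12)"
  using Gal_on_s[OF assms(1), of s0 s3 s2 s1] assms s0 s1 s2 s3 by (simp add: u_defs mult.commute)

text \<open>Serves to replace the unknown signs \<open>b_k\<close> of a lift by wanted signs
  \<open>c_k\<close>, provided their difference is an available pattern.\<close>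

lemma acts_comp_pattern:
  fixes b0 b1 b2 b3 c0 c1 c2 c3 :: bool
  assumes s: "acts \<sigma> i' r' (sg (b0 \<noteq> b1) v01) (sg (b0 \<noteq> b2) v02) (sg (b0 \<noteq> b3) v03)
      (sg (b1 \<noteq> b2) v12) (sg (b1 \<noteq> b3) v13) (sg (b2 \<noteq> b3) v23)"
    and p: "pattern \<tau> (b0 \<noteq> c0) (b1 \<noteq> c1) (b2 \<noteq> c2) (b3 \<noteq> c3)"
  shows "acts (\<sigma> \<circ> \<tau>) i' r' (sg (c0 \<noteq> c1) v01) (sg (c0 \<noteq> c2) v02) (sg (c0 \<noteq> c3) v03)
      (sg (c1 \<noteq> c2) v12) (sg (c1 \<noteq> c3) v13) (sg (c2 \<noteq> c3) v23)"
proof -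
  note A = actsD[OF s] and B = actsD[OF p[unfolded pattern_def]]
  show ?thesis unfolding acts_def
    by (simp add: A B Gal_comp Gal_simps[OF A(1)] sg_sg) (intro conjI arg_cong2[where f = sg] refl; blast)
qed

text \<open>Conjugation by the rotation carries a sign change to the next vertex; the unknown signs
  of \<open>\<rho>\<close> cancel in the conjugate.\<close>

lemma pattern_shift:
  assumes \<rho>: "\<rho> \<in> carrier (Gal L F)" "\<rho> i = i" "\<rho> r = i * r"
    and H: "subgroup H (Gal L F)" "\<rho> \<in> H" and p: "\<sigma> \<in> H" "pattern \<sigma> b0 b1 b2 b3"
  shows "\<exists>\<tau>\<in>H. pattern \<tau> b3 b0 b1 b2"
proof -
  let ?\<rho>' = "inv\<^bsub>Gal L F\<^esub> \<rho>"
  obtain c0 c1 c2 c3 :: bool where c: "acts \<rho> i (i * r) (sg (c0 \<noteq> c1) u12) (sg (c0 \<noteq> c2) u13) (sg (c0 \<noteq> c3) u01)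
    (sg (c1 \<noteq> c2) u23) (sg (c1 \<noteq> c3) u02) (sg (c2 \<noteq> c3) u03)"
    using type_rotation[OF \<rho>] by blast
  note A = actsD[OF c] and B = actsD[OF p(2)[unfolded pattern_def]]
  have \<rho>': "?\<rho>' \<in> carrier (Gal L F)" using \<rho> by simp
  define \<tau> where "\<tau> = \<rho> \<circ> (\<sigma> \<circ> ?\<rho>')"
  have tH: "\<tau> \<in> H"
    using subgroup.m_closed[OF H(1) H(2) subgroup.m_closed[OF H(1) p(1) subgroup.m_inv_closed[OF H]]]
    unfolding \<tau>_def Gal_mult .
  then have tG: "\<tau> \<in> carrier (Gal L F)" using subgroup.mem_carrier[OF H(1)] by blast
  have \<tau>\<rho>: "\<tau> (\<rho> x) = \<rho> (\<sigma> x)" for x unfolding \<tau>_def using Gal_inv_apply(1)[OF sfL FL \<rho>(1)] by simp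
  have eig: "\<tau> v = sg p v" if "v \<in> L" "x \<in> L" "\<rho> x = sg q v" "\<sigma> x = sg p x" for v x p q
  proof -
    have "\<tau> (sg q v) = sg p (sg q v)" using \<tau>\<rho>[of x] that Gal_simps(3)[OF \<rho>(1)] by simp
    then have "sg q (\<tau> v) = sg q (sg p v)" using Gal_simps(3)[OF tG that(1)] by (simp add: sg_def)
    then show ?thesis by (simp add: sg_def split: if_splits)
  qed
  have ti: "\<tau> i = i" using \<tau>\<rho>[of i] A(2) B(2) by simp
  have "\<tau> (i * r) = i * r" using \<tau>\<rho>[of r] A(3) B(3) by simp
  then have tr: "\<tau> r = r" using Gal_simps(1)[OF tG, of i r] ti by simp
  have "pattern \<tau> b3 b0 b1 b2" unfolding pattern_def acts_def
    using tG ti tr eig[OF _ _ A(4) B(4)] eig[OF _ _ A(5) B(5)] eig[OF _ _ A(6) B(6)]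
      eig[OF _ _ A(7) B(7)] eig[OF _ _ A(8) B(8)] eig[OF _ _ A(9) B(9)] by (auto simp: eq_commute)
  then show ?thesis using tH by blast
qed

lemma pattern_comp:
  assumes H: "subgroup H (Gal L F)" and "\<sigma> \<in> H" "pattern \<sigma> b0 b1 b2 b3" "\<tau> \<in> H" "pattern \<tau> c0 c1 c2 c3"
  shows "\<exists>\<rho>\<in>H. pattern \<rho> (b0 \<noteq> c0) (b1 \<noteq> c1) (b2 \<noteq> c2) (b3 \<noteq> c3)"
proof (rule bexI)
  have x: "(p \<noteq> (p \<noteq> q)) = q" for p q :: bool by blast
  show "pattern (\<sigma> \<circ> \<tau>) (b0 \<noteq> c0) (b1 \<noteq> c1) (b2 \<noteq> c2) (b3 \<noteq> c3)"
    using acts_comp_pattern[OF assms(3)[unfolded pattern_def], of \<tau> "b0 \<noteq> c0" "b1 \<noteq> c1" "b2 \<noteq> c2" "b3 \<noteq> c3"] assms(5)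
    unfolding x pattern_def[symmetric] by blast
  show "\<sigma> \<circ> \<tau> \<in> H" using subgroup.m_closed[OF H assms(2,4)] by simp
qed

lemma pattern_negate: "pattern \<sigma> b0 b1 b2 b3 \<Longrightarrow> pattern \<sigma> (\<not> b0) (\<not> b1) (\<not> b2) (\<not> b3)"
  unfolding pattern_def by simp

text \<open>Up to the global sign an odd pattern negates a single \<open>s_k\<close>, and its
  rotations form a basis of all sign vectors.\<close>

lemma all_patterns:
  assumes \<rho>: "\<rho> i = i" "\<rho> r = i * r"
    and H: "subgroup H (Gal L F)" "\<rho> \<in> H" and p: "\<sigma> \<in> H" "pattern \<sigma> b0 b1 b2 b3"
    and odd: "((b0 \<noteq> b1) \<noteq> b2) \<noteq> b3"
  shows "\<exists>\<tau>\<in>H. pattern \<tau> c0 c1 c2 c3"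
proof -
  have \<rho>G: "\<rho> \<in> carrier (Gal L F)" using subgroup.mem_carrier[OF H] .
  define P where "P = (\<lambda>c0 c1 c2 c3. \<exists>\<tau>\<in>H. pattern \<tau> c0 c1 c2 c3)"
  have shift: "P c3 c0 c1 c2" if "P c0 c1 c2 c3" for c0 c1 c2 c3
    using that pattern_shift[OF \<rho>G \<rho> H] unfolding P_def by blast
  have xor: "P (c0 \<noteq> d0) (c1 \<noteq> d1) (c2 \<noteq> d2) (c3 \<noteq> d3)" if "P c0 c1 c2 c3" "P d0 d1 d2 d3" for c0 c1 c2 c3 d0 d1 d2 d3
    using that pattern_comp[OF H(1)] unfolding P_def by blast
  have neg: "P (\<not> c0) (\<not> c1) (\<not> c2) (\<not> c3)" if "P c0 c1 c2 c3" for c0 c1 c2 c3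
    using that pattern_negate unfolding P_def by blast
  have "P b0 b1 b2 b3" unfolding P_def using p by blast
  then have "P True False False False \<or> P False True False False \<or> P False False True False \<or> P False False False True"
    using odd neg[of b0 b1 b2 b3] by (cases b0; cases b1; cases b2; cases b3) simp_all
  then have f0: "P True False False False" using shift by blast
  note f1 = shift[OF f0]
  note f2 = shift[OF f1]
  note f3 = shift[OF f2]
  have z: "P False False False False" using xor[OF f0 f0] by simp
  have a: "P c0 False False False" using f0 z by (cases c0) auto
  have b: "P c0 c1 False False" using a xor[OF a f1] by (cases c1) auto
  have c: "P c0 c1 c2 False" using b xor[OF b f2] by (cases c2) auto
  have "P c0 c1 c2 c3" using c xor[OF c f3] by (cases c3) auto
  then show ?thesis unfolding P_def .
qed

text \<open>The given pattern negates two neighbouring \<open>s_k\<close>; its rotations span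
  exactly the sign vectors of even weight.\<close>

lemma even_patterns:
  assumes \<rho>: "\<rho> i = i" "\<rho> r = i * r"
    and H: "subgroup H (Gal L F)" "\<rho> \<in> H" and p: "\<sigma> \<in> H" "pattern \<sigma> b0 b1 b2 b3"
    and even: "b0 \<noteq> b2" "b1 \<noteq> b3" and c: "\<not> (((c0 \<noteq> c1) \<noteq> c2) \<noteq> c3)"
  shows "\<exists>\<tau>\<in>H. pattern \<tau> c0 c1 c2 c3"
proof -
  have \<rho>G: "\<rho> \<in> carrier (Gal L F)" using subgroup.mem_carrier[OF H] .
  define P where "P = (\<lambda>c0 c1 c2 c3. \<exists>\<tau>\<in>H. pattern \<tau> c0 c1 c2 c3)"
  have shift: "P c3 c0 c1 c2" if "P c0 c1 c2 c3" for c0 c1 c2 c3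
    using that pattern_shift[OF \<rho>G \<rho> H] unfolding P_def by blast
  have xor: "P (c0 \<noteq> d0) (c1 \<noteq> d1) (c2 \<noteq> d2) (c3 \<noteq> d3)" if "P c0 c1 c2 c3" "P d0 d1 d2 d3" for c0 c1 c2 c3 d0 d1 d2 d3
    using that pattern_comp[OF H(1)] unfolding P_def by blast
  have neg: "P (\<not> c0) (\<not> c1) (\<not> c2) (\<not> c3)" if "P c0 c1 c2 c3" for c0 c1 c2 c3
    using that pattern_negate unfolding P_def by blast
  have "P b0 b1 b2 b3" unfolding P_def using p by blast
  then have "P True True False False \<or> P False True True False \<or> P False False True True \<or> P True False False True"
    using even by (cases b0; cases b1; cases b2; cases b3) simp_all
  then have f0: "P True True False False" using shift by blast
  note f1 = shift[OF f0]
  have f2: "P True False True False" using xor[OF f0 f1] by simp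
  have z: "P False False False False" using xor[OF f0 f0] by simp
  have "P c0 c1 c2 c3"
    using c f0 f1 f2 z neg[OF f0] neg[OF f1] neg[OF f2] neg[OF z]
    by (cases c0; cases c1; cases c2; cases c3) simp_all
  then show ?thesis unfolding P_def .
qed

text \<open>\<open>u01 * u23\<close> is the product of all four \<open>s_k\<close> and therefore
  sees the parity of the signs.\<close>

lemma pattern_b:
  assumes "pattern \<sigma> b0 b1 b2 b3"
  shows "\<sigma> (u01 * u23) = sg (((b0 \<noteq> b1) \<noteq> b2) \<noteq> b3) (u01 * u23)"
proof -
  note B = actsD[OF assms[unfolded pattern_def]]
  have x: "((b0 \<noteq> b1) \<noteq> (b2 \<noteq> b3)) = (((b0 \<noteq> b1) \<noteq> b2) \<noteq> b3)" by blast
  show ?thesis by (simp only: Gal_simps(1)[OF B(1)] in_L B sg_mult x)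
qed

text \<open>Modulo patterns an automorphism is determined by its effect on \<open>i\<close> and
  \<open>r\<close>. Powers of the rotation and, if \<open>i\<close> is not in \<open>F\<close>, one
  reflection realise all possible effects; dividing by a suitable element of \<open>H\<close> leaves
  a pattern, and these are in \<open>H\<close>.\<close>

lemma generated:
  assumes H: "subgroup H (Gal L F)" "\<rho> \<in> H" and \<rho>: "\<rho> i = i" "\<rho> r = i * r"
    and \<tau>: "i \<in> F \<or> (\<tau> \<in> H \<and> \<tau> i = - i \<and> \<tau> r = r)"
    and pat: "\<And>\<sigma> b0 b1 b2 b3. pattern \<sigma> b0 b1 b2 b3 \<Longrightarrow> \<exists>\<sigma>'\<in>H. pattern \<sigma>' b0 b1 b2 b3"
  shows "H = carrier (Gal L F)"
proof
  show "H \<subseteq> carrier (Gal L F)" by (rule subgroup.subset[OF H(1)])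
  have HG: "\<sigma> \<in> carrier (Gal L F)" if "\<sigma> \<in> H" for \<sigma> using subgroup.mem_carrier[OF H(1) that] .
  have comp: "\<sigma> \<circ> \<sigma>' \<in> H" if "\<sigma> \<in> H" "\<sigma>' \<in> H" for \<sigma> \<sigma>' using subgroup.m_closed[OF H(1) that] by simp
  note R = Gal_simps[OF HG[OF H(2)]]
  have fixing: "\<sigma> \<in> H" if s: "\<sigma> \<in> carrier (Gal L F)" "\<sigma> i = i" "\<sigma> r = r" for \<sigma>
  proof -
    obtain b0 b1 b2 b3 where p: "pattern \<sigma> b0 b1 b2 b3" using ex_pattern[OF s] by blast
    obtain \<sigma>' where "\<sigma>' \<in> H" "pattern \<sigma>' b0 b1 b2 b3" using pat[OF p] by blast
    then show ?thesis using p acts_unique unfolding pattern_def by metis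
  qed
  have same: "\<sigma> \<in> H" if s: "\<sigma> \<in> carrier (Gal L F)" and h: "h \<in> H" "h i = \<sigma> i" "h r = \<sigma> r" for \<sigma> h
  proof -
    let ?h' = "inv\<^bsub>Gal L F\<^esub> h"
    have h'H: "?h' \<in> H" using subgroup.m_inv_closed[OF H(1) h(1)] .
    have "?h' \<circ> \<sigma> \<in> H"
      using Gal_comp[OF HG[OF h'H] s] Gal_inv_apply(1)[OF sfL FL HG[OF h(1)], of i]
        Gal_inv_apply(1)[OF sfL FL HG[OF h(1)], of r] h by (intro fixing) simp_all
    then have "h \<circ> (?h' \<circ> \<sigma>) \<in> H" by (rule comp[OF h(1)])
    moreover have "h \<circ> (?h' \<circ> \<sigma>) = \<sigma>" using Gal_inv_apply(2)[OF sfL FL HG[OF h(1)]] by auto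
    ultimately show ?thesis by simp
  qed
  have rot: "\<sigma> \<in> H" if s: "\<sigma> \<in> carrier (Gal L F)" "\<sigma> i = i" "\<sigma> r \<in> {r, i * r, - r, - (i * r)}" for \<sigma>
  proof -
    have 2: "\<rho> \<circ> \<rho> \<in> H" "(\<rho> \<circ> \<rho>) i = i" "(\<rho> \<circ> \<rho>) r = - r" using comp H \<rho> R by simp_all
    have 3: "\<rho> \<circ> (\<rho> \<circ> \<rho>) \<in> H" "(\<rho> \<circ> (\<rho> \<circ> \<rho>)) i = i" "(\<rho> \<circ> (\<rho> \<circ> \<rho>)) r = - (i * r)"
      using comp[OF H(2) 2(1)] \<rho> R by simp_all
    show ?thesis using s(3) same[OF s(1) H(2)] fixing[OF s(1,2)] same[OF s(1) 2(1)] same[OF s(1) 3(1)] \<rho> 2 3 s(2) by auto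
  qed
  show "carrier (Gal L F) \<subseteq> H"
  proof
    fix \<sigma> assume s: "\<sigma> \<in> carrier (Gal L F)"
    obtain \<sigma>' where s': "\<sigma>' \<in> Aut F" "\<And>x. x \<in> L \<Longrightarrow> \<sigma>' x = \<sigma> x" using Gal_extend[OF ac sfL FL s] by blast
    have si: "\<sigma> i = i \<or> \<sigma> i = - i" and sr: "\<sigma> r \<in> {r, i * r, - r, - (i * r)}"
      using Aut_i[OF s'(1)] Aut_r[OF s'(1)] s'(2) by simp_all
    show "\<sigma> \<in> H"
    proof (cases "\<sigma> i = i")
      case True then show ?thesis using rot s sr by blast
    next
      case False
      then have si: "\<sigma> i = - i" using si by blast
      have "i \<notin> F" using False GalD(4)[OF sfL s] by blast
      then have t: "\<tau> \<in> H" "\<tau> i = - i" "\<tau> r = r" using \<tau> by auto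
      have "\<sigma> \<circ> \<tau> \<in> H"
        using Gal_comp[OF s HG[OF t(1)]] t si sr Gal_simps[OF s] by (intro rot) simp_all
      then have "(\<sigma> \<circ> \<tau>) \<circ> inv\<^bsub>Gal L F\<^esub> \<tau> \<in> H" by (rule comp[OF _ subgroup.m_inv_closed[OF H(1) t(1)]])
      moreover have "(\<sigma> \<circ> \<tau>) \<circ> inv\<^bsub>Gal L F\<^esub> \<tau> = \<sigma>" using Gal_inv_apply(2)[OF sfL FL HG[OF t(1)]] by auto
      ultimately show ?thesis by simp
    qed
  qed
qed

end

section \<open>Recognising the two presentations inside a Galois group\<close>

lemma (in group) G1_relsI:
  assumes xy: "x \<in> carrier G" "y \<in> carrier G" and x4: "x \<otimes> x \<otimes> (x \<otimes> x) = \<one>" and y2: "y \<otimes> y = \<one>"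
    and t: "t = x \<otimes> (x \<otimes> x) \<otimes> (y \<otimes> (x \<otimes> y))" "t \<otimes> t = \<one>"
    and c: "c = t \<otimes> (x \<otimes> (x \<otimes> x) \<otimes> (t \<otimes> x))" "c \<otimes> c = \<one>" "c \<otimes> x = x \<otimes> c" "c \<otimes> y = y \<otimes> c"
  shows "commutator G x y = t" "commutator G t x = c" "G1_rels G x y"
proof -
  have C: "t \<in> carrier G" "c \<in> carrier G" using t c xy by simp_all
  \<comment> \<open>With inverses written as cubes or as the elements themselves, all relations
    become equations between composites of maps, which can be checked on the generators of the
    field.\<close>
  have i: "inv x = x \<otimes> (x \<otimes> x)" "inv y = y" "inv t = t"
    by (rule inv_equality; use xy x4 y2 t(2) C in \<open>simp add: m_assoc\<close>)+
  show t': "commutator G x y = t" unfolding commutator_def i(1,2) t(1) using xy by (simp add: m_assoc)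
  show c': "commutator G t x = c" unfolding commutator_def i(1,3) c(1) using xy C by (simp add: m_assoc)
  show "G1_rels G x y" unfolding G1_rels_def Let_def t' c'
    using nat_pow_2_4[OF xy(1)] nat_pow_2_4[OF xy(2)] nat_pow_2_4[OF C(1)] nat_pow_2_4[OF C(2)] x4 y2 t(2) c(2-4) by simp
qed

lemma (in group) G2_relsI:
  assumes xyz: "x \<in> carrier G" "y \<in> carrier G" "z \<in> carrier G"
    and sq: "x \<otimes> x = \<one>" "y \<otimes> y = \<one>" "z \<otimes> z = \<one>" "y \<otimes> (z \<otimes> (y \<otimes> z)) = \<one>"
    and t: "t = x \<otimes> (y \<otimes> (x \<otimes> y))" "t \<otimes> t = \<one>" and s: "s = x \<otimes> (z \<otimes> (x \<otimes> z))" "s \<otimes> s = \<one>"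
    and w: "w = y \<otimes> (s \<otimes> (y \<otimes> s))" "w = z \<otimes> (t \<otimes> (z \<otimes> t))" "w \<otimes> w = \<one>"
      "w \<otimes> x = x \<otimes> w" "w \<otimes> y = y \<otimes> w" "w \<otimes> z = z \<otimes> w"
  shows "commutator G x y = t" "commutator G x z = s" "commutator G y s = w" "G2_rels G x y z"
proof -
  have C: "t \<in> carrier G" "s \<in> carrier G" "w \<in> carrier G" using t s w xyz by simp_all
  have i: "inv x = x" "inv y = y" "inv z = z" "inv t = t" "inv s = s"
    by (rule inv_equality; use xyz sq t(2) s(2) C in simp)+
  show t': "commutator G x y = t" unfolding commutator_def i t(1) using xyz by (simp add: m_assoc)
  show s': "commutator G x z = s" unfolding commutator_def i s(1) using xyz by (simp add: m_assoc)
  show w': "commutator G y s = w" unfolding commutator_def i w(1) using xyz C by (simp add: m_assoc)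
  have w'': "commutator G z t = w" unfolding commutator_def i w(2) using xyz C by (simp add: m_assoc)
  have yz: "commutator G y z = \<one>" unfolding commutator_def i using sq(4) xyz by (simp add: m_assoc)
  show "G2_rels G x y z" unfolding G2_rels_def Let_def t' s' w' w'' yz
    using nat_pow_2_4(1)[OF xyz(1)] nat_pow_2_4(1)[OF xyz(2)] nat_pow_2_4(1)[OF xyz(3)]
      nat_pow_2_4(1)[OF C(1)] nat_pow_2_4(1)[OF C(2)] nat_pow_2_4(1)[OF C(3)] sq t(2) s(2) w(3-6) by simp
qed

lemma sg_inject:
  fixes d :: "'k::field"
  assumes "(2::'k) \<noteq> 0" "d \<noteq> 0" "sg p d = sg q d"
  shows "p = q"
proof -
  have "- d \<noteq> d" using assms(1,2) by (metis add.inverse_inverse add_eq_0_iff mult_2 mult_eq_0_iff)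
  then show ?thesis using assms(3) by (auto simp: sg_def split: if_splits)
qed

context sqrt_ext
begin

lemma opt_apply: "opt b \<sigma> x = (if b then \<sigma> x else x)"
  unfolding opt_def Gal_one by simp

lemma Gal_sg: "\<sigma> \<in> carrier (Gal L F) \<Longrightarrow> d \<in> L \<Longrightarrow> \<sigma> (sg b d) = sg b (\<sigma> d)"
  using GalD(7)[OF sfL] by (simp add: sg_def)

lemma opt_flip: "\<sigma> d = - d \<Longrightarrow> opt b \<sigma> d = sg b d"
  by (simp add: opt_apply sg_def)

lemma opt_fix: "\<sigma> d = d \<Longrightarrow> opt b \<sigma> d = d"
  by (simp add: opt_apply)

lemma opt_Gal: "\<sigma> \<in> carrier (Gal L F) \<Longrightarrow> opt b \<sigma> \<in> carrier (Gal L F)"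
  by (rule opt_closed)

lemma Gal_cancel:
  assumes "\<sigma> \<in> carrier (Gal L F)" "\<sigma> \<circ> \<alpha> = \<sigma> \<circ> \<beta>"
  shows "\<alpha> = \<beta>"
proof
  fix z
  show "\<alpha> z = \<beta> z"
    using fun_cong[OF assms(2), of z] Gal_inv_apply(1)[OF sfL FL assms(1)] by (metis comp_apply)
qed

text \<open>The exponents are read off one at a time: \<open>g\<close>, \<open>d2\<close>,
  \<open>d3\<close>, \<open>d4\<close>, \<open>d5\<close> are negated by \<open>x\<close>,
  \<open>y\<close>, \<open>x^2\<close>, \<open>t\<close>, \<open>c\<close> respectively and fixed by
  the letters further to the right. Letters to the left whose action on the detecting element is
  unknown are cancelled beforehand.\<close>

lemma nf1_injective:
  assumes C: "x \<in> carrier (Gal L F)" "y \<in> carrier (Gal L F)"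
    and tc: "commutator (Gal L F) x y = t" "commutator (Gal L F) t x = c"
    and dL: "d2 \<in> L" "d2 \<noteq> 0" "d3 \<noteq> 0" "d4 \<noteq> 0" "d5 \<noteq> 0" "d3 \<in> L" "d4 \<in> L"
    and g: "x g = - g" "y g = g" "t g = g" "c g = g"
    and d2: "x d2 = sg p d2" "y d2 = - d2" "t d2 = d2" "c d2 = d2"
    and d3: "(x \<circ> x) d3 = - d3" "t d3 = d3" "c d3 = d3"
    and d4: "(x \<circ> x) d4 = d4" "t d4 = - d4" "c d4 = d4" and d5: "c d5 = - d5"
    and eq: "nf1 x y e j f k l = nf1 x y e' j' f' k' l'"
  shows "e = e' \<and> j = j' \<and> f = f' \<and> k = k' \<and> l = l'"
proof -
  have tC: "t \<in> carrier (Gal L F)" and cC: "c \<in> carrier (Gal L F)" and uC: "x \<circ> x \<in> carrier (Gal L F)"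
    using C tc commutator_closed Gal_comp by metis+
  have nf: "nf1 x y e j f k l = opt e x \<circ> (opt j y \<circ> (opt f (x \<circ> x) \<circ> (opt k t \<circ> opt l c)))" for e j f k l
    unfolding nf1_def tc by simp
  have ug: "(x \<circ> x) g = g" "(x \<circ> x) d2 = d2"
    using g d2 GalD(7)[OF sfL C(1) gL] Gal_sg[OF C(1) dL(1)] by (simp_all add: sg_sg)
  have 1: "nf1 x y e j f k l g = sg e g" for e j f k l
    unfolding nf using g ug by (simp add: opt_fix opt_flip del: comp_apply add: comp_apply[of "opt _ _"])
  have e: "e = e'" using sg_inject[OF two g0] 1 eq by metis
  have 2: "nf1 x y e j f k l d2 = sg (j \<noteq> (e \<and> p)) d2" for e j f k l
  proof -
    have "nf1 x y e j f k l d2 = opt e x (sg j d2)"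
      unfolding nf using d2 ug by (simp add: opt_fix opt_flip del: comp_apply add: comp_apply[of "opt _ _"])
    also have "\<dots> = sg j (opt e x d2)" by (rule Gal_sg[OF opt_Gal[OF C(1)] dL(1)])
    also have "\<dots> = sg (j \<noteq> (e \<and> p)) d2" using d2(1) by (simp add: opt_apply sg_sg)
    finally show ?thesis .
  qed
  have "sg (j \<noteq> (e \<and> p)) d2 = sg (j' \<noteq> (e' \<and> p)) d2"
    unfolding 2[of e j f k l, symmetric] 2[of e' j' f' k' l', symmetric] eq ..
  then have "(j \<noteq> (e \<and> p)) = (j' \<noteq> (e' \<and> p))" by (rule sg_inject[OF two dL(2)])
  then have j: "j = j'" using e by blast
  define A where "A = (\<lambda>f k l. opt f (x \<circ> x) \<circ> (opt k t \<circ> opt l c))"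
  have AC: "A f k l \<in> carrier (Gal L F)" for f k l
    unfolding A_def by (intro Gal_comp opt_Gal uC tC cC)
  have "opt e x \<circ> (opt j y \<circ> A f k l) = opt e x \<circ> (opt j y \<circ> A f' k' l')"
    using eq unfolding nf e j A_def .
  then have A: "A f k l = A f' k' l'"
    by (rule Gal_cancel[OF opt_Gal[OF C(2)] Gal_cancel[OF opt_Gal[OF C(1)]]])
  have 3: "A f k l d3 = sg f d3" for f k l
    unfolding A_def using d3 by (simp add: opt_fix opt_flip del: comp_apply add: comp_apply[of "opt _ _"])
  have f: "f = f'" using sg_inject[OF two dL(3)] 3 A by metis
  have 4: "A f k l d4 = sg k d4" for f k l
  proof -
    have "A f k l d4 = opt f (x \<circ> x) (sg k d4)"
      unfolding A_def using d4 by (simp add: opt_fix opt_flip del: comp_apply add: comp_apply[of "opt _ _"])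
    also have "\<dots> = sg k (opt f (x \<circ> x) d4)" by (rule Gal_sg[OF opt_Gal[OF uC] dL(7)])
    finally show ?thesis using opt_fix[of "x \<circ> x" d4 f] d4(1) by simp
  qed
  have k: "k = k'" using sg_inject[OF two dL(4)] 4 A by metis
  have "opt f (x \<circ> x) \<circ> (opt k t \<circ> opt l c) = opt f (x \<circ> x) \<circ> (opt k t \<circ> opt l' c)"
    using A unfolding A_def f k .
  then have "opt l c = opt l' c"
    by (rule Gal_cancel[OF opt_Gal[OF tC] Gal_cancel[OF opt_Gal[OF uC]]])
  then have "sg l d5 = sg l' d5" using opt_flip[of c d5 l] opt_flip[of c d5 l'] d5 by simp
  then have "l = l'" using sg_inject[OF two dL(5)] by blast
  then show ?thesis using e j f k by blast
qed

text \<open>The exponents are again read off by detecting elements. After cancelling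
  \<open>x\<close>, \<open>y\<close>, \<open>z\<close>, the exponent of \<open>s\<close> is read
  from \<open>d4\<close> before that of \<open>t\<close> from \<open>d5\<close>, and
  \<open>d6\<close> detects \<open>w\<close>.\<close>

lemma nf2_injective:
  assumes C: "x \<in> carrier (Gal L F)" "y \<in> carrier (Gal L F)" "z \<in> carrier (Gal L F)"
    and tc: "commutator (Gal L F) x y = t" "commutator (Gal L F) x z = s" "commutator (Gal L F) y s = w"
    and dL: "d2 \<in> L" "d3 \<in> L" "d2 \<noteq> 0" "d3 \<noteq> 0" "d4 \<noteq> 0" "d5 \<noteq> 0" "d6 \<noteq> 0" "d5 \<in> L"
    and g: "x g = - g" "y g = g" "z g = g" "t g = g" "s g = g" "w g = g"
    and d2: "x d2 = d2" "y d2 = - d2" "z d2 = d2" "t d2 = d2" "s d2 = d2" "w d2 = d2"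
    and d3: "x d3 = d3" "y d3 = d3" "z d3 = - d3" "t d3 = d3" "s d3 = d3" "w d3 = d3"
    and d4: "t d4 = d4" "s d4 = - d4" "w d4 = d4" "d4 \<in> L"
    and d5: "t d5 = - d5" "s d5 = d5" "w d5 = d5" and d6: "w d6 = - d6"
    and eq: "nf2 x y z i j k l m n = nf2 x y z i' j' k' l' m' n'"
  shows "i = i' \<and> j = j' \<and> k = k' \<and> l = l' \<and> m = m' \<and> n = n'"
proof -
  have tC: "t \<in> carrier (Gal L F)" and sC: "s \<in> carrier (Gal L F)" and wC: "w \<in> carrier (Gal L F)"
    using C tc commutator_closed by metis+
  have nf: "nf2 x y z i j k l m n = opt i x \<circ> (opt j y \<circ> (opt k z \<circ> (opt l t \<circ> (opt m s \<circ> opt n w))))" for i j k l m n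
    unfolding nf2_def tc by simp
  have 1: "nf2 x y z i j k l m n g = sg i g" for i j k l m n
    unfolding nf using g by (simp add: opt_fix opt_flip)
  have i: "i = i'" using sg_inject[OF two g0] 1 eq by metis
  have 2: "nf2 x y z i j k l m n d2 = sg j d2" for i j k l m n
    unfolding nf using d2 Gal_sg[OF opt_Gal[OF C(1)] dL(1)] by (simp add: opt_fix opt_flip)
  have j: "j = j'" using sg_inject[OF two dL(3)] 2 eq by metis
  have 3: "nf2 x y z i j k l m n d3 = sg k d3" for i j k l m n
    unfolding nf using d3 Gal_sg[OF opt_Gal[OF C(1)] dL(2)] Gal_sg[OF opt_Gal[OF C(2)] dL(2)] by (simp add: opt_fix opt_flip)
  have k: "k = k'" using sg_inject[OF two dL(4)] 3 eq by metis
  define A where "A = (\<lambda>l m n. opt l t \<circ> (opt m s \<circ> opt n w))"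
  have AC: "A l m n \<in> carrier (Gal L F)" for l m n
    unfolding A_def by (intro Gal_comp opt_Gal sC tC wC)
  have "opt i x \<circ> (opt j y \<circ> (opt k z \<circ> A l m n)) = opt i x \<circ> (opt j y \<circ> (opt k z \<circ> A l' m' n'))"
    using eq unfolding nf i j k A_def .
  then have A: "A l m n = A l' m' n'"
    by (rule Gal_cancel[OF opt_Gal[OF C(3)] Gal_cancel[OF opt_Gal[OF C(2)] Gal_cancel[OF opt_Gal[OF C(1)]]]])
  have 4: "A l m n d4 = sg m d4" for l m n
    unfolding A_def using d4 Gal_sg[OF opt_Gal[OF tC] d4(4)] by (simp add: opt_fix opt_flip)
  have m: "m = m'" using sg_inject[OF two dL(5)] 4 A by metis
  have 5: "A l m n d5 = sg l d5" for l m n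
    unfolding A_def using d5 by (simp add: opt_fix opt_flip)
  have l: "l = l'" using sg_inject[OF two dL(6)] 5 A by metis
  have "opt l t \<circ> (opt m s \<circ> opt n w) = opt l t \<circ> (opt m s \<circ> opt n' w)"
    using A unfolding A_def l m .
  then have "opt n w = opt n' w"
    by (rule Gal_cancel[OF opt_Gal[OF sC] Gal_cancel[OF opt_Gal[OF tC]]])
  then have "sg n d6 = sg n' d6" using opt_flip[of w d6 n] opt_flip[of w d6 n'] d6 by simp
  then have "n = n'" using sg_inject[OF two dL(7)] by blast
  then show ?thesis using i j k l m by blast
qed

end

section \<open>Existence of automorphisms with prescribed signs\<close>

context root4
begin

lemma Aut_adjoin: "\<sigma> \<in> Aut (adjoin F S) \<Longrightarrow> \<sigma> \<in> Aut F \<and> (\<forall>x\<in>adjoin F S. \<sigma> x = x)"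
  using Gal_mono[OF adjoin_superset(1), of UNIV F S] AutD(3)[of \<sigma> "adjoin F S"] by blast

lemma ac_adjoin: "is_algebraic_closure_of (adjoin F S)"
  by (intro is_algebraic_closure_of_mono[OF ac] adjoin_superset is_subfield_adjoin)

lemma restr_apply: "x \<in> L \<Longrightarrow> restr L \<sigma> x = \<sigma> x"
  by (simp add: restr_def)

lemma gg_ir: "(i * r) * (i * r) = - g"
  unfolding g_def by (simp add: mult.assoc mult.left_commute)

text \<open>A lift of \<open>g\<close> to \<open>- g\<close> over \<open>F(i)\<close> sends
  \<open>r\<close> to a square root of \<open>- g = (i r)^2\<close>; if that is
  \<open>- (i r)\<close>, the cube of the lift has the right sign.\<close>

lemma ex_rotation:
  assumes "g \<notin> adjoin F {i}"
  shows "\<exists>\<rho>\<in>carrier (Gal L F). \<rho> i = i \<and> \<rho> r = i * r"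
proof -
  have "g * g \<in> adjoin F {i}" using adjoin_I(1)[OF g2] .
  then obtain \<tau> where "\<tau> \<in> Aut (adjoin F {i})" "\<tau> g = - g" using ex_Aut_sqrt[OF ac_adjoin _ assms] by blast
  then have t: "\<tau> \<in> Aut F" "\<tau> i = i" "\<tau> g = - g" using Aut_adjoin[of \<tau> "{i}"] adjoin_I(2)[of i "{i}" F] by auto
  define \<sigma> where "\<sigma> = restr L \<tau>"
  have s: "\<sigma> \<in> carrier (Gal L F)" "\<sigma> i = i" "\<sigma> g = - g"
    unfolding \<sigma>_def using restr_L[OF t(1)] t by (simp_all add: restr_apply)
  note S = Gal_simps[OF s(1)]
  have "\<sigma> r * \<sigma> r = (i * r) * (i * r)" using S(1)[of r r] s(3) unfolding gg_ir by (simp add: g_def)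
  then have "\<sigma> r = i * r \<or> \<sigma> r = - (i * r)" unfolding square_eq_iff .
  then show ?thesis
  proof
    assume "\<sigma> r = i * r" then show ?thesis using s by blast
  next
    assume sr: "\<sigma> r = - (i * r)"
    have "(\<sigma> \<circ> (\<sigma> \<circ> \<sigma>)) r = i * r" "(\<sigma> \<circ> (\<sigma> \<circ> \<sigma>)) i = i" using s S sr by simp_all
    then show ?thesis using Gal_comp[OF s(1) Gal_comp[OF s(1) s(1)]] by blast
  qed
qed

text \<open>A lift negating \<open>i\<close> over \<open>F(g)\<close> sends \<open>r\<close> to
  \<open>r\<close> or \<open>- r\<close>; the square of the rotation corrects the sign.\<close>

lemma ex_reflection:
  assumes "i \<notin> adjoin F {g}" and \<rho>: "\<rho> \<in> carrier (Gal L F)" "\<rho> i = i" "\<rho> r = i * r"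
  shows "\<exists>\<tau>\<in>carrier (Gal L F). \<tau> i = - i \<and> \<tau> r = r"
proof -
  have "i * i \<in> adjoin F {g}" unfolding i2 by (intro is_subfieldD(2,5)[OF is_subfield_adjoin])
  then obtain \<tau> where "\<tau> \<in> Aut (adjoin F {g})" "\<tau> i = - i" using ex_Aut_sqrt[OF ac_adjoin _ assms(1)] by blast
  then have t: "\<tau> \<in> Aut F" "\<tau> g = g" "\<tau> i = - i" using Aut_adjoin[of \<tau> "{g}"] adjoin_I(2)[of g "{g}" F] by auto
  define \<sigma> where "\<sigma> = restr L \<tau>"
  have s: "\<sigma> \<in> carrier (Gal L F)" "\<sigma> i = - i" "\<sigma> g = g"
    unfolding \<sigma>_def using restr_L[OF t(1)] t by (simp_all add: restr_apply)
  note S = Gal_simps[OF s(1)] and R = Gal_simps[OF \<rho>(1)]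
  have "\<sigma> r * \<sigma> r = r * r" using S(1)[of r r] s(3) by (simp add: g_def)
  then have "\<sigma> r = r \<or> \<sigma> r = - r" unfolding square_eq_iff .
  then show ?thesis
  proof
    assume "\<sigma> r = r" then show ?thesis using s by blast
  next
    assume sr: "\<sigma> r = - r"
    have "(\<sigma> \<circ> (\<rho> \<circ> \<rho>)) r = r" "(\<sigma> \<circ> (\<rho> \<circ> \<rho>)) i = - i" using s S R sr \<rho> by simp_all
    then show ?thesis using Gal_comp[OF s(1) Gal_comp[OF \<rho>(1) \<rho>(1)]] by blast
  qed
qed

lemma ex_pattern_moving:
  assumes d: "d \<in> L" "d * d \<in> adjoin F {i, g, r}" "d \<notin> adjoin F {i, g, r}"
  shows "\<exists>\<sigma> b0 b1 b2 b3. pattern \<sigma> b0 b1 b2 b3 \<and> \<sigma> d = - d"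
proof -
  obtain \<tau> where "\<tau> \<in> Aut (adjoin F {i, g, r})" and td: "\<tau> d = - d" using ex_Aut_sqrt[OF ac_adjoin d(2,3)] by blast
  then have t: "\<tau> \<in> Aut F" "\<tau> i = i" "\<tau> r = r"
    using Aut_adjoin[of \<tau> "{i, g, r}"] adjoin_I(2)[of _ "{i, g, r}" F] by auto
  have s: "restr L \<tau> \<in> carrier (Gal L F)" "restr L \<tau> i = i" "restr L \<tau> r = r" "restr L \<tau> d = - d"
    using restr_L[OF t(1)] t td d(1) by (simp_all add: restr_apply)
  then show ?thesis using ex_pattern[OF s(1-3)] by blast
qed

lemma b_in: "(u01 * u23) * (u01 * u23) \<in> F"
  unfolding sqb by (intro SF(2,7) g2)

text \<open>It suffices that \<open>u01 * u23\<close> lies outside \<open>F(i, g, r)\<close>: an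
  automorphism over that field negating it is an odd pattern. As \<open>r^2 = g\<close>, this
  requires both \<open>u01 * u23\<close> and its product with \<open>r\<close> to be outside
  \<open>F(i, g)\<close>.\<close>

lemma ex_odd_pattern:
  assumes gn: "g \<notin> adjoin F {i}" and bn: "u01 * u23 \<notin> adjoin F {i}" "u01 * u23 * g \<notin> adjoin F {i}"
  shows "\<exists>\<sigma> b0 b1 b2 b3. pattern \<sigma> b0 b1 b2 b3 \<and> ((b0 \<noteq> b1) \<noteq> b2) \<noteq> b3"
proof -
  let ?b = "u01 * u23" and ?P = "adjoin F {i}" and ?Q = "adjoin (adjoin F {i}) {g}"
  note SP = is_subfieldD[OF is_subfield_adjoin[of F "{i}"]]
  have iP: "i \<in> ?P" and g2P: "g * g \<in> ?P" and b2P: "?b * ?b \<in> ?P" using g2 b_in by (simp_all add: adjoin_I)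
  have bQ: "?b \<notin> ?Q" by (rule notin_adjoin_quadratic[OF is_subfield_adjoin b2P g2P bn two])
  \<comment> \<open>Squaring \<open>?b * r = u + v * g\<close> and comparing coefficients gives
    \<open>u^2 + v^2 g^2 = 0\<close>, so \<open>g\<close> would be \<open>i u / v\<close> up to
    sign, an element of \<open>F(i)\<close>.\<close>
  have brQ: "?b * r \<notin> ?Q"
  proof
    assume "?b * r \<in> ?Q"
    then obtain u v where uv: "?b * r = u + v * g" "u \<in> ?P" "v \<in> ?P"
      unfolding adjoin_quadratic[OF is_subfield_adjoin g2P] by blast
    have "(?b * ?b) * g = (?b * r) * (?b * r)" unfolding g_def by (simp add: algebra_simps)
    also have "\<dots> = (u * u + v * v * (g * g)) + 2 * u * v * g" unfolding uv(1) by (simp add: algebra_simps)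
    finally have eq: "(?b * ?b - 2 * u * v) * g = u * u + v * v * (g * g)" by (simp add: algebra_simps)
    have tP: "2 \<in> ?P" using twoF by (simp add: adjoin_I)
    have "?b * ?b - 2 * u * v = 0"
    proof (rule ccontr)
      assume nz: "?b * ?b - 2 * u * v \<noteq> 0"
      then have "g = (u * u + v * v * (g * g)) / (?b * ?b - 2 * u * v)" using eq by (simp add: field_simps)
      moreover have "\<dots> \<in> ?P" by (intro SP(3,4,7,8) uv tP b2P g2P)
      ultimately show False using gn by simp
    qed
    moreover have "?b * ?b \<noteq> 0" using sqb b0 by simp
    ultimately have v0: "v \<noteq> 0" and z: "u * u + v * v * (g * g) = 0" using eq by auto
    have "(i * u / v) * (i * u / v) = - (u * u) / (v * v)" by (simp add: mult.assoc mult.left_commute)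
    also have "\<dots> = g * g" using z v0 by (simp add: field_simps add_eq_0_iff)
    finally have "g * g = (i * u / v) * (i * u / v)" by (rule sym)
    then have "g = i * u / v \<or> g = - (i * u / v)" unfolding square_eq_iff .
    moreover have "i * u / v \<in> ?P" by (intro SP(4,8) iP uv)
    ultimately show False using gn SP(5) by metis
  qed
  have "?b \<notin> adjoin ?Q {r}"
  proof (rule notin_adjoin_quadratic[OF is_subfield_adjoin _ _ bQ brQ two])
    show "?b * ?b \<in> ?Q" using b2P by (rule adjoin_I)
    show "r * r \<in> ?Q" unfolding g_def[symmetric] by (simp add: adjoin_I)
  qed
  moreover have "adjoin ?Q {r} = adjoin F {i, g, r}" by (simp add: adjoin_adjoin insert_commute)
  ultimately obtain \<sigma> b0 b1 b2 b3 where p: "pattern \<sigma> b0 b1 b2 b3" "\<sigma> ?b = - ?b"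
    using ex_pattern_moving[of ?b] b_in adjoin_I(1) by (metis in_L(4,9) mult_in_L)
  have "sg (((b0 \<noteq> b1) \<noteq> b2) \<noteq> b3) ?b = sg True ?b" using pattern_b[OF p(1)] p(2) by simp
  then have "(((b0 \<noteq> b1) \<noteq> b2) \<noteq> b3) = True" by (rule sg_inject[OF two, rotated]) simp
  then have "((b0 \<noteq> b1) \<noteq> b2) \<noteq> b3" by (rule eqTrueE)
  then show ?thesis using p by blast
qed

text \<open>The norm from \<open>F(g)\<close> is multiplicative, so the norm of \<open>z^2\<close>
  is the square of the norm of \<open>z\<close>.\<close>

lemma norm_square:
  assumes "\<alpha> \<in> F" "\<beta> \<in> F" "z \<in> adjoin F {g}" "z * z = \<alpha> + \<beta> * g"
  shows "\<exists>f\<in>F. \<alpha> * \<alpha> - g * g * (\<beta> * \<beta>) = f * f"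
proof -
  obtain u v where uv: "z = u + v * g" "u \<in> F" "v \<in> F"
    using assms(3) unfolding adjoin_quadratic[OF sfF g2] by blast
  have "\<alpha> + \<beta> * g = (u * u + v * v * (g * g)) + 2 * u * v * g" using assms(4) unfolding uv(1) by (simp add: algebra_simps)
  then have eq: "(\<beta> - 2 * u * v) * g = u * u + v * v * (g * g) - \<alpha>" by (simp add: algebra_simps)
  have "\<beta> - 2 * u * v = 0"
  proof (rule ccontr)
    assume nz: "\<beta> - 2 * u * v \<noteq> 0"
    then have "g = (u * u + v * v * (g * g) - \<alpha>) / (\<beta> - 2 * u * v)" using eq by (simp add: field_simps)
    moreover have "\<dots> \<in> F" by (intro SF(3,4,7,8) uv twoF g2 assms)
    ultimately show False using gnF by simp
  qed
  then have "\<beta> = 2 * u * v" "\<alpha> = u * u + v * v * (g * g)" using eq by auto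
  then have "\<alpha> * \<alpha> - g * g * (\<beta> * \<beta>) = (u * u - v * v * (g * g)) * (u * u - v * v * (g * g))"
    by (simp add: algebra_simps)
  moreover have "u * u - v * v * (g * g) \<in> F" by (intro SF(4,7) uv g2)
  ultimately show ?thesis by blast
qed

text \<open>\<open>u02\<close> is a square root of \<open>1 - g\<close>. It stays outside
  \<open>F(i, g, r)\<close> because the norms of \<open>1 - g\<close> and \<open>- (1 - g)\<close>
  are \<open>- q^2\<close>, those of \<open>g (1 - g)\<close> and \<open>- g (1 - g)\<close> are
  \<open>g^2 q^2\<close>, and neither value is a square in \<open>F\<close>.\<close>

lemma ex_even_pattern:
  assumes iF: "i \<notin> F" and q: "q \<in> F" "1 - g * g = - (q * q)"
  shows "\<exists>\<sigma> b0 b1 b2 b3. pattern \<sigma> b0 b1 b2 b3 \<and> b0 \<noteq> b2 \<and> b1 \<noteq> b3"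
proof -
  let ?K = "adjoin F {g}" and ?Q = "adjoin (adjoin F {g}) {i}"
  note SK = is_subfieldD[OF is_subfield_adjoin[of F "{g}"]]
  have q0: "q \<noteq> 0" using b0 q(2) by auto
  have no: "f * f \<noteq> - (q * q)" if f: "f \<in> F" for f
  proof
    assume "f * f = - (q * q)"
    then have "(f / q) * (f / q) = i * i" using q0 unfolding i2 by (simp add: field_simps)
    then have "i = f / q \<or> i = - (f / q)" by (metis square_eq_iff minus_minus)
    then show False using iF SF(5,8) f q(1) by metis
  qed
  have no': "f * f \<noteq> g * g * (q * q)" if f: "f \<in> F" for f
  proof
    assume "f * f = g * g * (q * q)"
    then have "(f / q) * (f / q) = g * g" using q0 by (simp add: field_simps)
    then have "g = f / q \<or> g = - (f / q)" by (metis square_eq_iff minus_minus)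
    then show False using gnF SF(5,8) f q(1) by metis
  qed
  have n1: "u02 \<notin> ?K"
  proof
    assume "u02 \<in> ?K"
    then obtain f where "f \<in> F" "1 * 1 - g * g * ((-1) * (-1)) = f * f"
      using norm_square[of 1 "-1" u02] sqs(2) SF(2) SF(5)[OF SF(2)] by auto
    then show False using no[of f] q(2) by simp
  qed
  have n2: "u02 * i \<notin> ?K"
  proof
    assume "u02 * i \<in> ?K"
    moreover have "(u02 * i) * (u02 * i) = (u02 * u02) * (i * i)" by (simp add: algebra_simps)
    then have "(u02 * i) * (u02 * i) = (-1) + 1 * g" unfolding sqs(2) i2 by simp
    ultimately obtain f where "f \<in> F" "(-1) * (-1) - g * g * (1 * 1) = f * f"
      using norm_square[of "-1" 1 "u02 * i"] SF(2) SF(5)[OF SF(2)] by auto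
    then show False using no[of f] q(2) by simp
  qed
  have nn: "(- (g * g)) * (- (g * g)) - g * g * (1 * 1) = g * g * (q * q)"
    "(g * g) * (g * g) - g * g * ((-1) * (-1)) = g * g * (q * q)"
  proof -
    have "g * g * (g * g - 1) = g * g * (q * q)" using q(2) by (metis minus_diff_eq minus_minus)
    then show "(- (g * g)) * (- (g * g)) - g * g * (1 * 1) = g * g * (q * q)"
      "(g * g) * (g * g) - g * g * ((-1) * (-1)) = g * g * (q * q)" by (simp_all add: algebra_simps)
  qed
  have n3: "u02 * r \<notin> ?K"
  proof
    assume "u02 * r \<in> ?K"
    moreover have "(u02 * r) * (u02 * r) = (u02 * u02) * g" unfolding g_def by (simp add: algebra_simps)
    then have "(u02 * r) * (u02 * r) = (- (g * g)) + 1 * g" unfolding sqs(2) by (simp add: algebra_simps)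
    ultimately obtain f where "f \<in> F" "(- (g * g)) * (- (g * g)) - g * g * (1 * 1) = f * f"
      using norm_square[of "- (g * g)" 1 "u02 * r"] SF(2) SF(5)[OF g2] by blast
    then show False using no'[of f] nn by simp
  qed
  have n4: "u02 * r * i \<notin> ?K"
  proof
    assume "u02 * r * i \<in> ?K"
    moreover have "(u02 * r * i) * (u02 * r * i) = (u02 * u02) * g * (i * i)" unfolding g_def by (simp only: ac_simps)
    then have "(u02 * r * i) * (u02 * r * i) = (g * g) + (-1) * g" unfolding sqs(2) i2 by (simp add: algebra_simps)
    ultimately obtain f where "f \<in> F" "(g * g) * (g * g) - g * g * ((-1) * (-1)) = f * f"
      using norm_square[of "g * g" "-1" "u02 * r * i"] SF(5)[OF SF(2)] g2 by blast
    then show False using no'[of f] nn by simp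
  qed
  have gK: "g \<in> ?K" by (simp add: adjoin_I)
  have u2: "u02 * u02 \<in> ?K" unfolding sqs(2) by (intro SK(2,7) gK)
  have i2K: "i * i \<in> ?K" unfolding i2 by (intro SK(2,5))
  have ur2: "(u02 * r) * (u02 * r) \<in> ?K"
  proof -
    have "(u02 * r) * (u02 * r) = (u02 * u02) * g" unfolding g_def by (simp add: algebra_simps)
    then show ?thesis using SK(4)[OF u2 gK] by (simp only:)
  qed
  have nQ: "u02 \<notin> ?Q" "u02 * r \<notin> ?Q"
    by (rule notin_adjoin_quadratic[OF is_subfield_adjoin u2 i2K n1 n2 two],
        rule notin_adjoin_quadratic[OF is_subfield_adjoin ur2 i2K n3 n4 two])
  have "r * r \<in> ?Q" using adjoin_I(1)[OF gK] unfolding g_def .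
  then have "u02 \<notin> adjoin ?Q {r}"
    by (rule notin_adjoin_quadratic[OF is_subfield_adjoin adjoin_I(1)[OF u2] _ nQ two])
  moreover have N: "adjoin ?Q {r} = adjoin F {i, g, r}" by (simp add: adjoin_adjoin insert_commute)
  moreover have "u02 * u02 \<in> adjoin ?Q {r}" using u2 by (simp add: adjoin_I)
  ultimately obtain \<sigma> b0 b1 b2 b3 where p: "pattern \<sigma> b0 b1 b2 b3" "\<sigma> u02 = - u02"
    using ex_pattern_moving[of u02] by auto
  note B = actsD[OF p(1)[unfolded pattern_def]]
  have "sg (b0 \<noteq> b2) u02 = sg True u02" using B(5) p(2) by simp
  then have "(b0 \<noteq> b2) = True" by (rule sg_inject[OF two, rotated]) simp
  then have 1: "b0 \<noteq> b2" by (rule eqTrueE)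
  \<comment> \<open>The product of the \<open>s_k\<close> is \<open>i q\<close> up to sign and thus
    fixed by \<open>\<sigma>\<close>, so evenly many signs change; since \<open>b0\<close> and
    \<open>b2\<close> differ, so do \<open>b1\<close> and \<open>b3\<close>.\<close>
  have "(u01 * u23) * (u01 * u23) = (i * q) * (i * q)" unfolding sqb q(2) by (simp add: mult.assoc mult.left_commute)
  then have "u01 * u23 = i * q \<or> u01 * u23 = - (i * q)" unfolding square_eq_iff .
  moreover have "\<sigma> (i * q) = i * q" using Gal_simps(1)[OF B(1), of i q] B(2) GalD(4)[OF sfL B(1) q(1)] FL q(1) by auto
  moreover have "i * q \<in> L" using FL q(1) by auto
  ultimately have "\<sigma> (u01 * u23) = u01 * u23" using Gal_simps(2)[OF B(1), of "i * q"] by auto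
  then have "sg (((b0 \<noteq> b1) \<noteq> b2) \<noteq> b3) (u01 * u23) = sg False (u01 * u23)" using pattern_b[OF p(1)] by simp
  then have "(((b0 \<noteq> b1) \<noteq> b2) \<noteq> b3) = False" by (rule sg_inject[OF two, rotated]) simp
  then show ?thesis using 1 p(1) by blast
qed

end

text \<open>An automorphism is determined by its values on \<open>g\<close> and \<open>e\<close>,
  and the square of its value on \<open>e\<close> is \<open>e^2\<close> or the conjugate of
  \<open>e^2\<close>; this leaves four pairs of values. The powers of \<open>\<Sigma>\<close>
  realise them and are distinct because nonzero elements differ from their negatives.\<close>

lemma C4_extension:
  fixes F :: "'k::field set"
  assumes ac: "is_algebraic_closure_of F" and two: "(2::'k) \<noteq> 0" and gF: "g \<notin> F" and g2: "g * g \<in> F"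
    and e2: "e * e \<in> adjoin F {g}" and e0: "e \<noteq> 0"
    and S: "\<Sigma> \<in> Aut F" "\<Sigma> g = - g" "\<Sigma> e \<in> adjoin F {g, e}" "\<Sigma> (\<Sigma> e) = - e"
  shows "galois_ext F (adjoin F {g, e})" "Gal (adjoin F {g, e}) F \<cong> C4"
proof -
  define E where "E = adjoin F {g, e}"
  have sfF: "is_subfield F" using ac unfolding is_algebraic_closure_of_def by simp
  have sfE: "is_subfield E" unfolding E_def by (rule is_subfield_adjoin)
  have FE: "F \<subseteq> E" unfolding E_def by (rule adjoin_superset)
  have gE: "g \<in> E" and eE: "e \<in> E" and SeE: "\<Sigma> e \<in> E" unfolding E_def using S(3) by (simp_all add: adjoin_I)
  note SE = is_subfieldD[OF sfE]
  have neg: "- x \<noteq> x" if "x \<noteq> 0" for x :: 'k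
    using two that by (metis add.inverse_inverse add_eq_0_iff mult_2 mult_eq_0_iff)
  have g0: "g \<noteq> 0" using gF is_subfieldD(1)[OF sfF] by auto
  obtain u v where uv: "e * e = u + v * g" "u \<in> F" "v \<in> F"
    using e2 unfolding adjoin_quadratic[OF sfF g2] by blast
  have img: "(\<sigma> g = g \<and> (\<sigma> e = e \<or> \<sigma> e = - e)) \<or> (\<sigma> g = - g \<and> (\<sigma> e = \<Sigma> e \<or> \<sigma> e = - \<Sigma> e))"
    if s: "\<sigma> \<in> Aut F" for \<sigma>
  proof -
    have sq: "\<tau> e * \<tau> e = u + v * \<tau> g" if t: "\<tau> \<in> Aut F" for \<tau>
    proof -
      have "\<tau> e * \<tau> e = \<tau> (e * e)" by (simp add: AutD(2)[OF t])
      also have "\<dots> = u + v * \<tau> g" unfolding uv(1) by (simp add: AutD(1,2)[OF t] AutD(3)[OF t uv(2)] AutD(3)[OF t uv(3)])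
      finally show ?thesis .
    qed
    have "\<sigma> g * \<sigma> g = g * g" using AutD(2)[OF s, of g g] AutD(3)[OF s g2] by simp
    then have "\<sigma> g = g \<or> \<sigma> g = - g" unfolding square_eq_iff .
    then show ?thesis
    proof
      assume sg: "\<sigma> g = g"
      then have "\<sigma> e * \<sigma> e = e * e" using sq[OF s] uv(1) by simp
      then show ?thesis using sg unfolding square_eq_iff by blast
    next
      assume sg: "\<sigma> g = - g"
      then have "\<sigma> e * \<sigma> e = \<Sigma> e * \<Sigma> e" using sq[OF s] sq[OF S(1)] S(2) by simp
      then show ?thesis using sg unfolding square_eq_iff by blast
    qed
  qed
  have stable: "\<sigma> x \<in> E" if s: "\<sigma> \<in> Aut F" and x: "x \<in> E" for \<sigma> x
  proof -
    have "\<sigma> g \<in> E" using img[OF s] gE SE(5)[OF gE] by metis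
    moreover have "\<sigma> e \<in> E" using img[OF s] eE SE(5)[OF eE] SeE SE(5)[OF SeE] by metis
    ultimately have "\<sigma> d \<in> adjoin F {g, e}" if "d \<in> {g, e}" for d using that unfolding E_def by auto
    then show ?thesis using adjoin_stable[OF s _ x[unfolded E_def]] unfolding E_def by blast
  qed
  have tower: "sqrt_tower F [g, e]" using g2 e2 by simp
  show gal: "galois_ext F (adjoin F {g, e})"
    unfolding E_def[symmetric]
  proof (rule galois_ext_if_stable[OF ac sfE FE])
    show "\<sigma> x \<in> E" if "\<sigma> \<in> Aut F" "x \<in> E" for \<sigma> x using that by (rule stable)
    show "x \<in> F" if "x \<in> E" "\<And>\<sigma>. \<sigma> \<in> Aut F \<Longrightarrow> \<sigma> x = x" for x
      using sqrt_tower_fixed[OF ac two tower] that unfolding E_def by simp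
  qed
  define c where "c = restr E \<Sigma>"
  have c: "c \<in> carrier (Gal E F)"
    unfolding c_def by (rule restr_in_Gal[OF sfE is_subfield_UNIV _ FE _ S(1)]) (auto intro: stable)
  note D = GalD[OF sfE c]
  have cg: "c g = - g" and ce: "c e = \<Sigma> e" and cce: "c (\<Sigma> e) = - e"
    unfolding c_def using gE eE SeE S by (simp_all add: restr_def)
  have eqI: "\<sigma> = \<tau>" if "\<sigma> \<in> carrier (Gal E F)" "\<tau> \<in> carrier (Gal E F)" "\<sigma> g = \<tau> g" "\<sigma> e = \<tau> e" for \<sigma> \<tau>
    using Gal_adjoin_eqI[of \<sigma> F "{g, e}" \<tau>] that unfolding E_def by auto
  have c2: "c \<circ> c \<in> carrier (Gal E F)" "(c \<circ> c) g = g" "(c \<circ> c) e = - e"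
    using Gal_comp[OF c c] cg ce cce D(7)[OF gE] by simp_all
  have c3: "c \<circ> (c \<circ> c) \<in> carrier (Gal E F)" "(c \<circ> (c \<circ> c)) g = - g" "(c \<circ> (c \<circ> c)) e = - \<Sigma> e"
    using Gal_comp[OF c c2(1)] c2 cg ce D(7)[OF eE] by simp_all
  have c4: "c \<circ> (c \<circ> (c \<circ> c)) = id"
    by (rule eqI[OF Gal_comp[OF c c3(1)] Gal_id]) (use c3 cg cce D(7)[OF gE] D(7)[OF SeE] in simp_all)
  define f where "f = (\<lambda>k::int. if k = 0 then id else if k = 1 then c else if k = 2 then c \<circ> c else c \<circ> (c \<circ> c))"
  have C4: "carrier C4 = {0, 1, 2, 3}" by (auto simp: carrier_integer_mod_group)
  have fC: "f k \<in> carrier (Gal E F)" for k unfolding f_def using c c2(1) c3(1) Gal_id[of E F] by presburger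
  have c4': "c (c (c (c x))) = x" for x using fun_cong[OF c4, of x] by simp
  have fm: "f ((j + k) mod 4) = f j \<circ> f k" if "j \<in> carrier C4" "k \<in> carrier C4" for j k
  proof -
    have "j = 0 \<or> j = 1 \<or> j = 2 \<or> j = 3" "k = 0 \<or> k = 1 \<or> k = 2 \<or> k = 3" using that unfolding C4 by simp_all
    then show ?thesis by (elim disjE) (simp_all add: f_def fun_eq_iff c4')
  qed
  have "f \<in> hom C4 (Gal E F)" by (rule homI) (use fC fm in \<open>simp_all\<close>)
  moreover have "bij_betw f (carrier C4) (carrier (Gal E F))"
    unfolding bij_betw_def
  proof
    have v: "f 0 e = e" "f 1 e = \<Sigma> e" "f 2 e = - e" "f 3 e = - \<Sigma> e" "f 0 g = g" "f 1 g = - g" "f 2 g = g" "f 3 g = - g"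
      unfolding f_def using cg ce c2 c3 by simp_all
    have Se0: "\<Sigma> e \<noteq> 0" using e0 AutD(10)[OF S(1)] by simp
    have ne: "f 0 \<noteq> f 1" "f 0 \<noteq> f 2" "f 0 \<noteq> f 3" "f 1 \<noteq> f 2" "f 1 \<noteq> f 3" "f 2 \<noteq> f 3"
      using v neg[OF e0] neg[OF g0] neg[OF Se0] by metis+
    show "inj_on f (carrier C4)" unfolding C4 inj_on_def using ne by auto
    show "f ` carrier C4 = carrier (Gal E F)"
    proof
      show "f ` carrier C4 \<subseteq> carrier (Gal E F)" using fC by blast
      show "carrier (Gal E F) \<subseteq> f ` carrier C4"
      proof
        fix \<tau> assume t: "\<tau> \<in> carrier (Gal E F)"
        obtain \<sigma> where s: "\<sigma> \<in> Aut F" "\<And>x. x \<in> E \<Longrightarrow> \<sigma> x = \<tau> x" using Gal_extend[OF ac sfE FE t] by blast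
        have "(\<tau> g = g \<and> (\<tau> e = e \<or> \<tau> e = - e)) \<or> (\<tau> g = - g \<and> (\<tau> e = \<Sigma> e \<or> \<tau> e = - \<Sigma> e))"
          using img[OF s(1)] s(2)[OF gE] s(2)[OF eE] by simp
        then have "\<tau> = f 0 \<or> \<tau> = f 1 \<or> \<tau> = f 2 \<or> \<tau> = f 3" using eqI[OF t fC] v by metis
        then show "\<tau> \<in> f ` carrier C4" unfolding C4 by blast
      qed
    qed
  qed
  ultimately have "C4 \<cong> Gal E F" unfolding is_iso_def iso_def by blast
  then show "Gal (adjoin F {g, e}) F \<cong> C4" unfolding E_def[symmetric] using group.iso_sym[OF group_integer_mod_group] by blast
qed

section \<open>The stabiliser of g as a central product of dihedral groups\<close>

lemma (in group) nf2_mult_commutators: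
  assumes xyz: "x \<in> carrier G" "y \<in> carrier G" "z \<in> carrier G" and r: "G2_rels G x y z"
  shows "nf2 x y z i j k l m n \<otimes> commutator G x y = nf2 x y z i j k (\<not> l) m n" (is ?A)
    and "nf2 x y z i j k l m n \<otimes> commutator G x z = nf2 x y z i j k l (\<not> m) n" (is ?B)
    and "nf2 x y z i j k l m n \<otimes> commutator G y (commutator G x z) = nf2 x y z i j k l m (\<not> n)" (is ?C)
proof -
  define t s w where "t = commutator G x y" and "s = commutator G x z" and "w = commutator G y s"
  note R = G2_relations[OF xyz r, folded t_def s_def, folded w_def]
  note C = R(1-3) and E = R(4-24)
  note E' = E[THEN rewr_assoc, OF _ _ _]
  have D: "nf2 x y z i j k l m n = opt i x \<otimes> (opt j y \<otimes> (opt k z \<otimes> (opt l t \<otimes> (opt m s \<otimes> opt n w))))" for i j k l m n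
    unfolding nf2_def t_def[symmetric] s_def[symmetric] w_def[symmetric] ..
  show ?A unfolding D t_def[symmetric]
    by (cases i; cases j; cases k; cases l; cases m; cases n) (simp_all add: m_assoc xyz C E E')
  show ?B unfolding D s_def[symmetric]
    by (cases i; cases j; cases k; cases l; cases m; cases n) (simp_all add: m_assoc xyz C E E')
  show ?C unfolding D s_def[symmetric] w_def[symmetric]
    by (cases i; cases j; cases k; cases l; cases m; cases n) (simp_all add: m_assoc xyz C E E')
qed

text \<open>The right factor has no \<open>x\<close>, and the other letters commute except for the
  pairs \<open>y, s\<close> and \<open>z, t\<close> with commutator \<open>w\<close>. Collecting
  therefore only adds the bilinear term m j' + l k' to the exponent of \<open>w\<close>.\<close>

lemma (in group) nf2_mult_False:
  assumes xyz: "x \<in> carrier G" "y \<in> carrier G" "z \<in> carrier G" and r: "G2_rels G x y z"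
  shows "nf2 x y z i j k l m n \<otimes> nf2 x y z False j' k' l' m' n' =
    nf2 x y z i (j \<noteq> j') (k \<noteq> k') (l \<noteq> l') (m \<noteq> m') ((n \<noteq> (m \<and> j')) \<noteq> ((l \<and> k') \<noteq> n'))"
proof -
  note M = nf2_mult(2,3)[OF xyz r] nf2_mult_commutators[OF xyz r]
  let ?t = "commutator G x y" and ?s = "commutator G x z"
  let ?w = "commutator G y ?s" and ?n = "nf2 x y z i j k l m n"
  have nC: "?n \<in> carrier G" by (rule nf2_closed[OF xyz])
  have "?n \<otimes> nf2 x y z False j' k' l' m' n' =
      ?n \<otimes> opt j' y \<otimes> opt k' z \<otimes> opt l' ?t \<otimes> opt m' ?s \<otimes> opt n' ?w"
    unfolding nf2_def[of x y z False] using nC xyz by (simp add: m_assoc)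
  also have "?n \<otimes> opt j' y = nf2 x y z i (j \<noteq> j') k l m (n \<noteq> (m \<and> j'))"
    using M(1) nf2_closed[OF xyz] by (cases j') simp_all
  also have "\<dots> \<otimes> opt k' z = nf2 x y z i (j \<noteq> j') (k \<noteq> k') l m ((n \<noteq> (m \<and> j')) \<noteq> (l \<and> k'))"
    using M(2) nf2_closed[OF xyz] by (cases k') simp_all
  also have "\<dots> \<otimes> opt l' ?t = nf2 x y z i (j \<noteq> j') (k \<noteq> k') (l \<noteq> l') m ((n \<noteq> (m \<and> j')) \<noteq> (l \<and> k'))"
    using M(3) nf2_closed[OF xyz] by (cases l') simp_all
  also have "\<dots> \<otimes> opt m' ?s = nf2 x y z i (j \<noteq> j') (k \<noteq> k') (l \<noteq> l') (m \<noteq> m') ((n \<noteq> (m \<and> j')) \<noteq> (l \<and> k'))"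
    using M(4) nf2_closed[OF xyz] by (cases m') simp_all
  also have "\<dots> \<otimes> opt n' ?w = nf2 x y z i (j \<noteq> j') (k \<noteq> k') (l \<noteq> l') (m \<noteq> m') (((n \<noteq> (m \<and> j')) \<noteq> (l \<and> k')) \<noteq> n')"
    using M(5) nf2_closed[OF xyz] by (cases n') simp_all
  also have "(((n \<noteq> (m \<and> j')) \<noteq> (l \<and> k')) \<noteq> n') = ((n \<noteq> (m \<and> j')) \<noteq> ((l \<and> k') \<noteq> n'))" by blast
  finally show ?thesis .
qed

lemma (in group) G2_carrier:
  assumes xyz: "x \<in> carrier G" "y \<in> carrier G" "z \<in> carrier G" and r: "G2_rels G x y z"
    and gen: "generate G {x, y, z} = carrier G" and h: "h \<in> carrier G"
  shows "\<exists>i j k l m n. h = nf2 x y z i j k l m n"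
proof -
  define N where "N = {nf2 x y z i j k l m n | i j k l m n. True}"
  have inN: "nf2 x y z i j k l m n \<in> N" for i j k l m n unfolding N_def by blast
  have N_sub: "n \<in> carrier G" if "n \<in> N" for n using that nf2_closed[OF xyz] unfolding N_def by auto
  have step: "n \<otimes> s \<in> N" if nN: "n \<in> N" and s: "s \<in> {x, y, z}" for n s
  proof -
    obtain i j k l m p where n: "n = nf2 x y z i j k l m p" using nN unfolding N_def by blast
    show ?thesis unfolding n using s inN by (auto simp: nf2_mult[OF xyz r])
  qed
  have cl: "n \<otimes> g \<in> N" if "g \<in> generate G {x, y, z}" "n \<in> N" for g n
    using that
  proof (induction arbitrary: n rule: generate.induct)
    case one then show ?case using N_sub by simp
  next
    case (incl h) then show ?case using step by blast
  next
    case (inv h)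
    then show ?case using G2_rels_inv(1)[OF xyz r inv(1)] step by simp
  next
    case (eng h1 h2)
    then have "n \<otimes> h1 \<otimes> h2 \<in> N" by blast
    moreover have "h1 \<in> carrier G" "h2 \<in> carrier G" "n \<in> carrier G" using eng gen N_sub by simp_all
    ultimately show ?case by (simp add: m_assoc)
  qed
  have "\<one> \<in> N" using inN[of False False False False False False] by (simp add: nf2_def)
  then have "\<one> \<otimes> h \<in> N" by (rule cl[rotated]) (simp add: gen h)
  then show ?thesis using h unfolding N_def by simp
qed

context sqrt_ext
begin

text \<open>The stabiliser of \<open>g\<close> consists of the normal forms without
  \<open>x\<close>. Inside it \<open>y, s\<close> and \<open>z, t\<close> generate commuting
  dihedral groups that share the central element \<open>w\<close>.\<close>

lemma iso_DD:
  assumes xyz: "x \<in> carrier (Gal L F)" "y \<in> carrier (Gal L F)" "z \<in> carrier (Gal L F)" and r: "G2_rels (Gal L F) x y z"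
    and gen: "generate (Gal L F) {x, y, z} = carrier (Gal L F)"
    and inj: "\<And>i j k l m n i' j' k' l' m' n'. nf2 x y z i j k l m n = nf2 x y z i' j' k' l' m' n' \<Longrightarrow>
      i = i' \<and> j = j' \<and> k = k' \<and> l = l' \<and> m = m' \<and> n = n'"
    and ng: "\<And>i j k l m n. nf2 x y z i j k l m n g = sg i g"
  shows "Gal L (adjoin F {g}) \<cong> DD"
proof -
  let ?N = "nf2 x y z False"
  txt \<open>The first dihedral factor is generated by the rotation \<open>y [x, z]\<close> and the reflection \<open>y\<close>, the second one by
    \<open>z [x, y]\<close> and \<open>z\<close>; \<open>\<beta>\<close>, \<open>\<mu>\<close> and \<open>\<nu>\<close> are the exponents in the resulting normal form.\<close>
  define \<nu> :: "nat \<times> bool \<Rightarrow> bool" where "\<nu> = (\<lambda>(k, b). if b then k = 1 \<or> k = 2 else k = 2 \<or> k = 3)"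
  define \<mu> :: "nat \<times> bool \<Rightarrow> bool" where "\<mu> = (\<lambda>(k, b). odd k)"
  define \<beta> :: "nat \<times> bool \<Rightarrow> bool" where "\<beta> = (\<lambda>(k, b). odd k \<noteq> b)"
  define \<theta> where "\<theta> = (\<lambda>(p, q). ?N (\<beta> p) (\<beta> q) (\<mu> q) (\<mu> p) (\<nu> p \<noteq> \<nu> q))"
  have D8_bits: "\<beta> (p \<otimes>\<^bsub>D8\<^esub> q) = (\<beta> p \<noteq> \<beta> q)" "\<mu> (p \<otimes>\<^bsub>D8\<^esub> q) = (\<mu> p \<noteq> \<mu> q)"
    "\<nu> (p \<otimes>\<^bsub>D8\<^esub> q) = ((\<nu> p \<noteq> \<nu> q) \<noteq> (\<mu> p \<and> \<beta> q))"
    if "p \<in> carrier D8" "q \<in> carrier D8" for p q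
    by (rule D8_carrierE[OF that(1)]; rule D8_carrierE[OF that(2)]; simp add: D8_mult \<beta>_def \<mu>_def \<nu>_def)+
  have nG: "nf2 x y z i j k l m n \<in> carrier (Gal L F)" for i j k l m n by (rule nf2_closed[OF xyz])
  have M: "group (Gal L (adjoin F {g}))" by (rule group_Gal[OF sfL adjoin_g_subset])
  have one: "?N False False False False False = id"
    unfolding nf2_def by simp
  show ?thesis
  proof (rule iso_DD_of_hom[OF M, of \<theta>])
    show "\<theta> \<in> hom (D8 \<times>\<times> D8) (Gal L (adjoin F {g}))"
    proof (rule homI)
      fix P assume P: "P \<in> carrier (D8 \<times>\<times> D8)"
      show "\<theta> P \<in> carrier (Gal L (adjoin F {g}))"
        unfolding \<theta>_def Gal_adjoin_g_iff using nG ng by (cases P) simp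
      fix Q assume Q: "Q \<in> carrier (D8 \<times>\<times> D8)"
      obtain p q where p: "P = (p, q)" "p \<in> carrier D8" "q \<in> carrier D8" using P by (cases P) auto
      obtain p' q' where q: "Q = (p', q')" "p' \<in> carrier D8" "q' \<in> carrier D8" using Q by (cases Q) auto
      have "((\<nu> p \<noteq> \<nu> p') \<noteq> (\<mu> p \<and> \<beta> p')) \<noteq> ((\<nu> q \<noteq> \<nu> q') \<noteq> (\<mu> q \<and> \<beta> q')) \<longleftrightarrow>
          ((\<nu> p \<noteq> \<nu> q) \<noteq> (\<mu> p \<and> \<beta> p')) \<noteq> ((\<mu> q \<and> \<beta> q') \<noteq> (\<nu> p' \<noteq> \<nu> q'))" by argo
      then have "\<theta> (P \<otimes>\<^bsub>D8 \<times>\<times> D8\<^esub> Q) = \<theta> P \<otimes>\<^bsub>Gal L F\<^esub> \<theta> Q"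
        unfolding p(1) q(1) \<theta>_def mult_DirProd case_prod_conv D8_bits[OF p(2) q(2)] D8_bits[OF p(3) q(3)]
          nf2_mult_False[OF xyz r] by (simp only:)
      then show "\<theta> (P \<otimes>\<^bsub>D8 \<times>\<times> D8\<^esub> Q) = \<theta> P \<otimes>\<^bsub>Gal L (adjoin F {g})\<^esub> \<theta> Q" by (simp only: Gal_mult)
    qed
    show "carrier (Gal L (adjoin F {g})) \<subseteq> \<theta> ` carrier (D8 \<times>\<times> D8)"
    proof
      fix \<sigma> assume "\<sigma> \<in> carrier (Gal L (adjoin F {g}))"
      then have s: "\<sigma> \<in> carrier (Gal L F)" "\<sigma> g = g" unfolding Gal_adjoin_g_iff by auto
      obtain i j k l m n where nf: "\<sigma> = nf2 x y z i j k l m n" using G2_carrier[OF xyz r gen s(1)] by blast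
      have "sg i g = sg False g" using ng[of i j k l m n] s(2) nf by simp
      then have i: "i = False" by (rule sg_inject[OF two g0])
      have bits: "\<exists>p\<in>carrier D8. \<beta> p = b \<and> \<mu> p = m \<and> \<nu> p = n" for b m n
      proof -
        \<comment> \<open>The inverse of the coding: the eight elements of \<open>D8\<close>
          correspond to the eight triples of bits.\<close>
        define p :: "nat \<times> bool" where "p = (if m then (if b then (if n then 3 else 1) else (if n then 1 else 3)) else (if n then 2 else 0), m \<noteq> b)"
        have "p \<in> carrier D8" "\<beta> p = b" "\<mu> p = m" "\<nu> p = n"
          by (cases b; cases m; cases n; simp add: p_def D8_in \<beta>_def \<mu>_def \<nu>_def)+
        then show ?thesis by blast
      qed
      obtain p where p: "p \<in> carrier D8" "\<beta> p = j" "\<mu> p = m" "\<nu> p = n" using bits by blast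
      obtain q where q: "q \<in> carrier D8" "\<beta> q = k" "\<mu> q = l" "\<nu> q = False" using bits by blast
      have "\<sigma> = \<theta> (p, q)" unfolding nf i \<theta>_def using p q by simp
      moreover have "(p, q) \<in> carrier (D8 \<times>\<times> D8)" using p q by simp
      ultimately show "\<sigma> \<in> \<theta> ` carrier (D8 \<times>\<times> D8)" by (rule image_eqI)
    qed
    fix P assume P: "P \<in> carrier (D8 \<times>\<times> D8)"
    obtain p q where p: "P = (p, q)" "p \<in> carrier D8" "q \<in> carrier D8" using P by (cases P) auto
    have "\<theta> P = \<one>\<^bsub>Gal L (adjoin F {g})\<^esub> \<longleftrightarrow> \<not> \<beta> p \<and> \<not> \<beta> q \<and> \<not> \<mu> q \<and> \<not> \<mu> p \<and> \<nu> p = \<nu> q"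
    proof
      assume "\<theta> P = \<one>\<^bsub>Gal L (adjoin F {g})\<^esub>"
      then have "?N (\<beta> p) (\<beta> q) (\<mu> q) (\<mu> p) (\<nu> p \<noteq> \<nu> q) = ?N False False False False False"
        unfolding one Gal_one p(1) \<theta>_def by simp
      from inj[OF this] show "\<not> \<beta> p \<and> \<not> \<beta> q \<and> \<not> \<mu> q \<and> \<not> \<mu> p \<and> \<nu> p = \<nu> q" by blast
    next
      assume "\<not> \<beta> p \<and> \<not> \<beta> q \<and> \<not> \<mu> q \<and> \<not> \<mu> p \<and> \<nu> p = \<nu> q"
      then show "\<theta> P = \<one>\<^bsub>Gal L (adjoin F {g})\<^esub>" unfolding Gal_one p(1) \<theta>_def one[symmetric] by simp
    qed
    also have "\<dots> \<longleftrightarrow> P \<in> DD_kernel"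
      unfolding p(1) by (rule D8_carrierE[OF p(2)]; rule D8_carrierE[OF p(3)]; simp add: \<beta>_def \<mu>_def \<nu>_def)
    finally show "\<theta> P = \<one>\<^bsub>Gal L (adjoin F {g})\<^esub> \<longleftrightarrow> P \<in> DD_kernel" .
  qed
qed

end

section \<open>The three constructions of the extension\<close>

context root4
begin

lemma Gal_eqI:
  assumes "\<sigma> \<in> carrier (Gal L F)" "\<tau> \<in> carrier (Gal L F)" "\<sigma> i = \<tau> i" "\<sigma> r = \<tau> r" "\<sigma> u01 = \<tau> u01" "\<sigma> u02 = \<tau> u02"
    "\<sigma> u03 = \<tau> u03" "\<sigma> u12 = \<tau> u12" "\<sigma> u13 = \<tau> u13" "\<sigma> u23 = \<tau> u23"
  shows "\<sigma> = \<tau>"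
  using acts_unique[of \<sigma> "\<tau> i" "\<tau> r" "\<tau> u01" "\<tau> u02" "\<tau> u03" "\<tau> u12" "\<tau> u13" "\<tau> u23" \<tau>] assms
  unfolding acts_def by simp

lemma Gal_g_eq: "\<sigma> \<in> carrier (Gal L F) \<Longrightarrow> \<sigma> g = \<sigma> r * \<sigma> r"
  unfolding g_def by (simp add: Gal_simps)

lemma Gal_b:
  assumes "\<sigma> \<in> carrier (Gal L F)"
  shows "\<sigma> (u01 * u23) = \<sigma> u01 * \<sigma> u23"
  by (rule Gal_simps(1)[OF assms]) simp_all

lemma b_swap: "u12 * u03 = u01 * u23" "u23 * u01 = u01 * u23"
  using prod_eq by (simp_all add: mult.commute)

lemma adjoin_i: "i \<in> F \<Longrightarrow> adjoin F {i} = F"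
  using adjoin_least[OF sfF order_refl, of "{i}"] adjoin_superset(1)[where F = F and S = "{i}"] by blast

lemma subgroup_carrier: "subgroup (carrier (Gal L F)) (Gal L F)"
  by (rule subgroup_self)

lemma subgroup_generate: "S \<subseteq> carrier (Gal L F) \<Longrightarrow> subgroup (generate (Gal L F) S) (Gal L F)"
  by (rule generate_is_subgroup)

text \<open>\<open>x\<close> is the rotation without signs and \<open>y\<close> negates
  \<open>s0\<close> alone; as \<open>i\<close> is fixed, rotations and patterns exhaust the group.
  The exponents of the normal form are detected by \<open>g\<close>, the product of the
  \<open>s_k\<close>, \<open>r\<close>, \<open>u02\<close> and \<open>u01\<close>.\<close>

lemma G1_extension_if_i_in_F:
  assumes iF: "i \<in> F" and b: "u01 * u23 \<notin> F" "u01 * u23 * g \<notin> F"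
  shows "\<exists>E. galois_ext F E \<and> adjoin F {g} \<subseteq> E \<and> E \<subseteq> L \<and> Gal E F \<cong> C4 \<and> iso_G1 (Gal L F)"
proof -
  have gP: "g \<notin> adjoin F {i}" using gnF adjoin_i[OF iF] by simp
  obtain \<rho> where \<rho>: "\<rho> \<in> carrier (Gal L F)" "\<rho> i = i" "\<rho> r = i * r" using ex_rotation[OF gP] by blast
  have bP: "u01 * u23 \<notin> adjoin F {i}" "u01 * u23 * g \<notin> adjoin F {i}" using b adjoin_i[OF iF] by simp_all
  obtain \<sigma> b0 b1 b2 b3 where p: "pattern \<sigma> b0 b1 b2 b3" "((b0 \<noteq> b1) \<noteq> b2) \<noteq> b3"
    using ex_odd_pattern[OF gP bP] by blast
  have pG: "\<sigma> \<in> carrier (Gal L F)" using actsD(1)[OF p(1)[unfolded pattern_def]] .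
  note all = all_patterns[OF \<rho>(2,3) subgroup_carrier \<rho>(1) pG p]
  obtain d0 d1 d2 d3 :: bool where d: "acts \<rho> i (i * r) (sg (d0 \<noteq> d1) u12) (sg (d0 \<noteq> d2) u13) (sg (d0 \<noteq> d3) u01)
    (sg (d1 \<noteq> d2) u23) (sg (d1 \<noteq> d3) u02) (sg (d2 \<noteq> d3) u03)" using type_rotation[OF \<rho>] by blast
  obtain \<tau> where "pattern \<tau> (d0 \<noteq> False) (d1 \<noteq> False) (d2 \<noteq> False) (d3 \<noteq> False)" using all by blast
  from acts_comp_pattern[OF d this] obtain x where x: "acts x i (i * r) u12 u13 u01 u23 u02 u03" by auto
  obtain y where yp: "pattern y True False False False" using all by blast
  then have y: "acts y i r (- u01) (- u02) (- u03) u12 u13 u23" unfolding pattern_def by simp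
  note X = actsD[OF x] and Y = actsD[OF y]
  note SX = Gal_simps[OF X(1)] and SY = Gal_simps[OF Y(1)]
  define t where "t = x \<circ> (x \<circ> x) \<circ> (y \<circ> (x \<circ> y))"
  define c where "c = t \<circ> (x \<circ> (x \<circ> x) \<circ> (t \<circ> x))"
  have xx: "acts (x \<circ> x) i (- r) u23 u02 u12 u03 u13 u01"
    unfolding acts_def by (simp add: Gal_comp X SX)
  have t: "acts t i r (- u01) (- u02) u03 u12 (- u13) (- u23)"
    unfolding acts_def t_def by (simp add: Gal_comp X Y SX SY)
  note T = actsD[OF t] and ST = Gal_simps[OF actsD(1)[OF t]]
  have c: "acts c i r (- u01) u02 (- u03) (- u12) u13 (- u23)"
    unfolding acts_def c_def by (simp add: Gal_comp X T SX ST)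
  note C = actsD[OF c] and SC = Gal_simps[OF actsD(1)[OF c]]
  have x4: "x \<circ> x \<circ> (x \<circ> x) = id" by (rule Gal_eqI) (simp_all add: Gal_comp Gal_id X SX)
  have y2: "y \<circ> y = id" by (rule Gal_eqI) (simp_all add: Gal_comp Gal_id Y SY)
  have t2: "t \<circ> t = id" by (rule Gal_eqI) (simp_all add: Gal_comp Gal_id T ST)
  have c2: "c \<circ> c = id" by (rule Gal_eqI) (simp_all add: Gal_comp Gal_id C SC)
  have cx: "c \<circ> x = x \<circ> c" by (rule Gal_eqI) (simp_all add: Gal_comp X C SX SC)
  have cy: "c \<circ> y = y \<circ> c" by (rule Gal_eqI) (simp_all add: Gal_comp Y C SY SC)
  note rels = G1_relsI[OF X(1) Y(1), unfolded Gal_mult Gal_one, OF x4 y2 t_def t2 c_def c2 cx cy]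
  let ?H = "generate (Gal L F) {x, y}"
  have sub: "{x, y} \<subseteq> carrier (Gal L F)" using X(1) Y(1) by simp
  have H: "subgroup ?H (Gal L F)" by (rule subgroup_generate[OF sub])
  have xH: "x \<in> ?H" and yH: "y \<in> ?H" by (simp_all add: generate.incl)
  have gen: "?H = carrier (Gal L F)"
    by (rule generated[OF H xH X(2,3)]) (use iF all_patterns[OF X(2,3) H xH yH yp] in simp_all)
  have iso: "iso_G1 (Gal L F)"
  proof (rule iso_G1I[OF X(1) Y(1) rels(3) gen], rule nf1_injective[OF X(1) Y(1) rels(1,2)])
    show "u01 * u23 \<in> L" "u01 * u23 \<noteq> 0" "r \<noteq> 0" "u02 \<noteq> 0" "u01 \<noteq> 0" "r \<in> L" "u02 \<in> L" by simp_all
    show "x g = - g" "y g = g" "t g = g" "c g = g"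
      using Gal_g_eq[OF X(1)] Gal_g_eq[OF Y(1)] Gal_g_eq[OF T(1)] Gal_g_eq[OF C(1)] gg_ir
      by (simp_all only: X Y T C g_def)
    show "x (u01 * u23) = sg False (u01 * u23)" "y (u01 * u23) = - (u01 * u23)" "t (u01 * u23) = u01 * u23" "c (u01 * u23) = u01 * u23"
      using Gal_b[OF X(1)] Gal_b[OF Y(1)] Gal_b[OF T(1)] Gal_b[OF C(1)] b_swap by (simp_all add: X Y T C)
    show "(x \<circ> x) r = - r" "t r = r" "c r = r" "(x \<circ> x) u02 = u02" "t u02 = - u02" "c u02 = u02" "c u01 = - u01"
      by (rule actsD[OF xx] T C)+
  qed
  \<comment> \<open>The cyclic quartic field is \<open>F(r)\<close>: with \<open>i\<close> in
    \<open>F\<close> it is a Kummer extension by a fourth root, on which \<open>x\<close> acts by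
    \<open>r\<close> to \<open>i r\<close>.\<close>
  obtain \<Sigma> where S: "\<Sigma> \<in> Aut F" "\<And>v. v \<in> L \<Longrightarrow> \<Sigma> v = x v" using Gal_extend[OF ac sfL FL X(1)] by blast
  have Sr: "\<Sigma> r = i * r" using S(2)[of r] X(3) by simp
  have irE: "i * r \<in> adjoin F {g, r}"
    by (intro is_subfieldD(4)[OF is_subfield_adjoin]) (use iF in \<open>simp_all add: adjoin_I\<close>)
  have "r * r \<in> adjoin F {g}" unfolding g_def[symmetric] by (simp add: adjoin_I)
  moreover have "\<Sigma> g = - g" using S(2)[of g] Gal_g_eq[OF X(1)] X(3) gg_ir by simp
  moreover have "\<Sigma> (\<Sigma> r) = - r" unfolding Sr using S(2)[of "i * r"] SX X by simp
  ultimately have "galois_ext F (adjoin F {g, r})" "Gal (adjoin F {g, r}) F \<cong> C4"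
    using C4_extension[OF ac two gnF g2 _ r0 S(1)] irE Sr by simp_all
  moreover have "adjoin F {g} \<subseteq> adjoin F {g, r}"
    by (intro adjoin_least is_subfield_adjoin adjoin_superset) (simp add: adjoin_I)
  moreover have "adjoin F {g, r} \<subseteq> L" by (intro adjoin_least sfL FL) simp
  ultimately show ?thesis using iso by blast
qed

text \<open>The product of the \<open>s_k\<close> is \<open>i q\<close> up to sign with
  \<open>q\<close> in \<open>F\<close>, so it is negated by the same automorphisms as
  \<open>i\<close>.\<close>

lemma pattern_even:
  assumes q: "q \<in> F" "1 - g * g = - (q * q)" and s: "\<sigma> \<in> carrier (Gal L F)" "\<sigma> i = sg n i"
    and par: "\<sigma> (u01 * u23) = sg m (u01 * u23)"
  shows "m = n"
proof -
  have "(u01 * u23) * (u01 * u23) = (i * q) * (i * q)" unfolding sqb q(2) by (simp add: mult.assoc mult.left_commute)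
  then have e: "u01 * u23 = i * q \<or> u01 * u23 = - (i * q)" unfolding square_eq_iff .
  have qL: "q \<in> L" using FL q(1) by blast
  have "\<sigma> (i * q) = sg n (i * q)" using Gal_simps(1)[OF s(1) in_L(1) qL] s(2) GalD(4)[OF sfL s(1) q(1)] by (simp add: sg_def)
  then have "\<sigma> (u01 * u23) = sg n (u01 * u23)" using e Gal_simps(2)[OF s(1), of "i * q"] qL by (auto simp: sg_def)
  then have "sg m (u01 * u23) = sg n (u01 * u23)" using par by simp
  then show ?thesis by (rule sg_inject[OF two, rotated]) simp
qed

text \<open>\<open>x\<close> is the reflection exchanging \<open>s0\<close> with \<open>s1\<close>
  and \<open>s2\<close> with \<open>s3\<close>, \<open>y\<close> the one exchanging
  \<open>s1\<close> with \<open>s3\<close>. Both negate \<open>i\<close>, so each carries one sign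
  in order to negate the product of the \<open>s_k\<close>. Then \<open>x \<circ> y\<close> is a
  rotation and \<open>x \<circ> x\<close> negates two neighbours, which generates
  everything.\<close>

lemma G1_extension_if_b_is_minus_square:
  assumes iF: "i \<notin> F" and ig: "i \<notin> adjoin F {g}" and gi: "g \<notin> adjoin F {i}" and q: "q \<in> F" "1 - g * g = - (q * q)"
  shows "\<exists>E. galois_ext F E \<and> adjoin F {g} \<subseteq> E \<and> E \<subseteq> L \<and> Gal E F \<cong> C4 \<and> iso_G1 (Gal L F)"
proof -
  obtain \<rho> where \<rho>: "\<rho> \<in> carrier (Gal L F)" "\<rho> i = i" "\<rho> r = i * r" using ex_rotation[OF gi] by blast
  obtain \<tau> where \<tau>: "\<tau> \<in> carrier (Gal L F)" "\<tau> i = - i" "\<tau> r = r" using ex_reflection[OF ig \<rho>] by blast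
  obtain \<sigma> b0 b1 b2 b3 where p: "pattern \<sigma> b0 b1 b2 b3" "b0 \<noteq> b2" "b1 \<noteq> b3"
    using ex_even_pattern[OF iF q] by blast
  have pG: "\<sigma> \<in> carrier (Gal L F)" using actsD(1)[OF p(1)[unfolded pattern_def]] .
  note all = even_patterns[OF \<rho>(2,3) subgroup_carrier \<rho>(1) pG p]
  have \<rho>\<tau>: "\<rho> \<circ> \<tau> \<in> carrier (Gal L F)" "(\<rho> \<circ> \<tau>) i = - i" "(\<rho> \<circ> \<tau>) r = i * r"
    using Gal_comp[OF \<rho>(1) \<tau>(1)] \<rho> \<tau> Gal_simps[OF \<rho>(1)] by simp_all
  obtain d0 d1 d2 d3 :: bool where d: "acts (\<rho> \<circ> \<tau>) (- i) (i * r) (sg (d0 \<noteq> d1) u01) (sg (d0 \<noteq> d2) u13) (sg (d0 \<noteq> d3) u12)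
    (sg (d1 \<noteq> d2) u03) (sg (d1 \<noteq> d3) u02) (sg (d2 \<noteq> d3) u23)" using type_edge_reflection[OF \<rho>\<tau>] by blast
  \<comment> \<open>The lift negates \<open>i\<close>, hence the product of the \<open>s_k\<close>,
    so its signs are odd in number. Removing all of them except a single one on \<open>s0\<close>
    takes an even pattern, and those are available.\<close>
  have "((d0 \<noteq> d1) \<noteq> (d2 \<noteq> d3)) = True"
    by (rule pattern_even[OF q \<rho>\<tau>(1)], use \<rho>\<tau>(2) in simp)
      (simp only: Gal_b[OF \<rho>\<tau>(1)] actsD(4,9)[OF d] sg_mult)
  then have "\<not> ((((d0 \<noteq> True) \<noteq> (d1 \<noteq> False)) \<noteq> (d2 \<noteq> False)) \<noteq> (d3 \<noteq> False))" by blast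
  from all[OF this] obtain \<sigma>' where "pattern \<sigma>' (d0 \<noteq> True) (d1 \<noteq> False) (d2 \<noteq> False) (d3 \<noteq> False)" by blast
  from acts_comp_pattern[OF d this]
  obtain x where x: "acts x (- i) (i * r) (- u01) (- u13) (- u12) u03 u02 u23" by auto
  obtain e0 e1 e2 e3 :: bool where e: "acts \<tau> (- i) r (sg (e0 \<noteq> e1) u03) (sg (e0 \<noteq> e2) u02) (sg (e0 \<noteq> e3) u01)
    (sg (e1 \<noteq> e2) u23) (sg (e1 \<noteq> e3) u13) (sg (e2 \<noteq> e3) u12)" using type_vertex_reflection[OF \<tau>] by blast
  have "((e0 \<noteq> e1) \<noteq> (e2 \<noteq> e3)) = True"
    by (rule pattern_even[OF q \<tau>(1)], use \<tau>(2) in simp)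
      (simp only: Gal_b[OF \<tau>(1)] actsD(4,9)[OF e] sg_mult prod_eq)
  then have "\<not> ((((e0 \<noteq> True) \<noteq> (e1 \<noteq> False)) \<noteq> (e2 \<noteq> False)) \<noteq> (e3 \<noteq> False))" by blast
  from all[OF this] obtain \<sigma>'' where "pattern \<sigma>'' (e0 \<noteq> True) (e1 \<noteq> False) (e2 \<noteq> False) (e3 \<noteq> False)" by blast
  from acts_comp_pattern[OF e this]
  obtain y where y: "acts y (- i) r (- u03) (- u02) (- u01) u23 u13 u12" by auto
  note X = actsD[OF x] and Y = actsD[OF y]
  note SX = Gal_simps[OF X(1)] and SY = Gal_simps[OF Y(1)]
  define t where "t = x \<circ> (x \<circ> x) \<circ> (y \<circ> (x \<circ> y))"
  define c where "c = t \<circ> (x \<circ> (x \<circ> x) \<circ> (t \<circ> x))"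
  have xx: "acts (x \<circ> x) i r u01 (- u02) (- u03) (- u12) (- u13) u23"
    unfolding acts_def by (simp add: Gal_comp X SX)
  have t: "acts t i (- r) u23 (- u02) (- u12) (- u03) (- u13) u01"
    unfolding acts_def t_def by (simp add: Gal_comp X Y SX SY)
  note T = actsD[OF t] and ST = Gal_simps[OF actsD(1)[OF t]]
  have c: "acts c i r (- u01) u02 (- u03) (- u12) u13 (- u23)"
    unfolding acts_def c_def by (simp add: Gal_comp X T SX ST)
  note C = actsD[OF c] and SC = Gal_simps[OF actsD(1)[OF c]]
  have x4: "x \<circ> x \<circ> (x \<circ> x) = id" by (rule Gal_eqI) (simp_all add: Gal_comp Gal_id X SX)
  have y2: "y \<circ> y = id" by (rule Gal_eqI) (simp_all add: Gal_comp Gal_id Y SY)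
  have t2: "t \<circ> t = id" by (rule Gal_eqI) (simp_all add: Gal_comp Gal_id T ST)
  have c2: "c \<circ> c = id" by (rule Gal_eqI) (simp_all add: Gal_comp Gal_id C SC)
  have cx: "c \<circ> x = x \<circ> c" by (rule Gal_eqI) (simp_all add: Gal_comp X C SX SC)
  have cy: "c \<circ> y = y \<circ> c" by (rule Gal_eqI) (simp_all add: Gal_comp Y C SY SC)
  note rels = G1_relsI[OF X(1) Y(1), unfolded Gal_mult Gal_one, OF x4 y2 t_def t2 c_def c2 cx cy]
  let ?H = "generate (Gal L F) {x, y}"
  have sub: "{x, y} \<subseteq> carrier (Gal L F)" using X(1) Y(1) by simp
  have H: "subgroup ?H (Gal L F)" by (rule subgroup_generate[OF sub])
  have xH: "x \<in> ?H" and yH: "y \<in> ?H" by (simp_all add: generate.incl)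
  have xyH: "x \<circ> y \<in> ?H" and xxH: "x \<circ> x \<in> ?H"
    using generate.eng[OF xH yH] generate.eng[OF xH xH] by (simp_all only: Gal_mult)
  have xyi: "(x \<circ> y) i = i" "(x \<circ> y) r = i * r" using X Y SX by simp_all
  have xxp: "pattern (x \<circ> x) True True False False" unfolding pattern_def using xx by simp
  have gen: "?H = carrier (Gal L F)"
  proof (rule generated[OF H xyH xyi, of y])
    show "i \<in> F \<or> y \<in> ?H \<and> y i = - i \<and> y r = r" using yH Y by simp
    fix \<sigma> b0 b1 b2 b3 assume p: "pattern \<sigma> b0 b1 b2 b3"
    note P = actsD[OF p[unfolded pattern_def]]
    have "(((b0 \<noteq> b1) \<noteq> b2) \<noteq> b3) = False"
      by (rule pattern_even[OF q P(1), of False]) (use P(2) pattern_b[OF p] in simp_all)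
    then show "\<exists>\<sigma>'\<in>?H. pattern \<sigma>' b0 b1 b2 b3"
      by (intro even_patterns[OF xyi H xyH xxH xxp]) simp_all
  qed
  have iso: "iso_G1 (Gal L F)"
  proof (rule iso_G1I[OF X(1) Y(1) rels(3) gen], rule nf1_injective[OF X(1) Y(1) rels(1,2)])
    show "i \<in> L" "i \<noteq> 0" "r * u13 \<noteq> 0" "r \<noteq> 0" "u01 \<noteq> 0" "r * u13 \<in> L" "r \<in> L" by simp_all
    show "x g = - g" "y g = g" "t g = g" "c g = g"
      using Gal_g_eq[OF X(1)] Gal_g_eq[OF Y(1)] Gal_g_eq[OF T(1)] Gal_g_eq[OF C(1)] gg_ir
      by (simp_all add: X Y T C g_def[symmetric])
    show "x i = sg True i" "y i = - i" "t i = i" "c i = i" by (simp_all add: X Y T C)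
    show "(x \<circ> x) (r * u13) = - (r * u13)" "t (r * u13) = r * u13" "c (r * u13) = r * u13"
      using Gal_simps(1)[OF actsD(1)[OF xx], of r u13] actsD(3,8)[OF xx] by (simp_all add: ST SC T C del: comp_apply)
    show "(x \<circ> x) r = r" "t r = - r" "c r = r" "c u01 = - u01"
      by (rule actsD[OF xx] T C)+
  qed
  obtain \<Sigma> where S: "\<Sigma> \<in> Aut F" "\<And>v. v \<in> L \<Longrightarrow> \<Sigma> v = x v" using Gal_extend[OF ac sfL FL X(1)] by blast
  \<comment> \<open>Generator of the cyclic quartic field: \<open>?e^2 = g (1 + g)\<close>, and
    \<open>?e * \<Sigma> ?e\<close> is \<open>i g\<close> times the product of the
    \<open>s_k\<close>, that is \<open>g q\<close> up to sign. Hence \<open>F(g, ?e)\<close>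
    contains the conjugate \<open>\<Sigma> ?e\<close>.\<close>
  let ?e = "r * u13"
  have Se: "\<Sigma> ?e = i * r * u02" using S(2)[of ?e] SX X by simp
  have SSe: "\<Sigma> (\<Sigma> ?e) = - ?e" unfolding Se using S(2)[of "i * r * u02"] SX X by (simp add: mult.assoc)
  have e0: "?e \<noteq> 0" by simp
  have ee: "?e * ?e = g * (1 + g)"
  proof -
    have "?e * ?e = (r * r) * (u13 * u13)" by (simp add: algebra_simps)
    then show ?thesis unfolding sqs(5) g_def .
  qed
  have e2: "?e * ?e \<in> adjoin F {g}"
    unfolding ee by (intro is_subfieldD(2,3,4)[OF is_subfield_adjoin]) (simp_all add: adjoin_I)
  have SeE: "\<Sigma> ?e \<in> adjoin F {g, ?e}"
  proof -
    have "(u01 * u23) * (u01 * u23) = (i * q) * (i * q)" unfolding sqb q(2) by (simp add: mult.assoc mult.left_commute)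
    then have b: "u01 * u23 = i * q \<or> u01 * u23 = - (i * q)" unfolding square_eq_iff .
    have "(i * r * u02) * ?e = i * g * (u02 * u13)" unfolding g_def by (simp add: mult.assoc mult.left_commute)
    also have "\<dots> = i * g * (u01 * u23)" unfolding prod_eq ..
    finally have m: "(i * r * u02) * ?e = i * g * (u01 * u23)" .
    have "(i * r * u02) * ?e = - (g * q) \<or> (i * r * u02) * ?e = g * q"
      unfolding m using b by (auto simp: mult.assoc mult.left_commute)
    then have "i * r * u02 = - (g * q) / ?e \<or> i * r * u02 = (g * q) / ?e"
      using e0 by (metis nonzero_mult_div_cancel_right)
    moreover have E: "g * q \<in> adjoin F {g, ?e}" "?e \<in> adjoin F {g, ?e}"
      using is_subfieldD(4)[OF is_subfield_adjoin[of F "{g, ?e}"], of g q] q(1) by (simp_all add: adjoin_I)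
    then have "(g * q) / ?e \<in> adjoin F {g, ?e}" "- (g * q) / ?e \<in> adjoin F {g, ?e}"
      using is_subfieldD(5,8)[OF is_subfield_adjoin[of F "{g, ?e}"]] by blast+
    ultimately show ?thesis unfolding Se by metis
  qed
  have "\<Sigma> g = - g" using S(2)[of g] Gal_g_eq[OF X(1)] X(3) gg_ir by simp
  then have "galois_ext F (adjoin F {g, ?e})" "Gal (adjoin F {g, ?e}) F \<cong> C4"
    using C4_extension[OF ac two gnF g2 e2 e0 S(1) _ SeE SSe] by simp_all
  moreover have "adjoin F {g} \<subseteq> adjoin F {g, ?e}"
    by (intro adjoin_least is_subfield_adjoin adjoin_superset) (simp add: adjoin_I)
  moreover have "adjoin F {g, ?e} \<subseteq> L" by (intro adjoin_least sfL FL) simp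
  ultimately show ?thesis using iso by blast
qed

text \<open>Every sign pattern occurs, so \<open>x\<close> and \<open>z\<close> can be the two
  reflections without signs and \<open>y\<close> the negation of \<open>s0\<close>. Up to the global
  sign, \<open>t\<close> negates \<open>s0\<close> and \<open>s1\<close>, \<open>s\<close> is the
  half turn, and \<open>w\<close> negates \<open>s0\<close> and \<open>s2\<close>.\<close>

lemma G2_extension:
  assumes ig: "i \<notin> adjoin F {g}" and gi: "g \<notin> adjoin F {i}"
    and b: "u01 * u23 \<notin> adjoin F {i}" "u01 * u23 * g \<notin> adjoin F {i}"
  shows "Gal L (adjoin F {g}) \<cong> DD" "iso_G2 (Gal L F)"
proof -
  obtain \<rho> where \<rho>: "\<rho> \<in> carrier (Gal L F)" "\<rho> i = i" "\<rho> r = i * r" using ex_rotation[OF gi] by blast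
  obtain \<tau> where \<tau>: "\<tau> \<in> carrier (Gal L F)" "\<tau> i = - i" "\<tau> r = r" using ex_reflection[OF ig \<rho>] by blast
  obtain \<sigma> b0 b1 b2 b3 where p: "pattern \<sigma> b0 b1 b2 b3" "((b0 \<noteq> b1) \<noteq> b2) \<noteq> b3"
    using ex_odd_pattern[OF gi b] by blast
  have pG: "\<sigma> \<in> carrier (Gal L F)" using actsD(1)[OF p(1)[unfolded pattern_def]] .
  note all = all_patterns[OF \<rho>(2,3) subgroup_carrier \<rho>(1) pG p]
  have \<rho>\<tau>: "\<rho> \<circ> \<tau> \<in> carrier (Gal L F)" "(\<rho> \<circ> \<tau>) i = - i" "(\<rho> \<circ> \<tau>) r = i * r"
    using Gal_comp[OF \<rho>(1) \<tau>(1)] \<rho> \<tau> Gal_simps[OF \<rho>(1)] by simp_all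
  obtain d0 d1 d2 d3 :: bool where d: "acts (\<rho> \<circ> \<tau>) (- i) (i * r) (sg (d0 \<noteq> d1) u01) (sg (d0 \<noteq> d2) u13) (sg (d0 \<noteq> d3) u12)
    (sg (d1 \<noteq> d2) u03) (sg (d1 \<noteq> d3) u02) (sg (d2 \<noteq> d3) u23)" using type_edge_reflection[OF \<rho>\<tau>] by blast
  obtain \<sigma>' where "pattern \<sigma>' (d0 \<noteq> False) (d1 \<noteq> False) (d2 \<noteq> False) (d3 \<noteq> False)" using all by blast
  from acts_comp_pattern[OF d this] obtain x where x: "acts x (- i) (i * r) u01 u13 u12 u03 u02 u23" by auto
  obtain y where yp: "pattern y True False False False" using all by blast
  then have y: "acts y i r (- u01) (- u02) (- u03) u12 u13 u23" unfolding pattern_def by simp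
  obtain e0 e1 e2 e3 :: bool where e: "acts \<tau> (- i) r (sg (e0 \<noteq> e1) u03) (sg (e0 \<noteq> e2) u02) (sg (e0 \<noteq> e3) u01)
    (sg (e1 \<noteq> e2) u23) (sg (e1 \<noteq> e3) u13) (sg (e2 \<noteq> e3) u12)" using type_vertex_reflection[OF \<tau>] by blast
  obtain \<sigma>'' where "pattern \<sigma>'' (e0 \<noteq> False) (e1 \<noteq> False) (e2 \<noteq> False) (e3 \<noteq> False)" using all by blast
  from acts_comp_pattern[OF e this] obtain z where z: "acts z (- i) r u03 u02 u01 u23 u13 u12" by auto
  note X = actsD[OF x] and Y = actsD[OF y] and Z = actsD[OF z]
  note SX = Gal_simps[OF X(1)] and SY = Gal_simps[OF Y(1)] and SZ = Gal_simps[OF Z(1)]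
  define t where "t = x \<circ> (y \<circ> (x \<circ> y))"
  define s where "s = x \<circ> (z \<circ> (x \<circ> z))"
  define w where "w = y \<circ> (s \<circ> (y \<circ> s))"
  have t: "acts t i r u01 (- u02) (- u03) (- u12) (- u13) u23"
    unfolding acts_def t_def by (simp add: Gal_comp X Y SX SY)
  note T = actsD[OF t] and ST = Gal_simps[OF actsD(1)[OF t]]
  have s: "acts s i (- r) u23 u02 u12 u03 u13 u01"
    unfolding acts_def s_def by (simp add: Gal_comp X Z SX SZ)
  note S = actsD[OF s] and SS = Gal_simps[OF actsD(1)[OF s]]
  have w: "acts w i r (- u01) u02 (- u03) (- u12) u13 (- u23)"
    unfolding acts_def w_def by (simp add: Gal_comp Y S SY SS)
  note W = actsD[OF w] and SW = Gal_simps[OF actsD(1)[OF w]]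
  have x2: "x \<circ> x = id" by (rule Gal_eqI) (simp_all add: Gal_comp Gal_id X SX)
  have y2: "y \<circ> y = id" by (rule Gal_eqI) (simp_all add: Gal_comp Gal_id Y SY)
  have z2: "z \<circ> z = id" by (rule Gal_eqI) (simp_all add: Gal_comp Gal_id Z SZ)
  have yz: "y \<circ> (z \<circ> (y \<circ> z)) = id" by (rule Gal_eqI) (simp_all add: Gal_comp Gal_id Y Z SY SZ)
  have t2: "t \<circ> t = id" by (rule Gal_eqI) (simp_all add: Gal_comp Gal_id T ST)
  have ss2: "s \<circ> s = id" by (rule Gal_eqI) (simp_all add: Gal_comp Gal_id S SS)
  have w_eq: "w = z \<circ> (t \<circ> (z \<circ> t))" by (rule Gal_eqI) (simp_all add: Gal_comp W T Z ST SZ)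
  have w2: "w \<circ> w = id" by (rule Gal_eqI) (simp_all add: Gal_comp Gal_id W SW)
  have wx: "w \<circ> x = x \<circ> w" by (rule Gal_eqI) (simp_all add: Gal_comp X W SX SW)
  have wy: "w \<circ> y = y \<circ> w" by (rule Gal_eqI) (simp_all add: Gal_comp Y W SY SW)
  have wz: "w \<circ> z = z \<circ> w" by (rule Gal_eqI) (simp_all add: Gal_comp Z W SZ SW)
  note rels = G2_relsI[OF X(1) Y(1) Z(1), unfolded Gal_mult Gal_one, OF x2 y2 z2 yz t_def t2 s_def ss2 w_def w_eq w2 wx wy wz]
  let ?H = "generate (Gal L F) {x, y, z}"
  have sub: "{x, y, z} \<subseteq> carrier (Gal L F)" using X(1) Y(1) Z(1) by simp
  have H: "subgroup ?H (Gal L F)" by (rule subgroup_generate[OF sub])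
  have xH: "x \<in> ?H" and yH: "y \<in> ?H" and zH: "z \<in> ?H" by (simp_all add: generate.incl)
  have xzH: "x \<circ> z \<in> ?H" using generate.eng[OF xH zH] by (simp only: Gal_mult)
  have xzi: "(x \<circ> z) i = i" "(x \<circ> z) r = i * r" using X Z SX by simp_all
  have gen: "?H = carrier (Gal L F)"
  proof (rule generated[OF H xzH xzi, of z])
    show "i \<in> F \<or> z \<in> ?H \<and> z i = - i \<and> z r = r" using zH Z by simp
    show "\<exists>\<sigma>'\<in>?H. pattern \<sigma>' b0 b1 b2 b3" for b0 b1 b2 b3
      by (rule all_patterns[OF xzi H xzH yH yp]) simp
  qed
  have gs: "x g = - g" "y g = g" "z g = g" "t g = g" "s g = g" "w g = g"
    using Gal_g_eq[OF X(1)] Gal_g_eq[OF Y(1)] Gal_g_eq[OF Z(1)] Gal_g_eq[OF T(1)] Gal_g_eq[OF S(1)] Gal_g_eq[OF W(1)] gg_ir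
    by (simp_all add: X Y Z T S W g_def[symmetric])
  \<comment> \<open>The detecting elements are \<open>g\<close> for \<open>x\<close>, the product of
    the \<open>s_k\<close> for \<open>y\<close>, \<open>i * g\<close> for \<open>z\<close>,
    \<open>r\<close> for \<open>s\<close>, \<open>u02\<close> for \<open>t\<close> and
    \<open>u01\<close> for \<open>w\<close>. The choice \<open>i * g\<close> works because
    \<open>x\<close> negates both factors.\<close>
  have inj: "j = j' \<and> k = k' \<and> l = l' \<and> m = m' \<and> n = n' \<and> p = p'"
    if "nf2 x y z j k l m n p = nf2 x y z j' k' l' m' n' p'" for j k l m n p j' k' l' m' n' p'
  proof (rule nf2_injective[OF X(1) Y(1) Z(1) rels(1-3) _ _ _ _ _ _ _ _ gs _ _ _ _ _ _ _ _ _ _ _ _ _ _ _ _ _ _ _ _ that])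
    show "u01 * u23 \<in> L" "i * g \<in> L" "u01 * u23 \<noteq> 0" "i * g \<noteq> 0" "r \<noteq> 0" "u02 \<noteq> 0" "u01 \<noteq> 0" "u02 \<in> L" "r \<in> L"
      by simp_all
    show "x (u01 * u23) = u01 * u23" "y (u01 * u23) = - (u01 * u23)" "z (u01 * u23) = u01 * u23"
      "t (u01 * u23) = u01 * u23" "s (u01 * u23) = u01 * u23" "w (u01 * u23) = u01 * u23"
      using Gal_b[OF X(1)] Gal_b[OF Y(1)] Gal_b[OF Z(1)] Gal_b[OF T(1)] Gal_b[OF S(1)] Gal_b[OF W(1)] prod_eq b_swap
      by (simp_all add: X Y Z T S W)
    show "x (i * g) = i * g" "y (i * g) = i * g" "z (i * g) = - (i * g)" "t (i * g) = i * g" "s (i * g) = i * g" "w (i * g) = i * g"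
      by (simp_all add: SX SY SZ ST SS SW X Y Z T S W gs)
    show "t r = r" "s r = - r" "w r = r" "t u02 = - u02" "s u02 = u02" "w u02 = u02" "w u01 = - u01"
      by (rule T S W)+
  qed
  show "iso_G2 (Gal L F)" by (rule iso_G2I[OF X(1) Y(1) Z(1) rels(4) gen inj])
  have ng: "nf2 x y z j k l m n p g = sg j g" for j k l m n p
    unfolding nf2_def rels(1-3) using gs by (simp add: opt_fix opt_flip)
  show "Gal L (adjoin F {g}) \<cong> DD" by (rule iso_DD[OF X(1) Y(1) Z(1) rels(4) gen inj ng])
qed

end

section \<open>The theorem\<close>

lemma ex_sqrt:
  assumes "algebraically_closed TYPE('k::field)"
  shows "\<exists>x::'k. x * x = c"
proof -
  have "degree [:- c, 0, 1:] > 0" by simp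
  then obtain x where "poly [:- c, 0, 1:] x = 0" using assms unfolding algebraically_closed_def by blast
  then show ?thesis by (intro exI[of _ x]) (simp add: algebra_simps)
qed

lemma ex_root4:
  fixes F :: "'k::field set"
  assumes ac: "is_algebraic_closure_of F" and two: "(2::'k) \<noteq> 0" and g: "g * g \<in> F" "g \<notin> F" and i: "i * i = -1"
  shows "\<exists>r s0 s1 s2 s3. root4 F i r s0 s1 s2 s3 \<and> r * r = g"
proof -
  have alg: "algebraically_closed TYPE('k)" using ac unfolding is_algebraic_closure_of_def by simp
  obtain r where r: "r * r = g" using ex_sqrt[OF alg] by blast
  obtain s0 s1 s2 s3 where "s0 * s0 = 1 + r" "s1 * s1 = 1 + i * r" "s2 * s2 = 1 - r" "s3 * s3 = 1 - i * r"
    using ex_sqrt[OF alg] by metis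
  then have "root4 F i r s0 s1 s2 s3" using ac two i g r by unfold_locales simp_all
  then show ?thesis using r by blast
qed

lemma adjoin_scaled_sqrt:
  assumes F: "is_subfield F" and e: "e \<in> F" "e \<noteq> 0"
  shows "adjoin F {g * e} = adjoin F {g}"
proof -
  note A = is_subfieldD[OF is_subfield_adjoin[of F "{g}"]] and B = is_subfieldD[OF is_subfield_adjoin[of F "{g * e}"]]
  have "g * e \<in> adjoin F {g}" by (intro A(4)) (use e in \<open>simp_all add: adjoin_I\<close>)
  moreover have "(g * e) / e \<in> adjoin F {g * e}" by (intro B(8)) (use e in \<open>simp_all add: adjoin_I\<close>)
  then have "g \<in> adjoin F {g * e}" using e by simp
  ultimately show ?thesis by (intro antisym adjoin_least is_subfield_adjoin adjoin_superset) simp_all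
qed

text \<open>The classes of 1 and \<open>- a\<close> are always represented, and \<open>- a\<close>
  inherits the side conditions of rigidity from \<open>a\<close>; so rigidity can fail only through
  a represented element outside these classes.\<close>

lemma not_rigid_iff:
  fixes F :: "'k::field set"
  assumes F: "is_subfield F" and a: "a \<in> F" "a \<noteq> 0" "a \<notin> {x * x | x. x \<in> F}" "a \<notin> {- (x * x) | x. x \<in> F}"
  shows "\<not> rigid F (- a) \<longleftrightarrow> (\<exists>u\<in>F. \<exists>v\<in>F. u * u - a * (v * v) \<noteq> 0 \<and>
    (\<forall>f\<in>F. u * u - a * (v * v) \<noteq> f * f \<and> u * u - a * (v * v) \<noteq> - (a * (f * f))))"
proof -
  note S = is_subfieldD[OF F]
  have base: "- a \<in> F - {0}" "- a \<notin> {x * x | x. x \<in> F}" "- a \<notin> {- (x * x) | x. x \<in> F}"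
    using a S(5)[OF a(1)] by (auto, metis minus_minus)
  let ?U = "nonzero_squares F \<union> (\<lambda>s. - a * s) ` nonzero_squares F"
  have sub: "?U \<subseteq> represented_1c F (- a)"
  proof
    fix x assume "x \<in> ?U"
    then obtain f where f: "f \<in> F" "f \<noteq> 0" and x: "x = f * f \<or> x = - a * (f * f)"
      unfolding nonzero_squares_def by auto
    then have "x \<noteq> 0" using a(2) by auto
    moreover have "x = f * f + - a * (0 * 0) \<or> x = 0 * 0 + - a * (f * f)" using x by auto
    ultimately show "x \<in> represented_1c F (- a)" unfolding represented_1c_def using f(1) S(1) by blast
  qed
  have "\<not> rigid F (- a) \<longleftrightarrow> (\<exists>x\<in>represented_1c F (- a). x \<notin> ?U)"
    unfolding rigid_def using base sub by blast
  also have "\<dots> \<longleftrightarrow> (\<exists>u\<in>F. \<exists>v\<in>F. u * u - a * (v * v) \<noteq> 0 \<and> u * u - a * (v * v) \<notin> ?U)"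
  proof
    assume "\<exists>x\<in>represented_1c F (- a). x \<notin> ?U"
    then obtain u v where "u \<in> F" "v \<in> F" "u * u + - a * (v * v) \<noteq> 0" "u * u + - a * (v * v) \<notin> ?U"
      unfolding represented_1c_def by blast
    then show "\<exists>u\<in>F. \<exists>v\<in>F. u * u - a * (v * v) \<noteq> 0 \<and> u * u - a * (v * v) \<notin> ?U"
      by (intro bexI[of _ u] bexI[of _ v]) simp_all
  next
    assume "\<exists>u\<in>F. \<exists>v\<in>F. u * u - a * (v * v) \<noteq> 0 \<and> u * u - a * (v * v) \<notin> ?U"
    then obtain u v where uv: "u \<in> F" "v \<in> F" "u * u - a * (v * v) \<noteq> 0" "u * u - a * (v * v) \<notin> ?U" by blast
    have "u * u - a * (v * v) = u * u + - a * (v * v)" by simp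
    then have "u * u - a * (v * v) \<in> represented_1c F (- a)" unfolding represented_1c_def using uv(1-3) by blast
    then show "\<exists>x\<in>represented_1c F (- a). x \<notin> ?U" using uv(4) by blast
  qed
  also have "\<dots> \<longleftrightarrow> (\<exists>u\<in>F. \<exists>v\<in>F. u * u - a * (v * v) \<noteq> 0 \<and>
    (\<forall>f\<in>F. u * u - a * (v * v) \<noteq> f * f \<and> u * u - a * (v * v) \<noteq> - (a * (f * f))))"
  proof -
    have "x \<in> ?U \<longleftrightarrow> (\<exists>f\<in>F. f \<noteq> 0 \<and> (x = f * f \<or> x = - (a * (f * f))))" for x
      unfolding nonzero_squares_def image_def by auto
    moreover have "f \<noteq> 0" if "x \<noteq> 0" "x = f * f \<or> x = - (a * (f * f))" for x f using that by auto
    ultimately have "x \<notin> ?U \<longleftrightarrow> (\<forall>f\<in>F. x \<noteq> f * f \<and> x \<noteq> - (a * (f * f)))" if "x \<noteq> 0" for x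
      using that by metis
    then show ?thesis by blast
  qed
  finally show ?thesis .
qed

text \<open>The cases are: -1 a square, a norm but no square, not a norm. In the first and the last,
  \<open>g\<close> is scaled by \<open>e = v / u\<close>, so that \<open>1 - (g e)^2\<close> is the
  given norm up to a square; in the middle one by \<open>d = q / p\<close>, which does the same for
  the norm -1.\<close>

lemma extension_of_new_norm:
  fixes F :: "'k::field set"
  assumes ac: "is_algebraic_closure_of F" and two: "(2::'k) \<noteq> 0" and g: "g * g \<in> F" "g \<notin> F"
    and na: "\<And>f. f \<in> F \<Longrightarrow> g * g \<noteq> - (f * f)"
    and uv: "u \<in> F" "v \<in> F" "u * u - g * g * (v * v) \<noteq> 0"
      "\<And>f. f \<in> F \<Longrightarrow> u * u - g * g * (v * v) \<noteq> f * f" "\<And>f. f \<in> F \<Longrightarrow> u * u - g * g * (v * v) \<noteq> - (g * g * (f * f))"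
  shows "(\<exists>E L. adjoin F {g} \<subseteq> E \<and> E \<subseteq> L \<and> galois_ext F E \<and> galois_ext F L \<and> Gal E F \<cong> C4 \<and> iso_G1 (Gal L F)) \<or>
    (\<exists>L. adjoin F {g} \<subseteq> L \<and> galois_ext F L \<and> Gal L (adjoin F {g}) \<cong> DD \<and> iso_G2 (Gal L F))"
proof -
  have sf: "is_subfield F" and alg: "algebraically_closed TYPE('k)" using ac unfolding is_algebraic_closure_of_def by auto
  note S = is_subfieldD[OF sf]
  have g0: "g \<noteq> 0" using g S(1) by auto
  have sq: "x \<in> F" if "x * x = f * f" "f \<in> F" for x f
    using that S(5) by (metis square_eq_iff)
  let ?b = "u * u - g * g * (v * v)"
  \<comment> \<open>\<open>u = 0\<close> or \<open>v = 0\<close> would put the norm into -aF^2 or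
    F^2.\<close>
  have u0: "u \<noteq> 0" using uv(5)[OF uv(2)] by auto
  have v0: "v \<noteq> 0" using uv(4)[OF uv(1)] by auto
  define e where "e = v / u"
  have e: "e \<in> F" "e \<noteq> 0" unfolding e_def using uv S(8) u0 v0 by auto
  have be: "1 - (g * e) * (g * e) = ?b / (u * u)"
    unfolding e_def using u0 by (simp add: field_simps)
  have scaled: "(g * c) * (g * c) \<in> F" "g * c \<notin> F" if "c \<in> F" "c \<noteq> 0" for c
  proof -
    have "(g * c) * (g * c) = g * g * (c * c)" by (simp add: algebra_simps)
    then show "(g * c) * (g * c) \<in> F" using S(4)[OF g(1) S(4)[OF that(1) that(1)]] by (simp only:)
    show "g * c \<notin> F"
    proof
      assume "g * c \<in> F"
      then have "g * c / c \<in> F" using S(8) that by blast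
      then show False using that g by simp
    qed
  qed
  \<comment> \<open>If \<open>g * c * i\<close> were in \<open>F\<close>, its square would exhibit
    \<open>a\<close> as the negative of a square.\<close>
  have ind: "i \<notin> adjoin F {g * c}" "g * c \<notin> adjoin F {i}" if i: "i * i = -1" "i \<notin> F" and c: "c \<in> F" "c \<noteq> 0" for i c
  proof -
    have "g * c * i \<notin> F"
    proof
      assume f: "g * c * i \<in> F"
      have "(g * c * i) * (g * c * i) = (g * g) * (c * c) * (i * i)" by (simp only: ac_simps)
      then have "g * g = - ((g * c * i / c) * (g * c * i / c))" using i c by (simp add: field_simps)
      then show False using na[OF S(8)[OF f c(1)]] by simp
    qed
    moreover have "i * i \<in> F" using i S(2,5) by simp
    ultimately show "i \<notin> adjoin F {g * c}" "g * c \<notin> adjoin F {i}"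
      using notin_adjoin_quadratic[OF sf _ _ _ _ two, of i "g * c"] notin_adjoin_quadratic[OF sf _ _ _ _ two, of "g * c" i]
        scaled[OF c] i by (simp_all add: mult.commute mult.left_commute)
  qed
  have G1: ?thesis if L: "\<exists>E. galois_ext F E \<and> adjoin F {g} \<subseteq> E \<and> E \<subseteq> L \<and> Gal E F \<cong> C4 \<and> iso_G1 (Gal L F)" "galois_ext F L" for L
    using that by blast
  have b_sq: "x * x * (u * u) = ?b" if "x * x = ?b / (u * u)" for x
    using that u0 by simp
  have no_b: "x \<notin> F" if "x * x = ?b / (u * u)" for x
  proof
    assume x: "x \<in> F"
    have "?b = (x * u) * (x * u)" using b_sq[OF that] by (simp add: algebra_simps)
    then show False using uv(4)[of "x * u"] S(4)[OF x uv(1)] by simp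
  qed
  show ?thesis
  proof (cases "\<exists>p\<in>F. \<exists>q\<in>F. -1 = p * p - g * g * (q * q)")
    case True
    then obtain p q where pq: "p \<in> F" "q \<in> F" "-1 = p * p - g * g * (q * q)" by blast
    show ?thesis
    proof (cases "\<exists>i\<in>F. i * i = -1")
      case True
      then obtain i where i: "i \<in> F" "i * i = -1" by blast
      obtain r s0 s1 s2 s3 where R: "root4 F i r s0 s1 s2 s3" and rr: "r * r = g * e"
        using ex_root4[OF ac two scaled[OF e] i(2)] by blast
      interpret R: root4 F i r s0 s1 s2 s3 by (rule R)
      have Rg: "R.g = g * e" using rr by (simp add: R.g_def)
      define \<beta> where "\<beta> = R.u01 * R.u23"
      have bb: "\<beta> * \<beta> = ?b / (u * u)" unfolding \<beta>_def R.sqb Rg be ..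
      have "\<beta> \<notin> F" by (rule no_b[OF bb])
      \<comment> \<open>Since \<open>i\<close> is in \<open>F\<close>, a value
        \<open>\<beta> * R.g\<close> in \<open>F\<close> would put the given norm into aF^2 =
        -aF^2.\<close>
      moreover have "\<beta> * R.g \<notin> F"
      proof
        assume f: "\<beta> * R.g \<in> F"
        define k where "k = i * (\<beta> * R.g * u / (g * g * e))"
        have kF: "k \<in> F" unfolding k_def by (intro S(4,8) f i uv e g)
        have "k * k = (i * i) * (\<beta> * \<beta>) * (u * u) / (g * g)"
          unfolding k_def Rg using g0 e(2) by (simp add: field_simps)
        then have "- (g * g * (k * k)) = ?b" using i(2) b_sq[OF bb] g0 by (simp add: field_simps)
        then show False using uv(5)[OF kF] by simp
      qed
      ultimately have "\<exists>E. galois_ext F E \<and> adjoin F {R.g} \<subseteq> E \<and> E \<subseteq> R.L \<and> Gal E F \<cong> C4 \<and> iso_G1 (Gal R.L F)"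
        unfolding \<beta>_def by (rule R.G1_extension_if_i_in_F[OF i(1)])
      then show ?thesis unfolding Rg adjoin_scaled_sqrt[OF sf e] by (rule G1[OF _ R.galois_L])
    next
      case False
      obtain i :: 'k where i: "i * i = -1" using ex_sqrt[OF alg] by blast
      have iF: "i \<notin> F" using False i by blast
      \<comment> \<open>\<open>p = 0\<close> would make \<open>g * q\<close> a square root of 1 and
        so put \<open>g\<close> into \<open>F\<close>; likewise \<open>q = 0\<close> below would
        make -1 a square.\<close>
      have p0: "p \<noteq> 0"
      proof
        assume "p = 0"
        then have gq: "(g * q) * (g * q) = 1 * 1" using pq(3) by (simp add: algebra_simps)
        then have "g * q \<in> F" by (rule sq[OF _ S(2)])
        moreover have "q \<noteq> 0" using gq by auto
        ultimately show False using scaled(2)[OF pq(2)] by blast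
      qed
      have q0: "q \<noteq> 0" using pq(3) False pq(1) by auto
      define d where "d = q / p"
      have d: "d \<in> F" "d \<noteq> 0" unfolding d_def using pq S(8) p0 q0 by auto
      obtain r s0 s1 s2 s3 where R: "root4 F i r s0 s1 s2 s3" and rr: "r * r = g * d"
        using ex_root4[OF ac two scaled[OF d] i] by blast
      interpret R: root4 F i r s0 s1 s2 s3 by (rule R)
      have Rg: "R.g = g * d" using rr by (simp add: R.g_def)
      have "1 - R.g * R.g = (p * p - g * g * (q * q)) / (p * p)"
        unfolding Rg d_def using p0 by (simp add: field_simps)
      then have m: "1 - R.g * R.g = - ((1 / p) * (1 / p))" unfolding pq(3)[symmetric] by simp
      have pF: "1 / p \<in> F" using S(8)[OF S(2) pq(1)] .
      have "\<exists>E. galois_ext F E \<and> adjoin F {R.g} \<subseteq> E \<and> E \<subseteq> R.L \<and> Gal E F \<cong> C4 \<and> iso_G1 (Gal R.L F)"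
        by (rule R.G1_extension_if_b_is_minus_square[OF iF _ _ pF m]) (use ind[OF i iF d] Rg in simp_all)
      then show ?thesis unfolding Rg adjoin_scaled_sqrt[OF sf d] by (rule G1[OF _ R.galois_L])
    qed
  next
    case False
    obtain i :: 'k where i: "i * i = -1" using ex_sqrt[OF alg] by blast
    have iF: "i \<notin> F"
    proof
      assume "i \<in> F"
      moreover have "-1 = i * i - g * g * (0 * 0)" using i by simp
      ultimately show False using False S(1) by blast
    qed
    obtain r s0 s1 s2 s3 where R: "root4 F i r s0 s1 s2 s3" and rr: "r * r = g * e"
      using ex_root4[OF ac two scaled[OF e] i] by blast
    interpret R: root4 F i r s0 s1 s2 s3 by (rule R)
    have Rg: "R.g = g * e" using rr by (simp add: R.g_def)
    define \<beta> where "\<beta> = R.u01 * R.u23"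
    have bb: "\<beta> * \<beta> = ?b / (u * u)" unfolding \<beta>_def R.sqb Rg be ..
    have n1: "\<beta> \<notin> F" by (rule no_b[OF bb])
    \<comment> \<open>If \<open>- ?b\<close> were a square \<open>k^2\<close>, dividing the norm
      \<open>?b\<close> by \<open>k^2\<close> would exhibit -1 as a norm.\<close>
    have n2: "\<beta> * i \<notin> F"
    proof
      assume f: "\<beta> * i \<in> F"
      define k where "k = \<beta> * i * u"
      have kF: "k \<in> F" unfolding k_def by (intro S(4) f uv)
      have "k * k = (\<beta> * \<beta> * (u * u)) * (i * i)" unfolding k_def by (simp only: ac_simps)
      then have kk: "?b = - (k * k)" using b_sq[OF bb] i by simp
      then have k0: "k \<noteq> 0" using uv(3) by auto
      have "(u / k) * (u / k) - g * g * ((v / k) * (v / k)) = ?b / (k * k)"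
        using k0 by (simp add: field_simps)
      then have "-1 = (u / k) * (u / k) - g * g * ((v / k) * (v / k))" unfolding kk using k0 by simp
      then show False using False S(8)[OF uv(1) kF] S(8)[OF uv(2) kF] by blast
    qed
    have gk: "(\<beta> * R.g * u / (g * g * e)) * (\<beta> * R.g * u / (g * g * e)) * (g * g) = ?b"
    proof -
      have "(\<beta> * R.g * u / (g * g * e)) * (\<beta> * R.g * u / (g * g * e)) * (g * g) = \<beta> * \<beta> * (u * u)"
        unfolding Rg using g0 e(2) by (simp add: field_simps)
      then show ?thesis using b_sq[OF bb] by simp
    qed
    \<comment> \<open>If \<open>?b = k^2 g^2\<close>, multiplying it by \<open>- g^2\<close>, the
      norm of \<open>g\<close>, would give minus a square, so -1 would again be a norm.\<close>
    have n3: "\<beta> * R.g \<notin> F"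
    proof
      assume f: "\<beta> * R.g \<in> F"
      define k where "k = \<beta> * R.g * u / (g * g * e)"
      have kF: "k \<in> F" unfolding k_def by (intro S(4,8) f uv e g)
      have kk: "k * k * (g * g) = ?b" unfolding k_def by (rule gk)
      then have k0: "k \<noteq> 0" using uv(3) by auto
      have "u * u = (k * k + v * v) * (g * g)" using kk by (simp add: algebra_simps)
      then have "g * g * ((u / (g * g * k)) * (u / (g * g * k))) = (k * k + v * v) / (k * k)"
        using g0 k0 by (simp add: field_simps)
      then have "-1 = (v / k) * (v / k) - g * g * ((u / (g * g * k)) * (u / (g * g * k)))"
        using k0 by (simp add: field_simps)
      moreover have "v / k \<in> F" "u / (g * g * k) \<in> F" by (intro S(4,8) uv kF g)+
      ultimately show False using False by blast
    qed
    \<comment> \<open>Here the norm would lie in -aF^2, which is excluded because it is new.\<close>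
    have n4: "\<beta> * R.g * i \<notin> F"
    proof
      assume f: "\<beta> * R.g * i \<in> F"
      define k where "k = \<beta> * R.g * i * u / (g * g * e)"
      have kF: "k \<in> F" unfolding k_def by (intro S(4,8) f uv e g)
      have "k * k = (\<beta> * R.g * u / (g * g * e)) * (\<beta> * R.g * u / (g * g * e)) * (i * i)"
        unfolding k_def by (simp add: ac_simps)
      then have "- (g * g * (k * k)) = ?b" unfolding i using gk by (simp add: ac_simps)
      then show False using uv(5)[OF kF] by simp
    qed
    have i2F: "i * i \<in> F" using i S(2,5) by simp
    have b2F: "\<beta> * \<beta> \<in> F" unfolding bb by (intro S(4,7,8) uv g)
    have bg2F: "(\<beta> * R.g) * (\<beta> * R.g) \<in> F"
    proof -
      have "(\<beta> * R.g) * (\<beta> * R.g) = (\<beta> * \<beta>) * (R.g * R.g)" by (simp only: ac_simps)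
      then show ?thesis using S(4)[OF b2F R.g2] by (simp only:)
    qed
    have "\<beta> \<notin> adjoin F {i}" by (rule notin_adjoin_quadratic[OF sf b2F i2F n1 n2 two])
    moreover have "\<beta> * R.g \<notin> adjoin F {i}" by (rule notin_adjoin_quadratic[OF sf bg2F i2F n3 n4 two])
    ultimately have "Gal R.L (adjoin F {R.g}) \<cong> DD" "iso_G2 (Gal R.L F)"
      using R.G2_extension ind[OF i iF e] unfolding \<beta>_def Rg by simp_all
    moreover have "adjoin F {R.g} \<subseteq> R.L" by (rule R.adjoin_g_subset)
    ultimately show ?thesis using R.galois_L unfolding Rg adjoin_scaled_sqrt[OF sf e] by blast
  qed
qed

theorem theorem5p2:
  fixes F :: "'k::field set" and a :: 'k
  assumes "is_algebraic_closure_of F"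
    and "(2::'k) \<noteq> 0"
    and "a \<in> F" and "a \<noteq> 0"
    and "a \<notin> {x * x | x. x \<in> F}" and "a \<notin> {- (x * x) | x. x \<in> F}"
  shows "\<not> rigid F (- a) \<longleftrightarrow>
    (\<exists>E L. is_subfield E \<and> is_subfield L \<and> F \<subseteq> adjoin_sqrt F a \<and> adjoin_sqrt F a \<subseteq> E \<and> E \<subseteq> L \<and>
        galois_ext F E \<and> galois_ext F L \<and> Gal E F \<cong> C4 \<and> iso_G1 (Gal L F)) \<or>
    (\<exists>L. is_subfield L \<and> F \<subseteq> adjoin_sqrt F a \<and> adjoin_sqrt F a \<subseteq> L \<and>
        galois_ext F L \<and> Gal L (adjoin_sqrt F a) \<cong> DD \<and> iso_G2 (Gal L F))"
proof -
  have sf: "is_subfield F" and alg: "algebraically_closed TYPE('k)"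
    using assms(1) unfolding is_algebraic_closure_of_def by auto
  obtain g where g: "g * g = a" using ex_sqrt[OF alg] by blast
  have gF: "g \<notin> F" using assms(5) g by blast
  have g2: "g * g \<in> F" using assms(3) g by simp
  have sqrt_a: "adjoin_sqrt F a = adjoin F {g}" by (rule adjoin_sqrt_eq[OF g])
  have FK: "F \<subseteq> adjoin F {g}" and gK: "g \<in> adjoin F {g}" using adjoin_superset[where F = F and S = "{g}"] by auto
  have sfE: "is_subfield E" if "galois_ext F E" for E using that unfolding galois_ext_def by blast
  note iff = not_rigid_iff[OF sf assms(3-6)]
  show ?thesis
    unfolding iff sqrt_a
  proof
    assume "\<exists>u\<in>F. \<exists>v\<in>F. u * u - a * (v * v) \<noteq> 0 \<and>
      (\<forall>f\<in>F. u * u - a * (v * v) \<noteq> f * f \<and> u * u - a * (v * v) \<noteq> - (a * (f * f)))"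
    then obtain u v where uv: "u \<in> F" "v \<in> F" "u * u - g * g * (v * v) \<noteq> 0"
      "\<And>f. f \<in> F \<Longrightarrow> u * u - g * g * (v * v) \<noteq> f * f" "\<And>f. f \<in> F \<Longrightarrow> u * u - g * g * (v * v) \<noteq> - (g * g * (f * f))"
      unfolding g by blast
    have na: "g * g \<noteq> - (f * f)" if "f \<in> F" for f using assms(6) that unfolding g by blast
    have "(\<exists>E L. adjoin F {g} \<subseteq> E \<and> E \<subseteq> L \<and> galois_ext F E \<and> galois_ext F L \<and> Gal E F \<cong> C4 \<and> iso_G1 (Gal L F)) \<or>
      (\<exists>L. adjoin F {g} \<subseteq> L \<and> galois_ext F L \<and> Gal L (adjoin F {g}) \<cong> DD \<and> iso_G2 (Gal L F))"
      by (rule extension_of_new_norm[OF assms(1,2) g2 gF na uv])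
    then show "(\<exists>E L. is_subfield E \<and> is_subfield L \<and> F \<subseteq> adjoin F {g} \<and> adjoin F {g} \<subseteq> E \<and> E \<subseteq> L \<and>
        galois_ext F E \<and> galois_ext F L \<and> Gal E F \<cong> C4 \<and> iso_G1 (Gal L F)) \<or>
      (\<exists>L. is_subfield L \<and> F \<subseteq> adjoin F {g} \<and> adjoin F {g} \<subseteq> L \<and>
        galois_ext F L \<and> Gal L (adjoin F {g}) \<cong> DD \<and> iso_G2 (Gal L F))"
      using FK sfE by meson
  next
    assume "(\<exists>E L. is_subfield E \<and> is_subfield L \<and> F \<subseteq> adjoin F {g} \<and> adjoin F {g} \<subseteq> E \<and> E \<subseteq> L \<and>
        galois_ext F E \<and> galois_ext F L \<and> Gal E F \<cong> C4 \<and> iso_G1 (Gal L F)) \<or>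
      (\<exists>L. is_subfield L \<and> F \<subseteq> adjoin F {g} \<and> adjoin F {g} \<subseteq> L \<and>
        galois_ext F L \<and> Gal L (adjoin F {g}) \<cong> DD \<and> iso_G2 (Gal L F))"
    then show "\<exists>u\<in>F. \<exists>v\<in>F. u * u - a * (v * v) \<noteq> 0 \<and>
      (\<forall>f\<in>F. u * u - a * (v * v) \<noteq> f * f \<and> u * u - a * (v * v) \<noteq> - (a * (f * f)))"
    proof (elim disjE exE conjE)
      fix E L assume E: "adjoin F {g} \<subseteq> E" "E \<subseteq> L" "galois_ext F E" "galois_ext F L" "Gal E F \<cong> C4" "iso_G1 (Gal L F)"
      then have gE: "g \<in> E" and gL: "g \<in> L" using gK by auto
      interpret sqrt_ext F L g using assms(1,2) E(4) gL gF g2 by unfold_locales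
      show ?thesis using norms_of_G1[OF E(6) E(2,3) gE E(5)] unfolding g .
    next
      fix L assume L: "adjoin F {g} \<subseteq> L" "galois_ext F L" "Gal L (adjoin F {g}) \<cong> DD" "iso_G2 (Gal L F)"
      then have gL: "g \<in> L" using gK by auto
      interpret sqrt_ext F L g using assms(1,2) L(2) gL gF g2 by unfold_locales
      show ?thesis using norms_of_G2[OF L(4,3)] unfolding g .
    qed
  qed
qed

end
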